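(* Let $\mathcal R\subseteq\Sigma_+$ be a subset of Hessenberg type, $\mathcal C=\Sigma_+\setminus\mathcal R$, and $\mathfrak q=N_{\mathfrak g}\mathfrak n_{\mathcal C}=\{X\in\mathfrak g:[X,Y]\in\mathfrak n_{\mathcal C}\ \forall\,Y\in\mathfrak n_{\mathcal C}\}$. For every $E\in\mathfrak q$, $\overline{\tau(E)}$ is a multicontact vector field on $S$. In particular, the map $\nu:\mathfrak q\to\mathfrak X(S)$ defined by $\nu(E)=\overline{\tau(E)}$ is a Lie algebra homomorphism. If $\Delta\subset\mathcal R$, then the kernel of $\nu$ is $\mathfrak n_{\mathcal C}$; thus $\nu(\mathfrak q)$ is isomorphic to $\mathfrak q/\mathfrak n_{\mathcal C}$.
   Context: $\mathfrak g$ is a real simple Lie algebra of real rank greater than one, with Cartan involution $\theta$, Cartan decomposition $\mathfrak g=\mathfrak k\oplus\mathfrak p$, $\mathfrak a\subset\mathfrak p$ maximal abelian, $\Sigma$ the restricted roots, $\mathfrak g_\alpha$ the restricted root spaces, $m_\alpha=\dim\mathfrak g_\alpha$, $\Sigma_+$ a positive system, $\Delta$ its simple roots, $\mathfrak n=\bigoplus_{\alpha\in\Sigma_+}\mathfrak g_\alpha$, $\overline{\mathfrak n}=\theta\mathfrak n$. $G=\mathrm{Int}(\mathfrak g)$, $K$ the connected subgroup with Lie algebra $\mathfrak k$, $M$ the centralizer of $\mathfrak a$ in $K$, $A=\exp\mathfrak a$, $N=\exp\mathfrak n$, $\overline N=\exp\overline{\mathfrak n}$, $P=MA\overline N$. The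 map $n\mapsto nP$ identifies $N$ with an open dense subset of $G/P$. A proper subset $\mathcal R\subset\Sigma_+$ is of Hessenberg type if $\alpha\in\mathcal R$, $\beta$ a negative root and $\alpha+\beta\in\Sigma_+$ imply $\alpha+\beta\in\mathcal R$. $\mathfrak n_{\mathcal C}=\bigoplus_{\alpha\in\mathcal C}\mathfrak g_\alpha$, an ideal of $\mathfrak n$. Fix a basis $\{E_{\alpha,j}\}_{j=1}^{m_\alpha}$ of each $\mathfrak g_\alpha$, $\alpha\in\Sigma_+$, and coordinates $n=\exp(\sum x_{\alpha,j}E_{\alpha,j})$ on $N$. $X_{\alpha,j}$ is the left-invariant vector field on $N$ equal to $\partial/\partial x_{\alpha,j}$ at the identity. $S=\{n\in N:x_{\alpha,j}=0\ \forall\alpha\in\mathcal C\}$; $\overline X_{\alpha,j}$ is the vector field on $S$ obtained from $X_{\alpha,j}$ by deleting its $\partial/\partial x_{\gamma,k}$-components with $\gamma\in\mathcal C$ (so $\overline X_{\alpha,j}=0$ for $\alpha\in\mathcal C$). $\mathfrak X(S)$ is the Lie algebra of smooth vector fields on $S$. A smooth vector field $F$ on $S$ is multicontact if for every $\delta\in\Delta\cap\mathcal R$ and $1\le i\le m_\delta$, $[F,\overline X_{\delta,i}]=\sum_k\lambda^i_{\delta,k}\overline X_{\delta,k}$ for some smooth functions $\lambda^i_{\delta,k}$. For $E\in\mathfrak g$, $\tau(E)$ is the vector field on $N$ given by $\tau(E)h(n)=\frac{d}{dt}h([\exp(-tE)n])\big|_{t=0}$, where for small $t$ the element $[\exp(-tE)n]\in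 N$ is determined by $\exp(-tE)n\in[\exp(-tE)n]P$. Writing $\tau(E)=\sum_{\gamma\in\Sigma_+}\sum_j f_{\gamma,j}X_{\gamma,j}$, $\overline{\tau(E)}$ is the vector field $\sum_{\gamma\in\mathcal R}\sum_j f_{\gamma,j}|_S\,\overline X_{\gamma,j}$ on $S$. *)

theory Defs
  imports "HOL-Analysis.Analysis" "HOL-Library.Function_Algebras"
begin

section \<open>Lie algebras with explicit carriers, homomorphisms, quotients\<close>

text \<open>As for the structures of HOL-Algebra, the record only collects the data; no axioms are imposed.\<close>
record 'a lie_alg =
  lcarrier :: "'a set"
  ladd :: "'a \<Rightarrow> 'a \<Rightarrow> 'a"
  lscale :: "real \<Rightarrow> 'a \<Rightarrow> 'a"
  lbracket :: "'a \<Rightarrow> 'a \<Rightarrow> 'a"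

definition lie_hom :: "'a lie_alg \<Rightarrow> 'b lie_alg \<Rightarrow> ('a \<Rightarrow> 'b) set" where
  "lie_hom L L' = {f.
     (\<forall>x\<in>lcarrier L. f x \<in> lcarrier L') \<and>
     (\<forall>x\<in>lcarrier L. \<forall>y\<in>lcarrier L. f (ladd L x y) = ladd L' (f x) (f y)) \<and>
     (\<forall>c. \<forall>x\<in>lcarrier L. f (lscale L c x) = lscale L' c (f x)) \<and>
     (\<forall>x\<in>lcarrier L. \<forall>y\<in>lcarrier L. f (lbracket L x y) = lbracket L' (f x) (f y))}"

definition lie_isomorphic :: "'a lie_alg \<Rightarrow> 'b lie_alg \<Rightarrow> bool" where
  "lie_isomorphic L L' \<longleftrightarrow> (\<exists>f\<in>lie_hom L L'. bij_betw f (lcarrier L) (lcarrier L'))"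

definition sub_lie :: "('g::real_vector \<Rightarrow> 'g \<Rightarrow> 'g) \<Rightarrow> 'g set \<Rightarrow> 'g lie_alg" where
  "sub_lie br V = \<lparr>lcarrier = V, ladd = (+), lscale = (*\<^sub>R), lbracket = br\<rparr>"

text \<open>\<open>V / I\<close>: the elements are the cosets \<open>X + I\<close>. Every operation adds \<open>I\<close> again, so that its value
  is a full coset (e.g. also for scaling by 0).\<close>
definition quot_lie :: "('g::real_vector \<Rightarrow> 'g \<Rightarrow> 'g) \<Rightarrow> 'g set \<Rightarrow> 'g set \<Rightarrow> 'g set lie_alg" where
  "quot_lie br V I = \<lparr>
     lcarrier = (\<lambda>X. {X + Z |Z. Z \<in> I}) ` V,
     ladd = (\<lambda>A B. {X + Y + Z |X Y Z. X \<in> A \<and> Y \<in> B \<and> Z \<in> I}),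
     lscale = (\<lambda>c A. {c *\<^sub>R X + Z |X Z. X \<in> A \<and> Z \<in> I}),
     lbracket = (\<lambda>A B. {br X Y + Z |X Y Z. X \<in> A \<and> Y \<in> B \<and> Z \<in> I})\<rparr>"

section \<open>Smooth vector fields on a linear subspace\<close>

text \<open>\<open>f\<close> has continuous directional derivatives up to order \<open>k\<close> along the subspace \<open>V\<close>. Only values
  of \<open>f\<close> on \<open>V\<close> matter.\<close>
primrec Ck_on :: "nat \<Rightarrow> 'a::real_normed_vector set \<Rightarrow> ('a \<Rightarrow> 'b::real_normed_vector) \<Rightarrow> bool" where
  "Ck_on 0 V f \<longleftrightarrow> continuous_on V f"
| "Ck_on (Suc k) V f \<longleftrightarrow> continuous_on V f \<and>
     (\<forall>v\<in>V. \<exists>f'. (\<forall>x\<in>V. ((\<lambda>t. f (x + t *\<^sub>R v)) has_vector_derivative f' x) (at 0)) \<and> Ck_on k V f')"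

definition smooth_on :: "'a::real_normed_vector set \<Rightarrow> ('a \<Rightarrow> 'b::real_normed_vector) \<Rightarrow> bool" where
  "smooth_on V f \<longleftrightarrow> (\<forall>k. Ck_on k V f)"

text \<open>A vector field on \<open>V\<close> is its coefficient map \<open>V \<rightarrow> V\<close> (all tangent spaces being identified with
  \<open>V\<close>), extended by 0 outside \<open>V\<close> so that equality of fields is equality of functions.\<close>
definition vector_fields :: "'a::real_normed_vector set \<Rightarrow> ('a \<Rightarrow> 'a) set" where
  "vector_fields V = {F. smooth_on V F \<and> (\<forall>x\<in>V. F x \<in> V) \<and> (\<forall>x. x \<notin> V \<longrightarrow> F x = 0)}"

text \<open>The commutator \<open>F G - G F\<close> of derivations, i.e. \<open>DG(F) - DF(G)\<close> in linear coordinates.\<close>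
definition vf_bracket :: "'a::real_normed_vector set \<Rightarrow> ('a \<Rightarrow> 'a) \<Rightarrow> ('a \<Rightarrow> 'a) \<Rightarrow> 'a \<Rightarrow> 'a" where
  "vf_bracket V F G x = (if x \<in> V
     then vector_derivative (\<lambda>t. G (x + t *\<^sub>R F x)) (at 0)
        - vector_derivative (\<lambda>t. F (x + t *\<^sub>R G x)) (at 0)
     else 0)"

definition vf_lie :: "'a::real_normed_vector set \<Rightarrow> ('a \<Rightarrow> 'a) lie_alg" where
  "vf_lie V = \<lparr>lcarrier = vector_fields V, ladd = (\<lambda>F G x. F x + G x),
     lscale = (\<lambda>c F x. c *\<^sub>R F x), lbracket = vf_bracket V\<rparr>"

section \<open>Real Lie algebras, adjoint group, restricted roots\<close>

text \<open>The type class \<open>euclidean_space\<close> only serves to express finite dimension and the usual topology;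
  its inner product is unrelated to the Lie algebra.\<close>
locale real_lie_algebra =
  fixes br :: "'g::euclidean_space \<Rightarrow> 'g \<Rightarrow> 'g"
  assumes bilinear_br: "bilinear br"
    and br_self: "br X X = 0"
    and jacobi: "br X (br Y Z) + br Y (br Z X) + br Z (br X Y) = 0"
begin

definition lie_ideal :: "'g set \<Rightarrow> bool" where
  "lie_ideal I \<longleftrightarrow> subspace I \<and> (\<forall>X. \<forall>Y\<in>I. br X Y \<in> I)"

definition simple :: bool where
  "simple \<longleftrightarrow> (\<exists>X Y. br X Y \<noteq> 0) \<and> (\<forall>I. lie_ideal I \<longrightarrow> I = {0} \<or> I = UNIV)"

definition killing :: "'g \<Rightarrow> 'g \<Rightarrow> real" where
  "killing X Y = (\<Sum>b\<in>Basis. br X (br Y b) \<bullet> b)"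

definition cartan_involution :: "('g \<Rightarrow> 'g) \<Rightarrow> bool" where
  "cartan_involution \<theta> \<longleftrightarrow> linear \<theta> \<and> (\<forall>X. \<theta> (\<theta> X) = X) \<and>
     (\<forall>X Y. \<theta> (br X Y) = br (\<theta> X) (\<theta> Y)) \<and> (\<forall>X. X \<noteq> 0 \<longrightarrow> - killing X (\<theta> X) > 0)"

definition abelian_subspace :: "'g set \<Rightarrow> bool" where
  "abelian_subspace V \<longleftrightarrow> subspace V \<and> (\<forall>X\<in>V. \<forall>Y\<in>V. br X Y = 0)"

definition maximal_abelian_in :: "'g set \<Rightarrow> 'g set \<Rightarrow> bool" where
  "maximal_abelian_in W V \<longleftrightarrow> abelian_subspace V \<and> V \<subseteq> W \<and>
     (\<forall>V'. abelian_subspace V' \<and> V \<subseteq> V' \<and> V' \<subseteq> W \<longrightarrow> V' = V)"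

text \<open>The adjoint group \<open>Int(g)\<close> consists of linear maps on \<open>g\<close>; its exponential map sends \<open>X\<close> to the
  exponential series of \<open>ad X\<close>.\<close>
definition exp_ad :: "'g \<Rightarrow> 'g \<Rightarrow> 'g" where
  "exp_ad X Y = (\<Sum>n. (br X ^^ n) Y /\<^sub>R fact n)"

text \<open>The connected subgroup of \<open>Int(g)\<close> with Lie algebra \<open>h\<close> is the group generated by \<open>exp h\<close>.
  Inverses are covered because \<open>h\<close> is closed under negation.\<close>
inductive_set connected_subgroup :: "'g set \<Rightarrow> ('g \<Rightarrow> 'g) set" for h :: "'g set" where
  one: "id \<in> connected_subgroup h"
| mult: "X \<in> h \<Longrightarrow> g \<in> connected_subgroup h \<Longrightarrow> exp_ad X \<circ> g \<in> connected_subgroup h"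

end

text \<open>A restricted root is a linear functional on \<open>\<aa>\<close>; it is encoded as a function on \<open>g\<close> that is 0
  outside \<open>\<aa>\<close>, so that the pointwise operations on functions are those of the dual space of \<open>\<aa>\<close>.\<close>
locale simple_lie_algebra_rank_gt_1 = real_lie_algebra br
  for br :: "'g::euclidean_space \<Rightarrow> 'g \<Rightarrow> 'g" +
  fixes \<theta> :: "'g \<Rightarrow> 'g" and \<aa> :: "'g set"
  assumes simple: "simple"
    and cartan: "cartan_involution \<theta>"
    and maximal_abelian: "maximal_abelian_in {X. \<theta> X = - X} \<aa>"
    and real_rank: "dim \<aa> > 1"
begin

definition \<aa>_dual :: "('g \<Rightarrow> real) set" where
  "\<aa>_dual = {\<alpha>. (\<forall>H\<in>\<aa>. \<forall>H'\<in>\<aa>. \<alpha> (H + H') = \<alpha> H + \<alpha> H') \<and>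
     (\<forall>c. \<forall>H\<in>\<aa>. \<alpha> (c *\<^sub>R H) = c * \<alpha> H) \<and> (\<forall>X. X \<notin> \<aa> \<longrightarrow> \<alpha> X = 0)}"

definition root_space :: "('g \<Rightarrow> real) \<Rightarrow> 'g set" where
  "root_space \<alpha> = {X. \<forall>H\<in>\<aa>. br H X = \<alpha> H *\<^sub>R X}"

definition roots :: "('g \<Rightarrow> real) set" where
  "roots = {\<alpha>\<in>\<aa>_dual. \<alpha> \<noteq> 0 \<and> root_space \<alpha> \<noteq> {0}}"

definition m :: "('g \<Rightarrow> real) \<Rightarrow> nat" where
  "m \<alpha> = dim (root_space \<alpha>)"

text \<open>The roots positive on a Weyl chamber, which is given by a regular element \<open>H\<close> of \<open>\<aa>\<close>.\<close>
definition positive_system :: "('g \<Rightarrow> real) set \<Rightarrow> bool" where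
  "positive_system pos \<longleftrightarrow> (\<exists>H\<in>\<aa>. (\<forall>\<alpha>\<in>roots. \<alpha> H \<noteq> 0) \<and> pos = {\<alpha>\<in>roots. \<alpha> H > 0})"

definition sum_root_spaces :: "('g \<Rightarrow> real) set \<Rightarrow> 'g set" where
  "sum_root_spaces A = span (\<Union>\<alpha>\<in>A. root_space \<alpha>)"

definition K :: "('g \<Rightarrow> 'g) set" where
  "K = connected_subgroup {X. \<theta> X = X}"

definition M :: "('g \<Rightarrow> 'g) set" where
  "M = {k\<in>K. \<forall>H\<in>\<aa>. k H = H}"

end

section \<open>The nilpotent group, the slice and the multicontact fields\<close>

text \<open>\<open>E \<alpha> 1, \<dots>, E \<alpha> (m \<alpha>)\<close> is a basis of the root space of \<open>\<alpha>\<close>.\<close>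
locale hessenberg_setting = simple_lie_algebra_rank_gt_1 br \<theta> \<aa>
  for br :: "'g::euclidean_space \<Rightarrow> 'g \<Rightarrow> 'g" and \<theta> :: "'g \<Rightarrow> 'g" and \<aa> :: "'g set" +
  fixes pos :: "('g \<Rightarrow> real) set"
    and E :: "('g \<Rightarrow> real) \<Rightarrow> nat \<Rightarrow> 'g"
    and R :: "('g \<Rightarrow> real) set"
  assumes pos: "positive_system pos"
    and E_inj: "\<alpha> \<in> pos \<Longrightarrow> inj_on (E \<alpha>) {1..m \<alpha>}"
    and E_independent: "\<alpha> \<in> pos \<Longrightarrow> independent (E \<alpha> ` {1..m \<alpha>})"
    and E_span: "\<alpha> \<in> pos \<Longrightarrow> span (E \<alpha> ` {1..m \<alpha>}) = root_space \<alpha>"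
    and R_proper: "R \<subset> pos"
    and R_hessenberg: "\<alpha> \<in> R \<Longrightarrow> - \<beta> \<in> pos \<Longrightarrow> \<alpha> + \<beta> \<in> pos \<Longrightarrow> \<alpha> + \<beta> \<in> R"
begin

definition simple_roots :: "('g \<Rightarrow> real) set" where
  "simple_roots = {\<delta>\<in>pos. \<not> (\<exists>\<alpha>\<in>pos. \<exists>\<beta>\<in>pos. \<delta> = \<alpha> + \<beta>)}"

abbreviation C :: "('g \<Rightarrow> real) set" where
  "C \<equiv> pos - R"

definition \<nn> :: "'g set" where
  "\<nn> = sum_root_spaces pos"

definition \<nn>\<^sub>C :: "'g set" where
  "\<nn>\<^sub>C = sum_root_spaces C"

definition \<qq> :: "'g set" where
  "\<qq> = {X. \<forall>Y\<in>\<nn>\<^sub>C. br X Y \<in> \<nn>\<^sub>C}"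

definition N :: "('g \<Rightarrow> 'g) set" where
  "N = exp_ad ` \<nn>"

definition P :: "('g \<Rightarrow> 'g) set" where
  "P = {k \<circ> a \<circ> n' |k a n'. k \<in> M \<and> a \<in> exp_ad ` \<aa> \<and> n' \<in> exp_ad ` \<theta> ` \<nn>}"

text \<open>Throughout, \<open>N\<close> is described in the global exponential chart: the point
  \<open>exp (\<Sum> x\<^bsub>\<alpha>,j\<^esub> E \<alpha> j)\<close> is represented by the vector \<open>\<Sum> x\<^bsub>\<alpha>,j\<^esub> E \<alpha> j\<close> of \<open>\<nn>\<close>, and \<open>\<partial>/\<partial>x\<^bsub>\<alpha>,j\<^esub>\<close> by the
  constant vector \<open>E \<alpha> j\<close>. So vector fields on \<open>N\<close> become maps from \<open>\<nn>\<close> to \<open>\<nn>\<close>, and the vector field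
  \<open>h \<mapsto> d/dt h (c t)\<close> along a curve \<open>c\<close> in \<open>N\<close> becomes the derivative of \<open>log_N (c t)\<close>.\<close>

definition log_N :: "('g \<Rightarrow> 'g) \<Rightarrow> 'g" where
  "log_N = inv_into \<nn> exp_ad"

text \<open>The coordinate \<open>x\<^bsub>\<alpha>,j\<^esub>\<close> of a point, equally the \<open>\<partial>/\<partial>x\<^bsub>\<alpha>,j\<^esub>\<close>-component of a tangent vector.\<close>
definition coord :: "('g \<Rightarrow> real) \<Rightarrow> nat \<Rightarrow> 'g \<Rightarrow> real" where
  "coord \<alpha> j y = representation (\<Union>\<gamma>\<in>pos. E \<gamma> ` {1..m \<gamma>}) y (E \<alpha> j)"

definition S :: "'g set" where
  "S = {x\<in>\<nn>. \<forall>\<alpha>\<in>C. \<forall>j\<in>{1..m \<alpha>}. coord \<alpha> j x = 0}"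

definition X_field :: "('g \<Rightarrow> real) \<Rightarrow> nat \<Rightarrow> 'g \<Rightarrow> 'g" where
  "X_field \<alpha> j x = vector_derivative (\<lambda>t. log_N (exp_ad x \<circ> exp_ad (t *\<^sub>R E \<alpha> j))) (at 0)"

definition X_bar :: "('g \<Rightarrow> real) \<Rightarrow> nat \<Rightarrow> 'g \<Rightarrow> 'g" where
  "X_bar \<alpha> j x = (if x \<in> S
     then \<Sum>\<gamma>\<in>R. \<Sum>k\<in>{1..m \<gamma>}. coord \<gamma> k (X_field \<alpha> j x) *\<^sub>R E \<gamma> k
     else 0)"

definition multicontact :: "('g \<Rightarrow> 'g) \<Rightarrow> bool" where
  "multicontact F \<longleftrightarrow> F \<in> vector_fields S \<and>
     (\<forall>\<delta>\<in>simple_roots \<inter> R. \<forall>i\<in>{1..m \<delta>}. \<exists>l :: nat \<Rightarrow> 'g \<Rightarrow> real.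
        (\<forall>k\<in>{1..m \<delta>}. smooth_on S (l k)) \<and>
        (\<forall>x\<in>S. vf_bracket S F (X_bar \<delta> i) x = (\<Sum>k\<in>{1..m \<delta>}. l k x *\<^sub>R X_bar \<delta> k x)))"

text \<open>\<open>[g]\<close>, the element of \<open>N\<close> with \<open>g \<in> [g] P\<close>.\<close>
definition N_part :: "('g \<Rightarrow> 'g) \<Rightarrow> 'g \<Rightarrow> 'g" where
  "N_part g = (THE n. n \<in> N \<and> (\<exists>p\<in>P. g = n \<circ> p))"

definition \<tau> :: "'g \<Rightarrow> 'g \<Rightarrow> 'g" where
  "\<tau> Z x = vector_derivative (\<lambda>t. log_N (N_part (exp_ad (- t *\<^sub>R Z) \<circ> exp_ad x))) (at 0)"

text \<open>The coefficients \<open>f\<^bsub>\<gamma>,j\<^esub>\<close> of \<open>\<tau> Z\<close> with respect to the left-invariant frame.\<close>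
definition \<tau>_coeff :: "'g \<Rightarrow> ('g \<Rightarrow> real) \<Rightarrow> nat \<Rightarrow> 'g \<Rightarrow> real" where
  "\<tau>_coeff Z \<gamma> j x = representation (\<Union>\<alpha>\<in>pos. (\<lambda>k. X_field \<alpha> k x) ` {1..m \<alpha>}) (\<tau> Z x) (X_field \<gamma> j x)"

definition \<nu> :: "'g \<Rightarrow> 'g \<Rightarrow> 'g" where
  "\<nu> Z x = (if x \<in> S then \<Sum>\<gamma>\<in>R. \<Sum>j\<in>{1..m \<gamma>}. \<tau>_coeff Z \<gamma> j x *\<^sub>R X_bar \<gamma> j x else 0)"

end

end

theory Submission
  imports Defs
begin

text \<open>The point \<open>x\<close> of \<open>\<nn>\<close> stands for \<open>exp x\<close>. For a regular \<open>H0\<close> in \<open>\<aa>\<close> the map \<open>x \<mapsto> exp (ad x) H0 - H0\<close> is a polynomial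
  bijection of \<open>\<nn>\<close> with polynomial inverse; this yields a polynomial group law without the
  Baker-Campbell-Hausdorff formula, and polynomial left-invariant fields.

  Factoring \<open>exp (-t Z) exp x = exp x exp (-t W)\<close> with \<open>W = exp (- ad x) Z\<close> along \<open>g = \<nn> + \<mm> + \<aa> + \<theta> \<nn>\<close> shows
  that \<open>\<tau> Z\<close> at \<open>x\<close> is the left-invariant field of \<open>- W\<^sub>+\<close>, where \<open>W\<^sub>+\<close> is the \<open>\<nn>\<close>-part of \<open>W\<close>. Hence \<open>\<tau>\<close> is a
  homomorphism, and \<open>[\<tau> Z, X]\<close> is the left-invariant field of \<open>- [X, W - W\<^sub>+]\<^sub>+\<close>, which lies in \<open>g\<^bsub>\<delta>\<^esub>\<close> when \<open>X\<close>
  does and \<open>\<delta>\<close> is simple. Since \<open>\<nn>\<^sub>C\<close> is an ideal of \<open>\<qq>\<close>, everything descends along \<open>\<nn> \<rightarrow> \<nn>/\<nn>\<^sub>C = S\<close>.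

  The kernel \<open>J\<close> of \<open>\<nu>\<close> is stable under \<open>ad H0\<close>, and \<open>J \<inter> \<nn> = \<nn>\<^sub>C\<close>. Its part in \<open>\<mm> + \<aa>\<close> commutes with the simple root
  spaces, hence with \<open>\<nn>\<close>, hence vanishes; for \<open>Z\<close> in a negative eigenspace \<open>[Z, \<theta> Z]\<close> then vanishes, so \<open>Z = 0\<close>.\<close>

section \<open>Polynomial maps\<close>

text \<open>The derivative that defines \<open>\<tau>\<close> presupposes that the
  \<open>N\<close>-part of a curve in the adjoint group exists near t = 0 and is differentiable
  there, while this group is only a set of linear maps without a manifold structure. The trace
  functional \<open>ktr\<close> supplies coordinates: it sends endomorphisms linearly to g, is
  injective on inner derivations because the Killing form is nondegenerate, and hence separates
  automorphisms close to the identity. The factorization problem becomes an equation between maps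
  from g to g. \<open>H0\<close> works as a base point because \<open>ad H0\<close> is invertible on
  \<open>\<nn>\<close>, and because a unipotent automorphism that fixes \<open>H0\<close> commutes
  with \<open>ad H0\<close> and is therefore the identity. An element of \<open>N\<close> is thus
  known from its effect on one vector, so products and brackets in \<open>N\<close> can be compared
  inside g. The projection \<open>pn\<close> extends the group law and the fields from
  \<open>\<nn>\<close> to all of g, so that polynomial calculus on the whole space applies until the
  fields are pushed down to \<open>S\<close>.\<close>

lemma linear_imp_bounded_linear:
  fixes L :: "'a::euclidean_space \<Rightarrow> 'b::real_normed_vector"
  shows "linear L \<Longrightarrow> bounded_linear L"
  by (simp add: linear_conv_bounded_linear)

lemma linear_has_vector_derivative:
  fixes L :: "'a::euclidean_space \<Rightarrow> 'b::real_normed_vector"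
  assumes "linear L" "(f has_vector_derivative f') F"
  shows "((\<lambda>t. L (f t)) has_vector_derivative L f') F"
  using bounded_linear.has_vector_derivative[OF linear_imp_bounded_linear] assms by blast

lemma polynomial_function_linear:
  fixes L :: "'b::euclidean_space \<Rightarrow> 'c::real_normed_vector"
  assumes "linear L" "polynomial_function f"
  shows "polynomial_function (\<lambda>x. L (f x))"
  using polynomial_function_compose[OF assms(2) polynomial_function_bounded_linear[OF linear_imp_bounded_linear[OF assms(1)]]]
  by (simp add: o_def)

lemma polynomial_function_bilinear:
  fixes B :: "'b::euclidean_space \<Rightarrow> 'c::euclidean_space \<Rightarrow> 'd::real_normed_vector"
  assumes B: "bilinear B" and f: "polynomial_function f" and g: "polynomial_function g"
  shows "polynomial_function (\<lambda>x. B (f x) (g x))"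
proof -
  have "B (f x) (g x) = (\<Sum>b\<in>Basis. (f x \<bullet> b) *\<^sub>R B b (g x))" for x
  proof -
    have "B (f x) (g x) = B (\<Sum>b\<in>Basis. (f x \<bullet> b) *\<^sub>R b) (g x)"
      by (simp add: euclidean_representation)
    also have "\<dots> = (\<Sum>b\<in>Basis. (f x \<bullet> b) *\<^sub>R B b (g x))"
      using B unfolding bilinear_def
      by (simp add: linear_sum[where f="\<lambda>z. B z (g x)"] linear_cmul[where f="\<lambda>z. B z (g x)"])
    finally show ?thesis .
  qed
  moreover have "polynomial_function (\<lambda>x. (f x \<bullet> b) *\<^sub>R B b (g x))" for b
  proof (rule polynomial_function_mult)
    show "polynomial_function (\<lambda>x. f x \<bullet> b)"
      by (rule polynomial_function_linear[OF _ f]) (simp add: bounded_linear.linear bounded_linear_inner_left)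
    show "polynomial_function (\<lambda>x. B b (g x))"
      by (rule polynomial_function_linear[OF _ g]) (use B in \<open>simp add: bilinear_def\<close>)
  qed
  ultimately show ?thesis by (simp add: polynomial_function_sum)
qed

section \<open>Derivatives of polynomial maps along polynomial vector fields\<close>

abbreviation Fd where "Fd f x \<equiv> frechet_derivative f (at x)"

lemma Fd_poly:
  fixes p :: "'a::euclidean_space \<Rightarrow> 'b::euclidean_space"
  assumes "polynomial_function p"
  shows "(p has_derivative Fd p x) (at x)"
  using differentiable_at_polynomial_function[OF assms] frechet_derivative_works by blast

lemma Fd_linear:
  fixes p :: "'a::euclidean_space \<Rightarrow> 'b::euclidean_space"
  assumes "polynomial_function p"
  shows "linear (Fd p x)"
  using Fd_poly[OF assms] has_derivative_linear by blast

lemma Fd_eqI: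
  assumes "(p has_derivative p') (at x)"
  shows "Fd p x = p'"
  using frechet_derivative_at[OF assms] by simp

lemma line_deriv:
  fixes p :: "'a::real_normed_vector \<Rightarrow> 'b::real_normed_vector"
  assumes "(p has_derivative p') (at x)"
  shows "((\<lambda>t. p (x + t *\<^sub>R v)) has_vector_derivative p' v) (at 0)"
proof -
  have "((\<lambda>t. x + t *\<^sub>R v) has_derivative (\<lambda>t. t *\<^sub>R v)) (at 0)"
    by (auto intro!: derivative_eq_intros)
  from has_derivative_compose[OF this, of p p'] assms
  have "((\<lambda>t. p (x + t *\<^sub>R v)) has_derivative (\<lambda>t. p' (t *\<^sub>R v))) (at 0)" by simp
  moreover have "p' (t *\<^sub>R v) = t *\<^sub>R p' v" for t
    using has_derivative_linear[OF assms] by (simp add: linear_cmul)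
  ultimately show ?thesis by (simp add: has_vector_derivative_def)
qed

lemma Fd_poly_line:
  fixes p :: "'a::euclidean_space \<Rightarrow> 'b::euclidean_space"
  assumes "polynomial_function p"
  shows "((\<lambda>t. p (x + t *\<^sub>R v)) has_vector_derivative Fd p x v) (at 0)"
  using line_deriv[OF Fd_poly[OF assms]] .

lemma Fd_mult:
  fixes f g :: "'a::euclidean_space \<Rightarrow> real"
  assumes "polynomial_function f" "polynomial_function g"
  shows "Fd (\<lambda>x. f x * g x) x v = f x * Fd g x v + Fd f x v * g x"
  using Fd_eqI[OF has_derivative_mult[OF Fd_poly[OF assms(1)] Fd_poly[OF assms(2)], of x]] by simp

lemma Fd_add:
  fixes f g :: "'a::euclidean_space \<Rightarrow> 'b::euclidean_space"
  assumes "polynomial_function f" "polynomial_function g"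
  shows "Fd (\<lambda>x. f x + g x) x v = Fd f x v + Fd g x v"
  using Fd_eqI[OF has_derivative_add[OF Fd_poly[OF assms(1)] Fd_poly[OF assms(2)], of x]] by simp

lemma Fd_bounded_linear:
  "bounded_linear f \<Longrightarrow> Fd f x = f"
  by (rule Fd_eqI) (rule bounded_linear_imp_has_derivative)

lemma Fd_linear_comp:
  fixes L :: "'b::euclidean_space \<Rightarrow> 'c::euclidean_space" and p :: "'a::euclidean_space \<Rightarrow> 'b"
  assumes "linear L" "polynomial_function p"
  shows "Fd (\<lambda>x. L (p x)) x v = L (Fd p x v)"
  using Fd_eqI[OF bounded_linear.has_derivative[OF linear_imp_bounded_linear[OF assms(1)] Fd_poly[OF assms(2)], of x]]
  by simp

text \<open>The direction \<open>G\<close> varies with the point, so polynomial maps are closed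
  under the action of polynomial vector fields, and the iterated derivatives in a commutator stay
  polynomial.\<close>

lemma real_polynomial_Fd:
  fixes p :: "'a::euclidean_space \<Rightarrow> real"
  assumes "real_polynomial_function p" and G: "polynomial_function G"
  shows "polynomial_function (\<lambda>x. Fd p x (G x))"
  using assms(1)
proof (induction p rule: real_polynomial_function.induct)
  case (linear f)
  then show ?case
    using polynomial_function_linear[OF bounded_linear.linear[OF linear] G] by (simp add: Fd_bounded_linear)
next
  case (const c)
  then show ?case by simp
next
  case (add f g)
  then show ?case
    by (simp add: real_polynomial_function_eq Fd_add polynomial_function_add)
next
  case (mult f g)
  have "polynomial_function (\<lambda>x. f x *\<^sub>R Fd g x (G x) + Fd f x (G x) *\<^sub>R g x)"
    using mult by (intro polynomial_function_add polynomial_function_mult)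
       (simp_all add: real_polynomial_function_eq)
  then show ?case using mult
    by (simp add: real_polynomial_function_eq Fd_mult)
qed

lemma polynomial_Fd:
  fixes p :: "'a::euclidean_space \<Rightarrow> 'b::euclidean_space"
  assumes p: "polynomial_function p" and G: "polynomial_function G"
  shows "polynomial_function (\<lambda>x. Fd p x (G x))"
proof -
  have "real_polynomial_function (\<lambda>x. Fd p x (G x) \<bullet> b)" for b
  proof -
    have l: "linear (\<lambda>y. y \<bullet> b)" for b :: 'b
      by (simp add: bounded_linear.linear bounded_linear_inner_left)
    have "Fd (\<lambda>x. p x \<bullet> b) x (G x) = Fd p x (G x) \<bullet> b" for x
      by (rule Fd_linear_comp[OF l p])
    moreover have "real_polynomial_function (\<lambda>x. p x \<bullet> b)"
      using polynomial_function_linear[OF l p] by (simp add: real_polynomial_function_eq)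
    from real_polynomial_Fd[OF this G] have "polynomial_function (\<lambda>x. Fd (\<lambda>x. p x \<bullet> b) x (G x))" .
    ultimately show ?thesis by (simp add: real_polynomial_function_eq)
  qed
  then show ?thesis by (simp add: polynomial_function_iff_Basis_inner)
qed

text \<open>The commutator of derivations is a derivation, tested on a polynomial \<open>h\<close>. Induction on \<open>h\<close>
  avoids the symmetry of second derivatives.\<close>
lemma Fd_commutator_real:
  fixes h :: "'a::euclidean_space \<Rightarrow> real"
  assumes "real_polynomial_function h" and F: "polynomial_function F" and G: "polynomial_function G"
  shows "Fd (\<lambda>y. Fd h y (G y)) x (F x) - Fd (\<lambda>y. Fd h y (F y)) x (G x)
       = Fd h x (Fd G x (F x) - Fd F x (G x))"
  using assms(1)
proof (induction h rule: real_polynomial_function.induct)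
  case (linear f)
  then show ?case
    by (simp add: Fd_bounded_linear Fd_linear_comp bounded_linear.linear F G linear_diff)
next
  case (const c)
  then show ?case by simp
next
  case (add f g)
  then have f: "polynomial_function f" "polynomial_function g"
    by (simp_all add: real_polynomial_function_eq)
  note P = real_polynomial_Fd[OF add.hyps(1) F] real_polynomial_Fd[OF add.hyps(1) G]
     real_polynomial_Fd[OF add.hyps(2) F] real_polynomial_Fd[OF add.hyps(2) G]
  show ?case using add.IH by (simp add: Fd_add f P)
next
  case (mult f g)
  then have f: "polynomial_function f" "polynomial_function g"
    by (simp_all add: real_polynomial_function_eq)
  note P = real_polynomial_Fd[OF mult.hyps(1) F] real_polynomial_Fd[OF mult.hyps(1) G]
     real_polynomial_Fd[OF mult.hyps(2) F] real_polynomial_Fd[OF mult.hyps(2) G]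
  note M = polynomial_function_mult[where 'b=real, simplified]
  have "Fd (\<lambda>y. Fd (\<lambda>x. f x * g x) y (G y)) x (F x) - Fd (\<lambda>y. Fd (\<lambda>x. f x * g x) y (F y)) x (G x)
    = f x * (Fd (\<lambda>y. Fd g y (G y)) x (F x) - Fd (\<lambda>y. Fd g y (F y)) x (G x))
    + (Fd (\<lambda>y. Fd f y (G y)) x (F x) - Fd (\<lambda>y. Fd f y (F y)) x (G x)) * g x"
    by (simp add: Fd_mult Fd_add f P M algebra_simps)
  also have "\<dots> = Fd (\<lambda>x. f x * g x) x (Fd G x (F x) - Fd F x (G x))"
    by (simp only: mult.IH Fd_mult f)
  finally show ?case .
qed

lemma Fd_commutator:
  fixes h :: "'a::euclidean_space \<Rightarrow> 'b::euclidean_space"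
  assumes h: "polynomial_function h" and F: "polynomial_function F" and G: "polynomial_function G"
  shows "Fd (\<lambda>y. Fd h y (G y)) x (F x) - Fd (\<lambda>y. Fd h y (F y)) x (G x)
       = Fd h x (Fd G x (F x) - Fd F x (G x))"
proof (rule euclidean_eqI)
  fix b :: 'b
  have l: "linear (\<lambda>y::'b. y \<bullet> b)"
    by (simp add: bounded_linear.linear bounded_linear_inner_left)
  have hb: "real_polynomial_function (\<lambda>x. h x \<bullet> b)"
    using polynomial_function_linear[OF l h] by (simp add: real_polynomial_function_eq)
  show "(Fd (\<lambda>y. Fd h y (G y)) x (F x) - Fd (\<lambda>y. Fd h y (F y)) x (G x)) \<bullet> b
       = Fd h x (Fd G x (F x) - Fd F x (G x)) \<bullet> b"
    using Fd_commutator_real[OF hb F G, of x]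
    by (simp add: Fd_linear_comp[OF l] h polynomial_Fd F G inner_diff_left)
qed

lemma polynomial_imp_Ck_on:
  fixes f :: "'a::euclidean_space \<Rightarrow> 'b::euclidean_space"
  assumes "polynomial_function f"
  shows "Ck_on k V f"
  using assms
proof (induction k arbitrary: f)
  case 0
  then show ?case
    by (simp add: continuous_on_polymonial_function)
next
  case (Suc k)
  have "\<exists>f'. (\<forall>x\<in>V. ((\<lambda>t. f (x + t *\<^sub>R v)) has_vector_derivative f' x) (at 0)) \<and> Ck_on k V f'" for v
    using Fd_poly_line[OF Suc.prems] Suc.IH[OF polynomial_Fd[OF Suc.prems polynomial_function_const]]
    by (intro exI[of _ "\<lambda>x. Fd f x v"]) blast
  then show ?case using Suc.prems by (simp add: continuous_on_polymonial_function)
qed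

text \<open>\<open>Ck_on\<close> only looks along lines \<open>x + t *\<^sub>R v\<close> with
  \<open>x\<close> and \<open>v\<close> in \<open>V\<close>, and a subspace contains them. Hence a
  field cut off to 0 outside \<open>V\<close> keeps the smoothness of its polynomial
  formula.\<close>

lemma Ck_on_cong:
  fixes f g :: "'a::real_normed_vector \<Rightarrow> 'b::real_normed_vector"
  assumes V: "subspace V" and eq: "\<And>x. x \<in> V \<Longrightarrow> f x = g x" and "Ck_on k V f"
  shows "Ck_on k V g"
proof (cases k)
  case 0
  then show ?thesis using assms by (metis Ck_on.simps(1) continuous_on_cong)
next
  case (Suc l)
  have *: "f (x + t *\<^sub>R v) = g (x + t *\<^sub>R v)" if "x \<in> V" "v \<in> V" for x v t
    using that by (intro eq subspace_add[OF V] subspace_scale[OF V])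
  have c: "continuous_on V g"
    using assms(3) Suc eq by (metis Ck_on.simps(2) continuous_on_cong)
  show ?thesis unfolding Suc Ck_on.simps
  proof (intro conjI ballI c)
    fix v assume v: "v \<in> V"
    then obtain f' where f': "\<And>x. x \<in> V \<Longrightarrow> ((\<lambda>t. f (x + t *\<^sub>R v)) has_vector_derivative f' x) (at 0)" "Ck_on l V f'"
      using assms(3) unfolding Suc Ck_on.simps by blast
    have "(\<lambda>t. f (x + t *\<^sub>R v)) = (\<lambda>t. g (x + t *\<^sub>R v))" if "x \<in> V" for x
      using *[OF that v] by blast
    with f' show "\<exists>f'. (\<forall>x\<in>V. ((\<lambda>t. g (x + t *\<^sub>R v)) has_vector_derivative f' x) (at 0)) \<and> Ck_on l V f'"
      by (intro exI[of _ f']) simp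
  qed
qed

lemma smooth_on_polynomial:
  fixes f g :: "'a::euclidean_space \<Rightarrow> 'b::euclidean_space"
  assumes "subspace V" "polynomial_function f" "\<And>x. x \<in> V \<Longrightarrow> f x = g x"
  shows "smooth_on V g"
  unfolding smooth_on_def using assms Ck_on_cong polynomial_imp_Ck_on by metis

section \<open>Traces and symmetric operators\<close>

definition tr :: "('a::euclidean_space \<Rightarrow> 'a) \<Rightarrow> real" where
  "tr A = (\<Sum>b\<in>Basis. A b \<bullet> b)"

lemma tr_comp: 
  fixes A B :: "'a::euclidean_space \<Rightarrow> 'a"
  assumes "linear A" "linear B"
  shows "tr (\<lambda>x. A (B x)) = (\<Sum>b\<in>Basis. \<Sum>c\<in>Basis. (B b \<bullet> c) * (A c \<bullet> b))"
proof -
  have "A (B b) \<bullet> b = (\<Sum>c\<in>Basis. (B b \<bullet> c) * (A c \<bullet> b))" for b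
  proof -
    have "A (B b) = A (\<Sum>c\<in>Basis. (B b \<bullet> c) *\<^sub>R c)" by (simp add: euclidean_representation)
    also have "\<dots> = (\<Sum>c\<in>Basis. (B b \<bullet> c) *\<^sub>R A c)"
      by (simp add: linear_sum[OF assms(1)] linear_cmul[OF assms(1)])
    finally show ?thesis by (simp add: inner_sum_left)
  qed
  then show ?thesis by (simp add: tr_def)
qed

lemma tr_commute:
  fixes A B :: "'a::euclidean_space \<Rightarrow> 'a"
  assumes "linear A" "linear B"
  shows "tr (\<lambda>x. A (B x)) = tr (\<lambda>x. B (A x))"
  unfolding tr_comp[OF assms] tr_comp[OF assms(2,1)]
  by (subst sum.swap) (simp add: mult.commute)

lemma tr_add: "tr (\<lambda>x. A x + B x) = tr A + tr B"
  by (simp add: tr_def inner_add_left sum.distrib)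

lemma tr_diff: "tr (\<lambda>x. A x - B x) = tr A - tr B"
  by (simp add: tr_def inner_diff_left sum_subtractf)

lemma tr_scale: "tr (\<lambda>x. c *\<^sub>R A x) = c * tr A"
  by (simp add: tr_def sum_distrib_left)

lemma tr_bound: 
  fixes A :: "'a::euclidean_space \<Rightarrow> 'a"
  assumes "\<And>x. norm (A x) \<le> c * norm x"
  shows "\<bar>tr A\<bar> \<le> real DIM('a) * c"
proof -
  have "\<bar>tr A\<bar> \<le> (\<Sum>b\<in>(Basis::'a set). \<bar>A b \<bullet> b\<bar>)" unfolding tr_def by (rule sum_abs)
  also have "\<dots> \<le> (\<Sum>b\<in>(Basis::'a set). (c::real))"
  proof (rule sum_mono)
    fix b :: 'a assume b: "b \<in> Basis"
    have "\<bar>A b \<bullet> b\<bar> \<le> norm (A b) * norm b" by (rule Cauchy_Schwarz_ineq2)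
    then show "\<bar>A b \<bullet> b\<bar> \<le> c" using assms[of b] b by simp
  qed
  finally show ?thesis by simp
qed

section \<open>Spectral theorem for commuting operators that are symmetric for a given form\<close>

locale pos_def_form =
  fixes ip :: "'a::euclidean_space \<Rightarrow> 'a \<Rightarrow> real"
  assumes bil: "bilinear ip" and sym: "ip x y = ip y x" and pd: "x \<noteq> 0 \<Longrightarrow> ip x x > 0"
begin

lemma lin1: "linear (\<lambda>x. ip x y)" and lin2: "linear (\<lambda>y. ip x y)"
  using bil by (auto simp: bilinear_def)

lemmas ip_simps = linear_add[OF lin1] linear_add[OF lin2] linear_cmul[OF lin1] linear_cmul[OF lin2]
  linear_diff[OF lin1] linear_diff[OF lin2] linear_0[OF lin1] linear_0[OF lin2]
  linear_neg[OF lin1] linear_neg[OF lin2] linear_sum[OF lin1] linear_sum[OF lin2]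

lemma ip_eq_0_iff [simp]: "ip x x = 0 \<longleftrightarrow> x = 0"
  using pd[of x] by (cases "x = 0") (auto simp: ip_simps)

lemma ip_nonneg: "ip x x \<ge> 0"
  using pd[of x] by (cases "x = 0") (auto simp: ip_simps)

text \<open>Gram-Schmidt: the correction is made along the part \<open>w\<close> of the new vector
  that is orthogonal to the old span.\<close>

lemma orthogonal_projection_exists:
  assumes "finite A"
  shows "\<exists>y\<in>span A. \<forall>z\<in>span A. ip (x - y) z = 0"
  using assms
proof (induction A arbitrary: x rule: finite_induct)
  case empty
  then show ?case by (auto simp: ip_simps)
next
  case (insert a A)
  obtain p where p: "p \<in> span A" "\<And>z. z \<in> span A \<Longrightarrow> ip (a - p) z = 0"
    using insert.IH[of a] by blast
  obtain y where y: "y \<in> span A" "\<And>z. z \<in> span A \<Longrightarrow> ip (x - y) z = 0"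
    using insert.IH[of x] by blast
  define w where "w = a - p"
  \<comment> \<open>For \<open>w = 0\<close> the new vector already lies in the old span and the
    added term vanishes, so both cases share one formula.\<close>
  define y' where "y' = y + (ip (x - y) w / ip w w) *\<^sub>R w"
  have mono: "z \<in> span (insert a A)" if "z \<in> span A" for z
    using that span_mono[of A "insert a A"] by blast
  have "w \<in> span (insert a A)"
    unfolding w_def by (intro span_diff[OF _ mono[OF p(1)]]) (simp add: span_base)
  then have 1: "y' \<in> span (insert a A)"
    unfolding y'_def by (intro span_add[OF mono[OF y(1)]] span_scale)
  have yw: "ip (x - y') w = 0"
    by (cases "w = 0") (auto simp: y'_def ip_simps)
  have yA: "ip (x - y') z = 0" if "z \<in> span A" for z
  proof -
    have "x - y' = (x - y) - (ip (x - y) w / ip w w) *\<^sub>R w" by (simp add: y'_def)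
    then have "ip (x - y') z = ip (x - y) z - ip (x - y) w / ip w w * ip w z"
      by (simp only: ip_simps real_scaleR_def)
    then show ?thesis using y(2)[OF that] p(2)[OF that] by (simp add: w_def)
  qed
  have "ip (x - y') z = 0" if z: "z \<in> span (insert a A)" for z
  proof -
    obtain k where "z - k *\<^sub>R a \<in> span A" using z span_breakdown_eq by metis
    then have "(z - k *\<^sub>R a) + k *\<^sub>R p \<in> span A" using p(1) by (simp add: span_add span_scale)
    then have "ip (x - y') ((z - k *\<^sub>R a) + k *\<^sub>R p + k *\<^sub>R w) = 0"
      using yA yw by (simp only: linear_add[OF lin2, of _ "(z - k *\<^sub>R a) + k *\<^sub>R p"] linear_cmul[OF lin2]) simp
    moreover have "(z - k *\<^sub>R a) + k *\<^sub>R p + k *\<^sub>R w = z" by (simp add: w_def algebra_simps)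
    ultimately show ?thesis by simp
  qed
  with 1 show ?case by blast
qed

text \<open>A maximizer of the Rayleigh quotient is an eigenvector. The sphere that provides
  compactness is the Euclidean one, unrelated to \<open>ip\<close>; this is harmless because the
  quotient is invariant under scaling.\<close>

lemma symmetric_eigenvector:
  assumes V: "subspace V" "V \<noteq> {0}" and T: "linear T" "\<And>x. x \<in> V \<Longrightarrow> T x \<in> V"
    and sa: "\<And>x y. ip (T x) y = ip x (T y)"
  obtains v c where "v \<in> V" "v \<noteq> 0" "T v = c *\<^sub>R v"
proof -
  have ct: "continuous_on A (\<lambda>x. ip (f x) (g x))" if "linear f" "linear g" for A and f g :: "'a \<Rightarrow> 'a"
  proof -
    have "bounded_bilinear ip" using bil bilinear_conv_bounded_bilinear by blast
    from bounded_bilinear.continuous_on[OF this linear_continuous_on linear_continuous_on]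
    show ?thesis using that by (simp add: linear_conv_bounded_linear)
  qed
  have ctI: "continuous_on A (\<lambda>x. ip x x)" "continuous_on A (\<lambda>x. ip (T x) x)" for A
    using ct[of "\<lambda>x. x" "\<lambda>x. x"] ct[OF T(1), of "\<lambda>x. x"] by (simp_all add: linear_id[unfolded id_def])
  let ?S = "sphere 0 1 \<inter> V"
  define q where "q x = ip (T x) x / ip x x" for x
  have cpt: "compact ?S"
    using closed_subspace[OF V(1)] by (simp add: compact_Int_closed)
  obtain w where w: "w \<in> V" "w \<noteq> 0" using V subspace_0 by blast
  then have "(1 / norm w) *\<^sub>R w \<in> ?S" by (simp add: subspace_scale[OF V(1)])
  then have ne: "?S \<noteq> {}" by blast
  have "continuous_on ?S q"
    unfolding q_def by (intro continuous_on_divide ctI) auto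
  from continuous_attains_sup[OF cpt ne this]
  obtain v where v: "v \<in> ?S" "\<And>x. x \<in> ?S \<Longrightarrow> q x \<le> q v" by blast
  have v0: "v \<in> V" "v \<noteq> 0" using v(1) by auto
  have qsc: "q (a *\<^sub>R x) = q x" if "a \<noteq> 0" for a x
    using that by (simp add: q_def ip_simps linear_cmul[OF T(1)])
  define c where "c = q v"
  have max: "ip (T x) x \<le> c * ip x x" if "x \<in> V" for x
  proof (cases "x = 0")
    case False
    then have "(1 / norm x) *\<^sub>R x \<in> ?S" using that by (simp add: subspace_scale[OF V(1)])
    then have "q x \<le> c" using v(2)[of "(1 / norm x) *\<^sub>R x"] qsc[of "1 / norm x" x] False by (simp add: c_def)
    then show ?thesis using pd[OF False] by (simp add: q_def divide_simps)
  qed (simp add: ip_simps linear_0[OF T(1)])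
  have eqv: "ip (T v) v = c * ip v v"
    using pd[OF v0(2)] v0 by (simp add: c_def q_def)
  \<comment> \<open>Moving from \<open>v\<close> by \<open>s\<close> times the defect
    \<open>w\<close> changes \<open>ip (T x) x - c * ip x x\<close> by \<open>2 * s * ip w w\<close>
    to first order. That expression is at most 0 on \<open>V\<close> and equals 0 at
    \<open>v\<close>, so \<open>w\<close> must vanish.\<close>
  define w where "w = T v - c *\<^sub>R v"
  have wV: "w \<in> V" using v0 T(2) V(1) by (simp add: w_def subspace_diff subspace_scale)
  have wv: "ip w w = ip (T v) w - c * ip v w" 
    using linear_diff[OF lin1, of "T v" "c *\<^sub>R v" w] linear_cmul[OF lin1, of c v w] by (simp add: w_def[symmetric])
  have key: "2 * s * ip w w + s\<^sup>2 * (ip (T w) w - c * ip w w) \<le> 0" for s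
  proof -
    have "v + s *\<^sub>R w \<in> V" using v0 wV V(1) by (simp add: subspace_add subspace_scale)
    from max[OF this] have "ip (T v) v + s * ip (T v) w + s * ip (T w) v + s * s * ip (T w) w
       \<le> c * (ip v v + s * ip v w + s * ip w v + s * s * ip w w)"
      by (simp add: ip_simps linear_add[OF T(1)] linear_cmul[OF T(1)] algebra_simps)
    moreover have "ip (T w) v = ip (T v) w" using sa sym by metis
    moreover have "ip (T v) w = ip w w + c * ip v w" using wv by simp
    ultimately have "c * ip v v + 2 * s * (ip w w + c * ip v w) + s * s * ip (T w) w
       \<le> c * (ip v v + 2 * s * ip v w + s * s * ip w w)"
      using sym[of w v] by (simp only: eqv) (simp add: algebra_simps)
    then show ?thesis by (simp add: algebra_simps power2_eq_square)
  qed
  have "ip w w = 0"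
  proof (rule ccontr)
    assume nz: "ip w w \<noteq> 0"
    then have p: "ip w w > 0" using pd[of w] by simp
    define D where "D = \<bar>ip (T w) w - c * ip w w\<bar> + 1"
    have D: "D > 0" "- D \<le> ip (T w) w - c * ip w w" unfolding D_def by auto
    \<comment> \<open>With this \<open>s\<close> the quadratic term is at least minus half of the
      linear one.\<close>
    define s where "s = ip w w / D"
    have s: "s > 0" using p D by (simp add: s_def)
    have "2 * s * ip w w - s\<^sup>2 * D \<le> 2 * s * ip w w + s\<^sup>2 * (ip (T w) w - c * ip w w)"
      using mult_left_mono[OF D(2), of "s\<^sup>2"] by simp
    also have "\<dots> \<le> 0" by (rule key)
    finally have "2 * s * ip w w \<le> s\<^sup>2 * D" by simp
    also have "\<dots> = s * ip w w" using D by (simp add: s_def power2_eq_square)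
    finally show False using s p by simp
  qed
  then have "T v = c *\<^sub>R v" by (simp add: w_def)
  with v0 that show thesis by blast
qed

text \<open>Unless every vector of \<open>V\<close> is a joint eigenvector, some \<open>T i\<close>
  has an eigenspace \<open>V1\<close> in \<open>V\<close> that is neither zero nor all of
  \<open>V\<close>. It and its orthogonal complement are stable under the whole commuting family and
  have smaller dimension. The family may be infinite, as it is for \<open>\<aa>\<close>.\<close>

lemma joint_eigenvectors_span:
  fixes T :: "'b \<Rightarrow> 'a \<Rightarrow> 'a"
  assumes lin: "\<And>i. i \<in> I \<Longrightarrow> linear (T i)"
    and sa: "\<And>i x y. i \<in> I \<Longrightarrow> ip (T i x) y = ip x (T i y)"
    and comm: "\<And>i j x. i \<in> I \<Longrightarrow> j \<in> I \<Longrightarrow> T i (T j x) = T j (T i x)"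
    and "subspace V" "\<And>i x. i \<in> I \<Longrightarrow> x \<in> V \<Longrightarrow> T i x \<in> V"
  shows "V \<subseteq> span {v \<in> V. \<forall>i\<in>I. \<exists>c. T i v = c *\<^sub>R v}"
  using assms(4,5)
proof (induction "dim V" arbitrary: V rule: less_induct)
  case less
  note V = less.prems
  show ?case
  proof (cases "\<forall>i\<in>I. \<forall>v\<in>V. \<exists>c. T i v = c *\<^sub>R v")
    case True
    then show ?thesis by (auto intro: span_base)
  next
    case False
    then obtain i u where i: "i \<in> I" "u \<in> V" "\<And>c. T i u \<noteq> c *\<^sub>R u" by blast
    then have "u \<noteq> 0" by (metis lin linear_0 scaleR_zero_right)
    with i have V0: "V \<noteq> {0}" by blast
    obtain v c where v: "v \<in> V" "v \<noteq> 0" "T i v = c *\<^sub>R v"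
      using symmetric_eigenvector[OF V(1) V0 lin[OF i(1)] V(2)[OF i(1)] sa[OF i(1)]] by blast
    define V1 where "V1 = {x \<in> V. T i x = c *\<^sub>R x}"
    define V2 where "V2 = {x \<in> V. \<forall>y\<in>V1. ip x y = 0}"
    have s1: "subspace V1"
      using V(1) lin[OF i(1)] unfolding V1_def subspace_def
      by (auto simp: linear_0 linear_add linear_cmul scaleR_add_right)
    have s2: "subspace V2"
      using V(1) unfolding V2_def subspace_def by (auto simp: ip_simps)
    have i1: "T j x \<in> V1" if "j \<in> I" "x \<in> V1" for j x
      using that V(2) comm[OF i(1) that(1)] lin[OF that(1)] unfolding V1_def
      by (auto simp: linear_cmul)
    have i2: "T j x \<in> V2" if "j \<in> I" "x \<in> V2" for j x
      using that V(2) sa[OF that(1)] i1[OF that(1)] unfolding V2_def by auto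
    have "V1 \<subset> V" using i by (auto simp: V1_def)
    then have d1: "dim V1 < dim V" using s1 V(1)
      by (intro dim_psubset) (simp add: span_eq_iff[THEN iffD2])
    have "v \<in> V1" using v by (simp add: V1_def)
    then have "v \<notin> V2" using pd[OF v(2)] v by (force simp: V2_def)
    then have "V2 \<subset> V" using v by (auto simp: V2_def)
    then have d2: "dim V2 < dim V" using s2 V(1)
      by (intro dim_psubset) (simp add: span_eq_iff[THEN iffD2])
    let ?E = "\<lambda>V. {v \<in> V. \<forall>i\<in>I. \<exists>c. T i v = c *\<^sub>R v}"
    have sub1: "V1 \<subseteq> span (?E V)"
      using less.hyps[OF d1 s1 i1] span_mono[of "?E V1" "?E V"] by (auto simp: V1_def)
    have sub2: "V2 \<subseteq> span (?E V)"
      using less.hyps[OF d2 s2 i2] span_mono[of "?E V2" "?E V"] by (auto simp: V2_def)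
    show ?thesis
    proof
      fix x assume x: "x \<in> V"
      obtain A where A: "finite A" "span A = V1"
        using basis_exists[of V1] s1 by (metis independent_bound span_minimal subset_antisym)
      obtain y where y: "y \<in> V1" "\<And>z. z \<in> V1 \<Longrightarrow> ip (x - y) z = 0"
        using orthogonal_projection_exists[OF A(1)] A(2) by blast
      define z where "z = x - y"
      have yz: "y \<in> V1" "z \<in> V2" "x = y + z"
        using y x V(1) by (auto simp: z_def V2_def V1_def intro: subspace_diff)
      then show "x \<in> span (?E V)" using sub1 sub2 by (auto intro: span_add)
    qed
  qed
qed

end

section \<open>The exponential series of the adjoint representation\<close>

text \<open>Expanding \<open>B\<close> in coordinates leaves finitely many scalar Cauchy products,
  one for each pair of basis vectors.\<close>

lemma bilinear_Cauchy_product: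
  fixes B :: "'a::euclidean_space \<Rightarrow> 'b::euclidean_space \<Rightarrow> 'c::real_normed_vector"
  assumes B: "bilinear B" and u: "summable (\<lambda>n. norm (u n))" and w: "summable (\<lambda>n. norm (w n))"
  shows "(\<lambda>n. \<Sum>i\<le>n. B (u i) (w (n - i))) sums B (suminf u) (suminf w)"
proof -
  have expand: "B x y = (\<Sum>c\<in>Basis. \<Sum>d\<in>Basis. ((x \<bullet> c) * (y \<bullet> d)) *\<^sub>R B c d)" for x y
  proof -
    have "B x y = B (\<Sum>c\<in>Basis. (x \<bullet> c) *\<^sub>R c) (\<Sum>d\<in>Basis. (y \<bullet> d) *\<^sub>R d)"
      by (simp add: euclidean_representation)
    also have "\<dots> = (\<Sum>(c, d)\<in>Basis \<times> Basis. B ((x \<bullet> c) *\<^sub>R c) ((y \<bullet> d) *\<^sub>R d))"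
      by (rule bilinear_sum[OF B])
    also have "\<dots> = (\<Sum>c\<in>Basis. \<Sum>d\<in>Basis. B ((x \<bullet> c) *\<^sub>R c) ((y \<bullet> d) *\<^sub>R d))"
      by (simp add: sum.cartesian_product)
    finally show ?thesis
      by (simp add: bilinear_lmul[OF B] bilinear_rmul[OF B] mult.commute)
  qed
  have summable_inner: "summable (\<lambda>n. norm (f n \<bullet> c))" if "summable (\<lambda>n. norm (f n))" "c \<in> Basis"
    for f :: "nat \<Rightarrow> 'd::euclidean_space" and c
    using that(1) by (rule summable_comparison_test'[where N=0]) (simp add: Basis_le_norm that(2))
  have su: "(\<Sum>n. f n \<bullet> c) = suminf f \<bullet> c" if "summable (\<lambda>n. norm (f n))"
    for f :: "nat \<Rightarrow> 'd::euclidean_space" and c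
    using bounded_linear.suminf[OF bounded_linear_inner_left summable_norm_cancel[OF that]] by simp
  have "(\<lambda>n. \<Sum>i\<le>n. (u i \<bullet> c) * (w (n - i) \<bullet> d)) sums ((suminf u \<bullet> c) * (suminf w \<bullet> d))"
    if "c \<in> Basis" "d \<in> Basis" for c d
    using Cauchy_product_sums[OF summable_inner[OF u that(1)] summable_inner[OF w that(2)]]
    by (simp add: su[OF u] su[OF w])
  then have "(\<lambda>n. \<Sum>c\<in>Basis. \<Sum>d\<in>Basis. (\<Sum>i\<le>n. (u i \<bullet> c) * (w (n - i) \<bullet> d)) *\<^sub>R B c d) sums
     (\<Sum>c\<in>Basis. \<Sum>d\<in>Basis. ((suminf u \<bullet> c) * (suminf w \<bullet> d)) *\<^sub>R B c d)"
    by (intro sums_sum sums_scaleR_left)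
  moreover have "(\<Sum>c\<in>Basis. \<Sum>d\<in>Basis. (\<Sum>i\<le>n. (u i \<bullet> c) * (w (n - i) \<bullet> d)) *\<^sub>R B c d)
    = (\<Sum>i\<le>n. B (u i) (w (n - i)))" for n
  proof -
    have "(\<Sum>i\<le>n. B (u i) (w (n - i))) = (\<Sum>i\<le>n. \<Sum>c\<in>Basis. \<Sum>d\<in>Basis. ((u i \<bullet> c) * (w (n - i) \<bullet> d)) *\<^sub>R B c d)"
      by (rule sum.cong[OF refl expand])
    also have "\<dots> = (\<Sum>c\<in>Basis. \<Sum>i\<le>n. \<Sum>d\<in>Basis. ((u i \<bullet> c) * (w (n - i) \<bullet> d)) *\<^sub>R B c d)"
      by (rule sum.swap)
    also have "\<dots> = (\<Sum>c\<in>Basis. \<Sum>d\<in>Basis. \<Sum>i\<le>n. ((u i \<bullet> c) * (w (n - i) \<bullet> d)) *\<^sub>R B c d)"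
      by (intro sum.cong[OF refl] sum.swap)
    finally show ?thesis by (simp add: scaleR_sum_left)
  qed
  ultimately show ?thesis by (simp add: expand[of "suminf u"])
qed

section \<open>The exponential of \<open>ad X\<close>: automorphism, inverse, derivative at
  0\<close>

context real_lie_algebra
begin

lemma br_lin1: "linear (\<lambda>x. br x y)" and br_lin2: "linear (\<lambda>y. br x y)"
  using bilinear_br by (auto simp: bilinear_def)

lemmas br_simps = linear_add[OF br_lin1] linear_add[OF br_lin2] linear_cmul[OF br_lin1] linear_cmul[OF br_lin2]
  linear_diff[OF br_lin1] linear_diff[OF br_lin2] linear_0[OF br_lin1] linear_0[OF br_lin2]
  linear_neg[OF br_lin1] linear_neg[OF br_lin2]

lemma br_swap: "br X Y = - br Y X"
proof -
  have "br (X + Y) (X + Y) = br X X + br Y Y + (br X Y + br Y X)"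
    by (simp only: br_simps add_ac)
  then show ?thesis by (simp add: br_self eq_neg_iff_add_eq_0)
qed

lemma br_deriv: "br X (br Y Z) = br (br X Y) Z + br Y (br X Z)"
proof -
  have 1: "br Y (br Z X) = - br Y (br X Z)" by (subst br_swap[of Z X]) (simp add: br_simps)
  have "br X (br Y Z) - (br (br X Y) Z + br Y (br X Z)) = 0"
    using jacobi[of X Y Z] unfolding 1 br_swap[of Z "br X Y"] by (simp add: algebra_simps)
  then show ?thesis by simp
qed

definition brK :: real where
  "brK = (SOME K. K > 0 \<and> (\<forall>x y. norm (br x y) \<le> K * norm x * norm y))"

lemma brK: "brK > 0" "norm (br x y) \<le> brK * norm x * norm y"
proof -
  have "\<exists>K. K > 0 \<and> (\<forall>x y. norm (br x y) \<le> K * norm x * norm y)"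
    using bilinear_bounded_pos[OF bilinear_br] by metis
  from someI_ex[OF this] show "brK > 0" "norm (br x y) \<le> brK * norm x * norm y"
    unfolding brK_def by auto
qed

lemma linear_ad_pow: "linear (br X ^^ n)"
proof (induction n)
  case 0
  show ?case using linear_id by (simp add: id_def)
next
  case (Suc n)
  show ?case using linear_compose[OF Suc.IH br_lin2[of X]] by (simp add: o_def)
qed

lemma norm_ad_pow: "norm ((br X ^^ n) Y) \<le> (brK * norm X) ^ n * norm Y"
proof (induction n)
  case (Suc n)
  have "norm ((br X ^^ Suc n) Y) \<le> brK * norm X * norm ((br X ^^ n) Y)"
    using brK(2)[of X "(br X ^^ n) Y"] by simp
  also have "\<dots> \<le> brK * norm X * ((brK * norm X) ^ n * norm Y)"
    using brK(1) by (intro mult_left_mono Suc.IH) simp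
  finally show ?case by (simp add: mult_ac)
qed simp

lemma exp_ad_term_bound:
  "norm ((br X ^^ n) Y /\<^sub>R fact n) \<le> (brK * norm X) ^ n /\<^sub>R fact n * norm Y"
  using norm_ad_pow[of n X Y] by (simp add: divide_simps)

lemma exp_ad_norm_summable: "summable (\<lambda>n. norm ((br X ^^ n) Y /\<^sub>R fact n))"
proof (rule summable_comparison_test'[where N=0])
  show "summable (\<lambda>n. (brK * norm X) ^ n /\<^sub>R fact n * norm Y)"
    by (intro summable_mult2 summable_exp_generic)
  show "norm (norm ((br X ^^ n) Y /\<^sub>R fact n)) \<le> (brK * norm X) ^ n /\<^sub>R fact n * norm Y" for n
    using exp_ad_term_bound[of n X Y] by simp
qed

lemma exp_ad_sums: "(\<lambda>n. (br X ^^ n) Y /\<^sub>R fact n) sums exp_ad X Y"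
  unfolding exp_ad_def using summable_norm_cancel[OF exp_ad_norm_summable] by (rule summable_sums)

lemma linear_exp_ad: "linear (exp_ad X)"
proof (rule linearI)
  fix Y Z c
  note l = linear_ad_pow[of _ X]
  have "(\<lambda>n. (br X ^^ n) (Y + Z) /\<^sub>R fact n) sums (exp_ad X Y + exp_ad X Z)"
    using sums_add[OF exp_ad_sums[of X Y] exp_ad_sums[of X Z]]
    by (simp add: linear_add[OF l] scaleR_add_right)
  with exp_ad_sums show "exp_ad X (Y + Z) = exp_ad X Y + exp_ad X Z" by (rule sums_unique2)
  have "(\<lambda>n. (br X ^^ n) (c *\<^sub>R Y) /\<^sub>R fact n) sums (c *\<^sub>R exp_ad X Y)"
    using sums_scaleR_right[OF exp_ad_sums[of X Y], of c]
    by (simp add: linear_cmul[OF l] mult.commute)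
  with exp_ad_sums show "exp_ad X (c *\<^sub>R Y) = c *\<^sub>R exp_ad X Y" by (rule sums_unique2)
qed

lemmas exp_ad_simps = linear_add[OF linear_exp_ad] linear_cmul[OF linear_exp_ad] linear_diff[OF linear_exp_ad]
  linear_0[OF linear_exp_ad] linear_neg[OF linear_exp_ad]

lemma exp_ad_fixed:
  assumes "br X Y = 0"
  shows "exp_ad X Y = Y"
proof -
  have "(br X ^^ n) Y /\<^sub>R fact n = (if n = 0 then Y else 0)" for n
  proof (cases n)
    case (Suc k)
    have "(br X ^^ Suc k) Y = (br X ^^ k) (br X Y)" by (simp only: funpow_Suc_right o_apply)
    then show ?thesis using Suc linear_0[OF linear_ad_pow] assms by simp
  qed simp
  then have "(\<lambda>n. (br X ^^ n) Y /\<^sub>R fact n) sums Y"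
    using sums_single[of 0 "\<lambda>n. Y"] by (simp cong: if_cong)
  with exp_ad_sums show ?thesis by (rule sums_unique2)
qed

lemma exp_ad_0 [simp]: "exp_ad 0 = id"
  by (rule ext) (simp add: exp_ad_fixed br_simps)

definition lie_auto :: "('g \<Rightarrow> 'g) \<Rightarrow> bool" where
  "lie_auto T \<longleftrightarrow> linear T \<and> bij T \<and> (\<forall>X Y. T (br X Y) = br (T X) (T Y))"

lemma Leibniz: "(br X ^^ n) (br Y Z) = (\<Sum>i\<le>n. real (n choose i) *\<^sub>R br ((br X ^^ i) Y) ((br X ^^ (n - i)) Z))"
proof (induction n)
  case (Suc n)
  let ?f = "\<lambda>i j. br ((br X ^^ i) Y) ((br X ^^ j) Z)"
  have "(br X ^^ Suc n) (br Y Z) = (\<Sum>i\<le>n. real (n choose i) *\<^sub>R br X (?f i (n - i)))"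
    by (simp add: Suc.IH linear_sum[OF br_lin2] linear_cmul[OF br_lin2])
  also have "\<dots> = (\<Sum>i\<le>n. real (n choose i) *\<^sub>R ?f (Suc i) (n - i)) + (\<Sum>i\<le>n. real (n choose i) *\<^sub>R ?f i (Suc n - i))"
  proof -
    have "br X (?f i (n - i)) = ?f (Suc i) (n - i) + ?f i (Suc n - i)" if "i \<le> n" for i
      using that by (subst br_deriv) (simp add: Suc_diff_le)
    then have "(\<Sum>i\<le>n. real (n choose i) *\<^sub>R br X (?f i (n - i))) = 
      (\<Sum>i\<le>n. real (n choose i) *\<^sub>R ?f (Suc i) (n - i) + real (n choose i) *\<^sub>R ?f i (Suc n - i))"
      by (intro sum.cong) (auto simp: scaleR_add_right)
    then show ?thesis by (simp only: sum.distrib)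
  qed
  also have "(\<Sum>i\<le>n. real (n choose i) *\<^sub>R ?f i (Suc n - i)) = (\<Sum>i\<le>Suc n. real (n choose i) *\<^sub>R ?f i (Suc n - i))"
    by (simp add: binomial_eq_0)
  also have "\<dots> = ?f 0 (Suc n) + (\<Sum>i\<le>n. real (n choose Suc i) *\<^sub>R ?f (Suc i) (n - i))"
    by (subst sum.atMost_Suc_shift) simp
  also have "(\<Sum>i\<le>n. real (n choose i) *\<^sub>R ?f (Suc i) (n - i)) + 
     (?f 0 (Suc n) + (\<Sum>i\<le>n. real (n choose Suc i) *\<^sub>R ?f (Suc i) (n - i))) =
     ?f 0 (Suc n) + (\<Sum>i\<le>n. real (Suc n choose Suc i) *\<^sub>R ?f (Suc i) (n - i))"
    by (simp add: sum.distrib[symmetric] scaleR_add_left del: funpow.simps)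
  also have "\<dots> = (\<Sum>i\<le>Suc n. real (Suc n choose i) *\<^sub>R ?f i (Suc n - i))"
    by (subst sum.atMost_Suc_shift) (simp del: funpow.simps binomial_Suc_Suc)
  finally show ?case .
qed simp

text \<open>The exponential of a derivation is an automorphism: divided by \<open>fact n\<close>,
  the Leibniz formula is the n-th term of the Cauchy product of the two series.\<close>

lemma exp_ad_br: "exp_ad X (br Y Z) = br (exp_ad X Y) (exp_ad X Z)"
proof -
  let ?u = "\<lambda>Y n. (br X ^^ n) Y /\<^sub>R fact n"
  have "(\<lambda>n. \<Sum>i\<le>n. br (?u Y i) (?u Z (n - i))) sums br (exp_ad X Y) (exp_ad X Z)"
    unfolding exp_ad_def
    by (rule bilinear_Cauchy_product[OF bilinear_br exp_ad_norm_summable exp_ad_norm_summable])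
  moreover have "(\<Sum>i\<le>n. br (?u Y i) (?u Z (n - i))) = ?u (br Y Z) n" for n
    unfolding Leibniz scaleR_sum_right
    by (intro sum.cong refl) (simp add: br_simps binomial_fact field_simps)
  ultimately have "(\<lambda>n. ?u (br Y Z) n) sums br (exp_ad X Y) (exp_ad X Z)" by simp
  with exp_ad_sums show ?thesis by (rule sums_unique2)
qed

lemma ad_pow_uminus: "(br (- X) ^^ n) Y = (-1) ^ n *\<^sub>R (br X ^^ n) Y"
  by (induction n) (simp_all add: br_simps)

text \<open>In the product of the two series the coefficient of the n-th power of
  \<open>ad X\<close> is an alternating sum of binomial coefficients, which vanishes for positive n.
  The product is taken entrywise in the standard basis, as for matrices.\<close>

lemma exp_ad_uminus: "exp_ad (- X) (exp_ad X Y) = Y"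
proof -
  let ?u = "\<lambda>X Y n. (br X ^^ n) Y /\<^sub>R fact n"
  have "(\<lambda>n. \<Sum>i\<le>n. ?u X Y (n - i) \<bullet> d * (?u (- X) d i \<bullet> c)) sums ((exp_ad (- X) d \<bullet> c) * (exp_ad X Y \<bullet> d))"
    if cd: "c \<in> Basis" "d \<in> Basis" for c d
  proof -
    have si: "summable (\<lambda>n. norm (?u X Y n \<bullet> c))" if "c \<in> Basis" for X Y c
      using exp_ad_norm_summable[of X Y]
      by (rule summable_comparison_test'[where N=0]) (simp only: real_norm_def abs_idempotent Basis_le_norm that)
    have su: "(\<Sum>n. ?u X Y n \<bullet> c) = exp_ad X Y \<bullet> c" for X Y c
      using bounded_linear.suminf[OF bounded_linear_inner_left summable_norm_cancel[OF exp_ad_norm_summable]]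
      unfolding exp_ad_def by metis
    show ?thesis using Cauchy_product_sums[OF si[OF cd(1), of "- X" d] si[OF cd(2), of X Y]]
      unfolding su by (simp only: mult.commute)
  qed
  then have "(\<lambda>n. \<Sum>d\<in>Basis. \<Sum>i\<le>n. ?u X Y (n - i) \<bullet> d * (?u (- X) d i \<bullet> c)) sums
      (\<Sum>d\<in>Basis. (exp_ad (- X) d \<bullet> c) * (exp_ad X Y \<bullet> d))" if "c \<in> Basis" for c
    using that by (intro sums_sum) auto
  moreover have "(\<Sum>d\<in>Basis. (exp_ad (- X) d \<bullet> c) * (exp_ad X Y \<bullet> d)) = exp_ad (- X) (exp_ad X Y) \<bullet> c" for c
    by (subst (4) euclidean_representation[symmetric])
       (simp only: linear_sum[OF linear_exp_ad] linear_cmul[OF linear_exp_ad] inner_sum_left inner_scaleR_left mult.commute)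
  moreover have "(\<Sum>d\<in>Basis. \<Sum>i\<le>n. ?u X Y (n - i) \<bullet> d * (?u (- X) d i \<bullet> c)) = (if n = 0 then Y \<bullet> c else 0)" for n c
  proof -
    have "(\<Sum>d\<in>Basis. \<Sum>i\<le>n. ?u X Y (n - i) \<bullet> d * (?u (- X) d i \<bullet> c)) =
       (\<Sum>i\<le>n. \<Sum>d\<in>Basis. ?u X Y (n - i) \<bullet> d * (?u (- X) d i \<bullet> c))" by (rule sum.swap)
    also have "\<dots> = (\<Sum>i\<le>n. ?u (- X) (?u X Y (n - i)) i \<bullet> c)"
    proof (rule sum.cong[OF refl])
      fix i
      have l: "linear (\<lambda>y. ?u (- X) y i \<bullet> c)"
        using linear_ad_pow[of i "- X"] by (auto intro!: linearI simp: linear_add linear_cmul inner_add_left algebra_simps)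
      have "?u (- X) (?u X Y (n - i)) i \<bullet> c = ?u (- X) (\<Sum>d\<in>Basis. (?u X Y (n - i) \<bullet> d) *\<^sub>R d) i \<bullet> c"
        by (simp only: euclidean_representation)
      also have "\<dots> = (\<Sum>d\<in>Basis. (?u X Y (n - i) \<bullet> d) * (?u (- X) d i \<bullet> c))"
        by (simp only: linear_sum[OF l] linear_cmul[OF l] real_scaleR_def)
      finally show "(\<Sum>d\<in>Basis. (?u X Y (n - i) \<bullet> d) * (?u (- X) d i \<bullet> c)) = ?u (- X) (?u X Y (n - i)) i \<bullet> c" by simp
    qed
    also have "\<dots> = (\<Sum>i\<le>n. (-1) ^ i * real (n choose i)) * (((br X ^^ n) Y \<bullet> c) / fact n)"
    proof -
      have "?u (- X) (?u X Y (n - i)) i \<bullet> c = (-1) ^ i * real (n choose i) * (((br X ^^ n) Y \<bullet> c) / fact n)"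
        if "i \<le> n" for i
      proof -
        have "(br X ^^ i) ((br X ^^ (n - i)) Y) = (br X ^^ n) Y"
          using that funpow_add[of i "n - i" "br X"] by simp
        then show ?thesis using that
          by (simp add: ad_pow_uminus linear_cmul[OF linear_ad_pow] binomial_fact field_simps)
      qed
      then show ?thesis unfolding sum_distrib_right by (intro sum.cong) auto
    qed
    also have "\<dots> = (if n = 0 then Y \<bullet> c else 0)"
      using choose_alternating_sum[of n, where 'a=real] by auto
    finally show ?thesis .
  qed
  ultimately have "(\<lambda>n. if n = 0 then Y \<bullet> c else 0) sums (exp_ad (- X) (exp_ad X Y) \<bullet> c)" if "c \<in> Basis" for c
    using that by simp
  moreover have "(\<lambda>n. if n = 0 then Y \<bullet> c else 0) sums (Y \<bullet> c)" for c
    using sums_single[of 0 "\<lambda>n. Y \<bullet> c"] by simp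
  ultimately show ?thesis
    by (intro euclidean_eqI[where 'a='g] sums_unique2[where 'a=real])
qed

lemma exp_ad_uminus': "exp_ad X (exp_ad (- X) Y) = Y"
  using exp_ad_uminus[of "- X"] by simp

lemma lie_auto_exp_ad: "lie_auto (exp_ad X)"
  unfolding lie_auto_def
  using linear_exp_ad exp_ad_br exp_ad_uminus exp_ad_uminus'
  by (auto intro!: o_bij[of "exp_ad (- X)"])

lemma lie_auto_comp: "lie_auto S \<Longrightarrow> lie_auto T \<Longrightarrow> lie_auto (S \<circ> T)"
  unfolding lie_auto_def by (auto intro: linear_compose bij_comp)

lemma lie_auto_exp_ad_conj:
  assumes "lie_auto T"
  shows "T (exp_ad X Y) = exp_ad (T X) (T Y)"
proof -
  have T: "linear T" "\<And>X Y. T (br X Y) = br (T X) (T Y)" using assms unfolding lie_auto_def by blast+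
  have "T ((br X ^^ n) Y) = (br (T X) ^^ n) (T Y)" for n
    by (induction n) (simp_all add: T(2))
  moreover have "(\<lambda>n. T ((br X ^^ n) Y /\<^sub>R fact n)) sums T (exp_ad X Y)"
    using T(1) by (intro bounded_linear.sums[OF _ exp_ad_sums]) (simp add: linear_conv_bounded_linear)
  ultimately have "(\<lambda>n. (br (T X) ^^ n) (T Y) /\<^sub>R fact n) sums T (exp_ad X Y)"
    by (simp add: linear_cmul[OF T(1)])
  with exp_ad_sums show ?thesis by (rule sums_unique2[symmetric])
qed

lemma exp_ad_continuous: "continuous_on UNIV (\<lambda>X. exp_ad X Y)"
proof -
  have "continuous_on (ball 0 r) (\<lambda>X. exp_ad X Y)" for r
  proof (rule uniform_limit_theorem)
    show "uniform_limit (ball 0 r) (\<lambda>n X. \<Sum>i<n. (br X ^^ i) Y /\<^sub>R fact i) (\<lambda>X. exp_ad X Y) sequentially"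
      unfolding exp_ad_def
    proof (rule Weierstrass_m_test)
      show "summable (\<lambda>n. (brK * r) ^ n /\<^sub>R fact n * norm Y)"
        by (intro summable_mult2 summable_exp_generic)
      show "norm ((br X ^^ n) Y /\<^sub>R fact n) \<le> (brK * r) ^ n /\<^sub>R fact n * norm Y" if "X \<in> ball 0 r" for X n
      proof -
        have "norm ((br X ^^ n) Y /\<^sub>R fact n) \<le> (brK * norm X) ^ n /\<^sub>R fact n * norm Y"
          by (rule exp_ad_term_bound)
        also have "\<dots> \<le> (brK * r) ^ n /\<^sub>R fact n * norm Y"
          using that brK(1) by (intro mult_right_mono scaleR_left_mono power_mono mult_left_mono) auto
        finally show ?thesis .
      qed
    qed
    have c: "continuous_on A (\<lambda>X. (br X ^^ i) Y)" for i A
    proof (induction i)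
      case (Suc i)
      have "bounded_bilinear br" using bilinear_br bilinear_conv_bounded_bilinear by blast
      from bounded_bilinear.continuous_on[OF this continuous_on_id Suc.IH] show ?case by simp
    qed simp
    show "\<forall>\<^sub>F n in sequentially. continuous_on (ball 0 r) (\<lambda>X. \<Sum>i<n. (br X ^^ i) Y /\<^sub>R fact i)"
      by (intro always_eventually allI continuous_intros c)
  qed simp
  then have "isCont (\<lambda>X. exp_ad X Y) x" for x
    by (rule continuous_on_interior[of "ball 0 (norm x + 1)"]) simp_all
  then show ?thesis by (simp add: continuous_at_imp_continuous_on)
qed

text \<open>Beyond the terms of order 0 and 1 the tail is quadratic in \<open>norm X\<close>. The
  factorization argument differentiates exponentials at 0 only.\<close>

lemma exp_ad_has_derivative_0: "((\<lambda>X. exp_ad X Y) has_derivative (\<lambda>X. br X Y)) (at 0)"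
proof -
  have bound: "norm (exp_ad X Y - Y - br X Y) \<le> (brK * norm X)\<^sup>2 * exp (brK * norm X) * norm Y" for X
  proof -
    let ?u = "\<lambda>n. (br X ^^ n) Y /\<^sub>R fact n" and ?b = "\<lambda>n. (brK * norm X)\<^sup>2 * ((brK * norm X) ^ n /\<^sub>R fact n) * norm Y"
    have "(\<lambda>n. ?u (n + 2)) sums (exp_ad X Y - (\<Sum>i<2. ?u i))"
      by (rule sums_split_initial_segment[OF exp_ad_sums])
    then have 1: "(\<lambda>n. ?u (n + 2)) sums (exp_ad X Y - Y - br X Y)"
      by (simp add: numeral_2_eq_2 diff_diff_eq)
    have "?b sums ((brK * norm X)\<^sup>2 * exp (brK * norm X) * norm Y)"
      by (intro sums_mult2 sums_mult exp_converges)
    moreover have "norm (?u (n + 2)) \<le> ?b n" for n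
    proof -
      have f: "(fact n :: real) \<le> fact (n + 2)" by (rule fact_mono) simp
      have "norm (?u (n + 2)) \<le> (brK * norm X) ^ (n + 2) /\<^sub>R fact (n + 2) * norm Y"
        by (rule exp_ad_term_bound)
      also have "\<dots> \<le> (brK * norm X) ^ (n + 2) /\<^sub>R fact n * norm Y"
        using f brK(1) by (intro mult_right_mono scaleR_right_mono le_imp_inverse_le) auto
      also have "\<dots> = ?b n" by (simp add: power_add power_mult_distrib power2_eq_square field_simps)
      finally show ?thesis .
    qed
    ultimately show ?thesis
      using 1 by (metis (no_types, lifting) norm_suminf_le sums_iff)
  qed
  show ?thesis
    unfolding has_derivative_at_within
  proof (intro conjI)
    show "bounded_linear (\<lambda>X. br X Y)" using br_lin1 linear_conv_bounded_linear by blast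
    have "isCont (\<lambda>X. brK\<^sup>2 * norm X * exp (brK * norm X) * norm Y) (0::'g)"
      by (intro continuous_intros)
    then have t: "((\<lambda>X::'g. brK\<^sup>2 * norm X * exp (brK * norm X) * norm Y) \<longlongrightarrow> 0) (at 0)" by (simp add: continuous_at)
    show "((\<lambda>X. (exp_ad X Y - exp_ad 0 Y - br (X - 0) Y) /\<^sub>R norm (X - 0)) \<longlongrightarrow> 0) (at 0)"
    proof (rule Lim_null_comparison[OF _ t])
      show "\<forall>\<^sub>F X in at 0. norm ((exp_ad X Y - exp_ad 0 Y - br (X - 0) Y) /\<^sub>R norm (X - 0))
         \<le> brK\<^sup>2 * norm X * exp (brK * norm X) * norm Y"
      proof (rule always_eventually, rule allI)
        fix X
        show "norm ((exp_ad X Y - exp_ad 0 Y - br (X - 0) Y) /\<^sub>R norm (X - 0))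
           \<le> brK\<^sup>2 * norm X * exp (brK * norm X) * norm Y"
        proof (cases "X = 0")
          case False
          have "norm ((exp_ad X Y - exp_ad 0 Y - br (X - 0) Y) /\<^sub>R norm (X - 0)) = norm (exp_ad X Y - Y - br X Y) / norm X"
            by (simp add: divide_inverse mult.commute)
          also have "\<dots> \<le> brK\<^sup>2 * norm X * exp (brK * norm X) * norm Y"
            using bound[of X] False by (simp add: pos_divide_le_eq power2_eq_square mult_ac)
          finally show ?thesis .
        qed simp
      qed
    qed
  qed
qed

end

section \<open>Automorphisms near the identity\<close>

lemma linear_norm_bound:
  fixes A :: "'a::euclidean_space \<Rightarrow> 'b::real_normed_vector"
  assumes "linear A"
  shows "norm (A x) \<le> (\<Sum>b\<in>Basis. norm (A b)) * norm x"
proof -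
  have "norm (A x) = norm (A (\<Sum>b\<in>Basis. (x \<bullet> b) *\<^sub>R b))" by (simp add: euclidean_representation)
  also have "\<dots> = norm (\<Sum>b\<in>Basis. (x \<bullet> b) *\<^sub>R A b)"
    by (simp add: linear_sum[OF assms] linear_cmul[OF assms])
  also have "\<dots> \<le> (\<Sum>b\<in>Basis. norm x * norm (A b))"
    by (intro sum_norm_le) (simp add: Basis_le_norm mult_right_mono)
  finally show ?thesis by (simp add: sum_distrib_left mult.commute)
qed

section \<open>The Killing form and the trace functional \<open>ktr\<close>\<close>

context real_lie_algebra
begin

lemma killing_tr: "killing X Y = tr (\<lambda>z. br X (br Y z))"
  by (simp add: killing_def tr_def)

lemma bilinear_killing: "bilinear killing"
  unfolding bilinear_def killing_def
  by (auto intro!: linearI simp: br_simps inner_add_left sum.distrib sum_distrib_left)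

lemmas killing_simps = bilinear_ladd[OF bilinear_killing] bilinear_radd[OF bilinear_killing]
  bilinear_lmul[OF bilinear_killing] bilinear_rmul[OF bilinear_killing]
  bilinear_lneg[OF bilinear_killing] bilinear_rneg[OF bilinear_killing]
  bilinear_lzero[OF bilinear_killing] bilinear_rzero[OF bilinear_killing]

lemma killing_sym: "killing X Y = killing Y X"
  unfolding killing_tr by (rule tr_commute[OF br_lin2 br_lin2])

lemma br_br: "br (br X Y) Z = br X (br Y Z) - br Y (br X Z)"
  using br_deriv[of X Y Z] by simp

lemma killing_br: "killing (br X Y) Z = killing X (br Y Z)"
proof -
  have l: "linear (\<lambda>z. br X (br Z z))" using linear_compose[OF br_lin2 br_lin2] by (simp add: o_def)
  have "tr (\<lambda>z. br Y (br X (br Z z))) = tr (\<lambda>z. br X (br Z (br Y z)))"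
    by (rule tr_commute[OF br_lin2 l])
  then show ?thesis by (simp add: killing_tr br_br br_simps tr_diff)
qed

text \<open>\<open>ktr\<close> represents \<open>X \<mapsto> tr (A \<circ> ad X)\<close>; on \<open>A = ad Z\<close> it represents \<open>killing Z\<close>.\<close>
definition ktr :: "('g \<Rightarrow> 'g) \<Rightarrow> 'g" where
  "ktr A = (\<Sum>b\<in>Basis. tr (\<lambda>z. A (br b z)) *\<^sub>R b)"

lemma ktr_inner: "b \<in> Basis \<Longrightarrow> ktr A \<bullet> b = tr (\<lambda>z. A (br b z))"
  by (simp add: ktr_def inner_sum_left inner_Basis if_distrib cong: if_cong)

lemma linear_ktr_ad: "linear (\<lambda>X. ktr (br X))"
  unfolding ktr_def
  by (auto intro!: linearI simp: killing_tr[symmetric] killing_simps scaleR_add_left sum.distrib scaleR_sum_right)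

lemma ktr_diff: "ktr (\<lambda>x. A x - B x) = ktr A - ktr B"
  by (simp add: ktr_def tr_diff scaleR_diff_left sum_subtractf)

lemma ktr_eq_0_imp_tr:
  assumes "ktr A = 0" "linear A"
  shows "tr (\<lambda>z. A (br X z)) = 0"
proof -
  have l: "linear (\<lambda>X. tr (\<lambda>z. A (br X z)))"
    using assms(2) by (auto intro!: linearI simp: br_simps linear_add linear_cmul tr_add tr_scale)
  have "tr (\<lambda>z. A (br X z)) = tr (\<lambda>z. A (br (\<Sum>b\<in>Basis. (X \<bullet> b) *\<^sub>R b) z))"
    by (simp add: euclidean_representation)
  also have "\<dots> = (\<Sum>b\<in>Basis. (X \<bullet> b) * (ktr A \<bullet> b))"
    by (simp add: linear_sum[OF l] linear_cmul[OF l] ktr_inner)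
  finally show ?thesis using assms(1) by simp
qed

text \<open>Product rule at 0 with both slots varying. The second slot may itself be of this shape,
  so nesting the rule treats a composition of several exponentials.\<close>

lemma has_derivative_exp_ad_app:
  fixes p g :: "'g \<Rightarrow> 'g"
  assumes p: "linear p" and g: "(g has_derivative g') (at 0)"
  shows "((\<lambda>v. exp_ad (p v) (g v)) has_derivative (\<lambda>h. br (p h) (g 0) + g' h)) (at 0)"
proof -
  have p0: "p 0 = 0" and bp: "bounded_linear p" by (rule linear_0[OF p]) (rule linear_imp_bounded_linear[OF p])
  have 1: "((\<lambda>v. exp_ad (p v) b) has_derivative (\<lambda>h. br (p h) b)) (at 0)" for b
    using has_derivative_compose[OF bounded_linear_imp_has_derivative[OF bp], of "\<lambda>X. exp_ad X b"
      "\<lambda>h. br h b" 0 UNIV] exp_ad_has_derivative_0[of b] p0 by simp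
  have 2: "((\<lambda>v. g v \<bullet> b) has_derivative (\<lambda>h. g' h \<bullet> b)) (at 0)" for b
    by (rule bounded_linear.has_derivative[OF bounded_linear_inner_left g])
  have "((\<lambda>v. \<Sum>b\<in>Basis. (g v \<bullet> b) *\<^sub>R exp_ad (p v) b) has_derivative
     (\<lambda>h. \<Sum>b\<in>Basis. (g 0 \<bullet> b) *\<^sub>R br (p h) b + (g' h \<bullet> b) *\<^sub>R exp_ad (p 0) b)) (at 0)"
    by (intro has_derivative_sum has_derivative_scaleR 1 2)
  moreover have "(\<Sum>b\<in>Basis. (g v \<bullet> b) *\<^sub>R exp_ad (p v) b) = exp_ad (p v) (g v)" for v
    by (subst (3) euclidean_representation[symmetric])
      (simp only: linear_sum[OF linear_exp_ad] linear_cmul[OF linear_exp_ad])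
  moreover have "(\<Sum>b\<in>Basis. (g 0 \<bullet> b) *\<^sub>R br (p h) b + (g' h \<bullet> b) *\<^sub>R exp_ad (p 0) b) = br (p h) (g 0) + g' h" for h
  proof -
    have "(\<Sum>b\<in>Basis. (g 0 \<bullet> b) *\<^sub>R br (p h) b) = br (p h) (\<Sum>b\<in>Basis. (g 0 \<bullet> b) *\<^sub>R b)"
      by (simp only: linear_sum[OF br_lin2] linear_cmul[OF br_lin2])
    then show ?thesis by (simp add: p0 sum.distrib euclidean_representation)
  qed
  ultimately show ?thesis by simp
qed

lemma continuous_exp_ad_app:
  fixes p g :: "'g \<Rightarrow> 'g"
  assumes p: "linear p" and g: "continuous_on UNIV g"
  shows "continuous_on UNIV (\<lambda>v. exp_ad (p v) (g v))"
proof -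
  have bp: "continuous_on UNIV p" by (rule linear_continuous_on[OF linear_imp_bounded_linear[OF p]])
  have 1: "continuous_on UNIV (\<lambda>v. exp_ad (p v) b)" for b
    by (rule continuous_on_compose2[OF exp_ad_continuous bp]) simp
  have "continuous_on UNIV (\<lambda>v. \<Sum>b\<in>Basis. (g v \<bullet> b) *\<^sub>R exp_ad (p v) b)"
    by (intro continuous_intros 1 g)
  moreover have "(\<Sum>b\<in>Basis. (g v \<bullet> b) *\<^sub>R exp_ad (p v) b) = exp_ad (p v) (g v)" for v
    by (subst (3) euclidean_representation[symmetric])
      (simp only: linear_sum[OF linear_exp_ad] linear_cmul[OF linear_exp_ad])
  ultimately show ?thesis by simp
qed

end

context simple_lie_algebra_rank_gt_1
begin

lemma theta: "linear \<theta>" "\<theta> (\<theta> X) = X" "\<theta> (br X Y) = br (\<theta> X) (\<theta> Y)" "X \<noteq> 0 \<Longrightarrow> - killing X (\<theta> X) > 0"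
  using cartan unfolding cartan_involution_def by auto

lemmas theta_simps = linear_add[OF theta(1)] linear_cmul[OF theta(1)] linear_diff[OF theta(1)]
  linear_0[OF theta(1)] linear_neg[OF theta(1)]

lemma killing_theta: "killing (\<theta> X) (\<theta> Y) = killing X Y"
proof -
  have l: "linear (\<lambda>z. br X (br Y (\<theta> z)))"
    using linear_compose[OF linear_compose[OF theta(1) br_lin2] br_lin2] by (simp add: o_def)
  have "br (\<theta> X) (br (\<theta> Y) z) = \<theta> (br X (br Y (\<theta> z)))" for z by (simp add: theta)
  then have "killing (\<theta> X) (\<theta> Y) = tr (\<lambda>z. \<theta> (br X (br Y (\<theta> z))))" by (simp add: killing_tr)
  also have "\<dots> = tr (\<lambda>z. br X (br Y (\<theta> (\<theta> z))))" by (rule tr_commute[OF theta(1) l])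
  finally show ?thesis by (simp add: theta killing_tr)
qed

text \<open>For this inner product the adjoint of \<open>br Z\<close> is
  \<open>- br (\<theta> Z)\<close>: elements of \<open>\<aa>\<close> act by symmetric operators,
  elements fixed by \<open>\<theta>\<close> by skew ones.\<close>

definition ip :: "'g \<Rightarrow> 'g \<Rightarrow> real" where
  "ip X Y = - killing X (\<theta> Y)"

sublocale ip: pos_def_form ip
proof
  show "bilinear ip"
    unfolding bilinear_def ip_def by (auto intro!: linearI simp: theta_simps killing_simps)
  show "ip x y = ip y x" for x y
    unfolding ip_def using killing_theta[of x "\<theta> y"] killing_sym[of y "\<theta> x"] by (simp add: theta)
  show "x \<noteq> 0 \<Longrightarrow> ip x x > 0" for x
    unfolding ip_def by (rule theta)
qed

lemma ip_adj: "ip (br Z X) Y = - ip X (br (\<theta> Z) Y)"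
  using killing_br[of X Z "\<theta> Y"] br_swap[of Z X]
  by (simp add: ip_def theta killing_simps)

lemma ad_eq_0_imp: "(\<And>Y. br X Y = 0) \<Longrightarrow> X = 0"
proof (rule ccontr)
  assume "\<And>Y. br X Y = 0" "X \<noteq> 0"
  then show False using theta(4)[of X] by (simp add: killing_def)
qed

text \<open>On inner derivations \<open>ktr\<close> represents the Killing form, which is
  nondegenerate because \<open>killing X (\<theta> X)\<close> is negative for nonzero
  \<open>X\<close>; an injective linear map is bounded below.\<close>

lemma ktr_ad_bound: obtains c where "c > 0" "\<And>X. c * norm X \<le> norm (ktr (br X))"
proof -
  have "X = 0" if "ktr (br X) = 0" for X
    using ktr_eq_0_imp_tr[OF that br_lin2, of "\<theta> X"] theta(4)[of X] by (auto simp: killing_tr)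
  then have "inj (\<lambda>X. ktr (br X))" using linear_ktr_ad linear_injective_0 by blast
  from linear_inj_bounded_below_pos[OF linear_ktr_ad this] that show thesis by blast
qed

text \<open>The difference \<open>A = T - T'\<close> satisfies the derivation rule up to an error \<open>\<eta>\<close> that is small
  relative to \<open>A\<close>, and \<open>killing (A X) Y = - tr (\<eta> X \<circ> ad Y)\<close>, since \<open>A\<close> is trace-orthogonal to the inner derivations.\<close>
lemma lie_auto_rigid:
  obtains e where "e > 0" "\<And>T T'. lie_auto T \<Longrightarrow> lie_auto T' \<Longrightarrow> ktr T = ktr T' \<Longrightarrow>
    (\<And>b. b \<in> Basis \<Longrightarrow> norm (T b - b) \<le> e) \<Longrightarrow> (\<And>b. b \<in> Basis \<Longrightarrow> norm (T' b - b) \<le> e) \<Longrightarrow> T = T'"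
proof -
  obtain c where c: "c > 0" "\<And>X. c * norm X \<le> norm (ktr (br X))" by (rule ktr_ad_bound) blast
  define d where "d = real DIM('g)"
  have d: "d > 0" by (simp add: d_def)
  \<comment> \<open>The value is chosen so that the final estimate of \<open>c * a\<close> closes
    with the factor 1/2.\<close>
  define e where "e = c / (4 * brK\<^sup>2 * d ^ 4)"
  have e: "e > 0" using c(1) brK(1) d by (simp add: e_def)
  have "T = T'" if T: "lie_auto T" and T': "lie_auto T'" and eq: "ktr T = ktr T'"
    and nT: "\<And>b. b \<in> Basis \<Longrightarrow> norm (T b - b) \<le> e" and nT': "\<And>b. b \<in> Basis \<Longrightarrow> norm (T' b - b) \<le> e" for T T'
  proof -
    have lT: "linear T" "linear T'" and hT: "\<And>X Y. T (br X Y) = br (T X) (T Y)" "\<And>X Y. T' (br X Y) = br (T' X) (T' Y)"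
      using T T' by (auto simp: lie_auto_def)
    define A where "A x = T x - T' x" for x
    have lA: "linear A" using linear_compose_sub[OF lT] by (simp add: A_def[abs_def])
    have kA: "ktr A = 0" using eq by (simp add: A_def[abs_def] ktr_diff)
    define a where "a = (\<Sum>b\<in>Basis. norm (A b))"
    have a0: "a \<ge> 0" by (simp add: a_def sum_nonneg)
    have nA: "norm (A x) \<le> a * norm x" for x unfolding a_def by (rule linear_norm_bound[OF lA])
    have near: "norm (U x - x) \<le> d * e * norm x" if "linear U" "\<And>b. b \<in> Basis \<Longrightarrow> norm (U b - b) \<le> e" for U and x :: 'g
    proof -
      have "norm (U x - x) \<le> (\<Sum>b\<in>Basis. norm (U b - b)) * norm x"
        using linear_norm_bound[OF linear_compose_sub[OF that(1) linear_id[unfolded id_def]]] by simp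
      also have "\<dots> \<le> (\<Sum>b\<in>(Basis::'g set). e) * norm x"
        by (intro mult_right_mono sum_mono that(2)) auto
      finally show ?thesis by (simp add: d_def)
    qed
    \<comment> \<open>\<open>A [X, Z]\<close> equals \<open>[A X, T Z] + [T' X, A Z]\<close>.
      Replacing \<open>T Z\<close> by \<open>Z\<close> and \<open>T' X\<close> by \<open>X\<close>
      leaves this remainder, small because both maps are near the identity.\<close>
    define \<eta> where "\<eta> X Z = br (A X) (T Z - Z) + br (T' X - X) (A Z)" for X Z
    have eta: "br (A X) Z = A (br X Z) - br X (A Z) - \<eta> X Z" for X Z
      by (simp add: A_def hT \<eta>_def br_simps)
    have n\<eta>: "norm (\<eta> X Z) \<le> 2 * brK * a * d * e * norm X * norm Z" for X Z
    proof -
      have "norm (br (A X) (T Z - Z)) \<le> brK * norm (A X) * norm (T Z - Z)" by (rule brK)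
      also have "\<dots> \<le> brK * (a * norm X) * (d * e * norm Z)"
        using brK(1) a0 by (intro mult_mono nA near[OF lT(1) nT] order_refl) auto
      finally have 1: "norm (br (A X) (T Z - Z)) \<le> brK * a * d * e * norm X * norm Z" by (simp add: mult_ac)
      have "norm (br (T' X - X) (A Z)) \<le> brK * norm (T' X - X) * norm (A Z)" by (rule brK)
      also have "\<dots> \<le> brK * (d * e * norm X) * (a * norm Z)"
        using brK(1) a0 d e by (intro mult_mono nA near[OF lT(2) nT'] order_refl) auto
      finally have "norm (br (T' X - X) (A Z)) \<le> brK * a * d * e * norm X * norm Z" by (simp add: mult_ac)
      with 1 show ?thesis unfolding \<eta>_def by (intro norm_triangle_le) simp
    qed
    have kill: "killing (A X) Y = - tr (\<lambda>z. \<eta> X (br Y z))" for X Y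
    proof -
      have lAY: "linear (\<lambda>z. A (br Y z))" using linear_compose[OF br_lin2 lA] by (simp add: o_def)
      have "tr (\<lambda>z. br X (A (br Y z))) = tr (\<lambda>z. A (br Y (br X z)))"
        by (rule tr_commute[OF br_lin2 lAY])
      moreover have "tr (\<lambda>z. A (br X (br Y z))) - tr (\<lambda>z. A (br Y (br X z))) = 0"
        using ktr_eq_0_imp_tr[OF kA lA, of "br X Y"] by (simp add: br_br linear_diff[OF lA] tr_diff)
      ultimately show ?thesis by (simp add: killing_tr eta tr_diff)
    qed
    have nk: "\<bar>killing (A X) Y\<bar> \<le> d * (2 * brK * a * d * e * norm X * (brK * norm Y))" for X Y
    proof -
      have "norm (\<eta> X (br Y z)) \<le> 2 * brK * a * d * e * norm X * (brK * norm Y) * norm z" for z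
      proof -
        have "norm (\<eta> X (br Y z)) \<le> 2 * brK * a * d * e * norm X * norm (br Y z)" by (rule n\<eta>)
        also have "\<dots> \<le> 2 * brK * a * d * e * norm X * (brK * norm Y * norm z)"
          using brK(1) a0 d e by (intro mult_left_mono brK(2)) simp
        finally show ?thesis by (simp add: mult_ac)
      qed
      from tr_bound[of "\<lambda>z. \<eta> X (br Y z)", OF this] show ?thesis unfolding kill d_def by simp
    qed
    have nAb: "c * norm (A b) \<le> 2 * brK\<^sup>2 * d ^ 3 * e * a" if b: "b \<in> Basis" for b
    proof -
      have "c * norm (A b) \<le> norm (ktr (br (A b)))" by (rule c)
      also have "\<dots> \<le> (\<Sum>b'\<in>Basis. \<bar>ktr (br (A b)) \<bullet> b'\<bar>)" by (rule norm_le_l1)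
      also have "\<dots> \<le> (\<Sum>b'\<in>(Basis::'g set). d * (2 * brK * a * d * e * brK))"
      proof (rule sum_mono)
        fix b' :: 'g assume b': "b' \<in> Basis"
        then show "\<bar>ktr (br (A b)) \<bullet> b'\<bar> \<le> d * (2 * brK * a * d * e * brK)"
          using nk[of b b'] b by (simp add: ktr_inner killing_tr)
      qed
      also have "\<dots> = 2 * brK\<^sup>2 * d ^ 3 * e * a" by (simp add: d_def power2_eq_square power3_eq_cube)
      finally show ?thesis .
    qed
    have "c * a = (\<Sum>b\<in>Basis. c * norm (A b))" by (simp add: a_def sum_distrib_left)
    also have "\<dots> \<le> (\<Sum>b\<in>(Basis::'g set). 2 * brK\<^sup>2 * d ^ 3 * e * a)" by (rule sum_mono[OF nAb])
    also have "\<dots> = 2 * brK\<^sup>2 * d ^ 4 * e * a" by (simp add: d_def power_def)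
    also have "\<dots> = c * a / 2" using d brK(1) by (simp add: e_def field_simps)
    finally have "a \<le> 0" using c(1) by simp
    with nA[of x for x] have "A x = 0" for x
      by (metis a0 antisym mult_zero_left norm_le_zero_iff)
    then show "T = T'" by (auto simp: A_def)
  qed
  with e that show thesis by blast
qed

text \<open>Both sides are automorphisms close to the identity, so by rigidity only their \<open>ktr\<close> must agree.
  That equation has a solution differentiable at 0 because \<open>f\<close> is differentiable at 0 with invertible derivative.\<close>
lemma exp_ad_local_factorization:
  fixes p1 p2 p3 p4 :: "'g \<Rightarrow> 'g"
  assumes lin: "linear p1" "linear p2" "linear p3" "linear p4"
    and sum: "\<And>v. p1 v + p2 v + p3 v + p4 v = v"
  obtains v where "(v has_vector_derivative W) (at 0)" "v 0 = 0"
    "\<forall>\<^sub>F t in at (0::real). exp_ad (t *\<^sub>R W) = exp_ad (p1 (v t)) \<circ> (exp_ad (p2 (v t)) \<circ> exp_ad (p3 (v t)) \<circ> exp_ad (p4 (v t)))"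
proof -
  obtain e where e: "e > 0" and rigid: "\<And>T T'. lie_auto T \<Longrightarrow> lie_auto T' \<Longrightarrow> ktr T = ktr T' \<Longrightarrow>
    (\<And>b. b \<in> Basis \<Longrightarrow> norm (T b - b) \<le> e) \<Longrightarrow> (\<And>b. b \<in> Basis \<Longrightarrow> norm (T' b - b) \<le> e) \<Longrightarrow> T = T'"
    using lie_auto_rigid by metis
  obtain c where c: "c > 0" "\<And>X. c * norm X \<le> norm (ktr (br X))" by (rule ktr_ad_bound) blast
  define F where "F v = exp_ad (p1 v) \<circ> (exp_ad (p2 v) \<circ> exp_ad (p3 v) \<circ> exp_ad (p4 v))" for v
  have auto: "lie_auto (F v)" for v unfolding F_def by (intro lie_auto_comp lie_auto_exp_ad)
  have p0: "p1 0 = 0" "p2 0 = 0" "p3 0 = 0" "p4 0 = 0" using lin by (simp_all add: linear_0)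
  have F0: "F 0 = id" by (simp add: F_def p0)
  have contF: "continuous_on UNIV (\<lambda>v. F v Y)" for Y
    unfolding F_def o_def by (intro continuous_exp_ad_app lin continuous_on_const)
  have derF: "((\<lambda>v. F v Y) has_derivative (\<lambda>h. br h Y)) (at 0)" for Y
  proof -
    have "((\<lambda>v. F v Y) has_derivative (\<lambda>h. br (p1 h) Y + (br (p2 h) Y + (br (p3 h) Y + (br (p4 h) Y + 0))))) (at 0)"
      using has_derivative_exp_ad_app[OF lin(1) has_derivative_exp_ad_app[OF lin(2) has_derivative_exp_ad_app[OF lin(3)
        has_derivative_exp_ad_app[OF lin(4) has_derivative_const[of Y]]]]]
      by (simp add: F_def o_def p0)
    moreover have "br (p1 h) Y + (br (p2 h) Y + (br (p3 h) Y + (br (p4 h) Y + 0))) = br h Y" for h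
    proof -
      have "br h Y = br (p1 h + p2 h + p3 h + p4 h) Y" by (simp only: sum)
      then show ?thesis by (simp only: br_simps add.assoc add_0_right)
    qed
    ultimately show ?thesis by simp
  qed
  define f where "f v = ktr (F v)" for v
  have ktr_deriv: "((\<lambda>v. ktr (G v)) has_derivative (\<lambda>h. ktr (G' h))) (at x)"
    if "\<And>Y. ((\<lambda>v. G v Y) has_derivative (\<lambda>h. G' h Y)) (at x)"
    for G G' :: "'z::real_normed_vector \<Rightarrow> 'g \<Rightarrow> 'g" and x
    unfolding ktr_def tr_def
    by (intro has_derivative_sum bounded_linear.has_derivative[OF bounded_linear_scaleR_left]
       bounded_linear.has_derivative[OF bounded_linear_inner_left] that)
  have derf: "(f has_derivative (\<lambda>h. ktr (br h))) (at 0)"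
    unfolding f_def by (rule ktr_deriv[OF derF])
  have contf: "continuous_on UNIV f"
    unfolding f_def ktr_def tr_def by (intro continuous_intros contF)
  obtain \<kappa>' where \<kappa>': "linear \<kappa>'" "(\<lambda>X. ktr (br X)) \<circ> \<kappa>' = id" "\<kappa>' \<circ> (\<lambda>X. ktr (br X)) = id"
  proof -
    have "inj (\<lambda>X. ktr (br X))"
    proof -
      have "X = 0" if "ktr (br X) = 0" for X
        using c(2)[of X] c(1) that by (simp add: mult_le_0_iff)
      then show ?thesis using linear_ktr_ad linear_injective_0 by blast
    qed
    from linear_injective_isomorphism[OF linear_ktr_ad this] that show thesis by (auto simp: fun_eq_iff)
  qed
  have b\<kappa>': "bounded_linear \<kappa>'" using \<kappa>' linear_conv_bounded_linear by blast
  obtain r where r: "r > 0" and rb: "\<And>v. norm v < r \<Longrightarrow> norm (f v - f 0 - ktr (br v)) \<le> c / 2 * norm v"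
    using derf[unfolded has_derivative_at_alt] c(1) half_gt_zero by (metis diff_zero)
  have vb: "norm v \<le> 2 / c * norm (f v - f 0)" if "norm v < r" for v
  proof -
    have "c * norm v \<le> norm (ktr (br v))" by (rule c)
    also have "\<dots> \<le> norm (f v - f 0) + norm (f v - f 0 - ktr (br v))"
      using norm_triangle_ineq4[of "f v - f 0" "f v - f 0 - ktr (br v)"] by simp
    also have "\<dots> \<le> norm (f v - f 0) + c / 2 * norm v" using rb[OF that] by simp
    finally show ?thesis using c(1) by (simp add: field_simps)
  qed
  define U where "U = interior (f ` ball 0 r)"
  \<comment> \<open>Continuity everywhere together with a right-invertible derivative at the single
    point 0 is enough for this open mapping theorem.\<close>
  have fU: "f 0 \<in> U"
    unfolding U_def
    by (rule sussmann_open_mapping[OF open_UNIV contf UNIV_I derf b\<kappa>' \<kappa>'(2)]) (use r in auto)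
  \<comment> \<open>An arbitrary choice of preimages. The bound \<open>gb\<close> makes it
    continuous at \<open>f 0\<close>, and a right inverse that is continuous there is differentiable
    there, with the inverse derivative.\<close>
  define g where "g y = (SOME v. norm v < r \<and> f v = y)" for y
  have g: "norm (g y) < r \<and> f (g y) = y" if "y \<in> U" for y
  proof -
    have "y \<in> f ` ball 0 r" using that interior_subset unfolding U_def by blast
    then have "\<exists>v. norm v < r \<and> f v = y" by auto
    then show ?thesis unfolding g_def by (rule someI_ex)
  qed
  have gb: "norm (g y) \<le> 2 / c * norm (y - f 0)" if "y \<in> U" for y
    using vb[of "g y"] g[OF that] by simp
  have g0: "g (f 0) = 0" using gb[OF fU] by simp
  have oU: "open U" by (simp add: U_def)
  have "(g \<longlongrightarrow> 0) (at (f 0))"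
  proof (rule Lim_null_comparison)
    show "\<forall>\<^sub>F y in at (f 0). norm (g y) \<le> 2 / c * norm (y - f 0)"
      using eventually_at_in_open'[OF oU fU] by eventually_elim (rule gb)
    have "((\<lambda>y. 2 / c * norm (y - f 0)) \<longlongrightarrow> 2 / c * norm (f 0 - f 0)) (at (f 0))"
      by (intro tendsto_intros)
    then show "((\<lambda>y. 2 / c * norm (y - f 0)) \<longlongrightarrow> 0) (at (f 0))" by simp
  qed
  then have cg: "continuous (at (f 0)) g" by (simp add: continuous_at g0)
  have dg: "(g has_derivative \<kappa>') (at (f 0))"
    by (rule has_derivative_inverse_basic[of f "\<lambda>h. ktr (br h)" g "f 0" \<kappa>' U])
      (use derf g0 b\<kappa>' \<kappa>' cg oU fU g in auto)
  define h where "h t = ktr (exp_ad (t *\<^sub>R W))" for t :: real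
  have h0: "h 0 = f 0" by (simp add: h_def f_def F0)
  have de: "((\<lambda>t. exp_ad (t *\<^sub>R W) Y) has_derivative (\<lambda>t. br (t *\<^sub>R W) Y)) (at 0)" for Y
  proof -
    have "((\<lambda>t::real. t *\<^sub>R W) has_derivative (\<lambda>t. t *\<^sub>R W)) (at 0)" by (auto intro!: derivative_eq_intros)
    from has_derivative_compose[OF this, of "\<lambda>X. exp_ad X Y" "\<lambda>X. br X Y"] exp_ad_has_derivative_0[of Y]
    show ?thesis by simp
  qed
  have dh: "(h has_derivative (\<lambda>t. ktr (br (t *\<^sub>R W)))) (at 0)"
    unfolding h_def by (rule ktr_deriv[OF de])
  have "((\<lambda>t. g (h t)) has_derivative (\<lambda>t. \<kappa>' (ktr (br (t *\<^sub>R W))))) (at 0)"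
    using has_derivative_compose[OF dh, of g \<kappa>'] dg h0 by simp
  then have dv: "((\<lambda>t. g (h t)) has_vector_derivative W) (at 0)"
    using \<kappa>'(3) by (simp add: has_vector_derivative_def fun_eq_iff)
  have v0: "g (h 0) = 0" by (simp add: h0 g0)
  have tv: "((\<lambda>t. g (h t)) \<longlongrightarrow> 0) (at 0)"
    using has_vector_derivative_continuous[OF dv] v0 by (simp add: continuous_at)
  have near: "\<forall>\<^sub>F t in at (0::real). \<forall>b\<in>Basis. norm (G t b - b) \<le> e"
    if "\<And>b. ((\<lambda>t. G t b) \<longlongrightarrow> b) (at 0)" for G :: "real \<Rightarrow> 'g \<Rightarrow> 'g"
  proof (rule eventually_ball_finite)
    show "\<forall>b\<in>Basis. \<forall>\<^sub>F t in at (0::real). norm (G t b - b) \<le> e"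
    proof
      fix b :: 'g
      have "\<forall>\<^sub>F t in at (0::real). dist (G t b) b < e" using tendstoD[OF that e] .
      then show "\<forall>\<^sub>F t in at (0::real). norm (G t b - b) \<le> e" by eventually_elim (simp add: dist_norm)
    qed
  qed simp
  have n1: "\<forall>\<^sub>F t in at (0::real). \<forall>b\<in>Basis. norm (exp_ad (t *\<^sub>R W) b - b) \<le> e"
  proof (rule near)
    show "((\<lambda>t. exp_ad (t *\<^sub>R W) b) \<longlongrightarrow> b) (at 0)" for b
      using has_derivative_continuous[OF de[of b]] by (simp add: continuous_at)
  qed
  have n2: "\<forall>\<^sub>F t in at (0::real). \<forall>b\<in>Basis. norm (F (g (h t)) b - b) \<le> e"
  proof (rule near)
    fix b
    have "isCont (\<lambda>v. F v b) 0" using contF continuous_on_eq_continuous_at by blast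
    then have "((\<lambda>v. F v b) \<longlongrightarrow> F 0 b) (nhds 0)" using tendsto_at_iff_tendsto_nhds[of "\<lambda>v. F v b" 0] by (simp add: continuous_at)
    then have "((\<lambda>v. F v b) \<longlongrightarrow> b) (nhds 0)" by (simp add: F0)
    from filterlim_compose[OF this tv]
    show "((\<lambda>t. F (g (h t)) b) \<longlongrightarrow> b) (at 0)" .
  qed
  have hU: "\<forall>\<^sub>F t in at (0::real). h t \<in> U"
    using has_derivative_continuous[OF dh] oU fU h0 by (simp add: continuous_at topological_tendstoD)
  have "\<forall>\<^sub>F t in at (0::real). exp_ad (t *\<^sub>R W) = F (g (h t))"
    using n1 n2 hU
  proof eventually_elim
    case (elim t)
    show ?case
      by (rule rigid[OF lie_auto_exp_ad auto]) (use elim g[OF elim(3)] in \<open>auto simp: f_def h_def\<close>)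
  qed
  with dv v0 that[of "\<lambda>t. g (h t)"] show thesis unfolding F_def by blast
qed

end

section \<open>Restricted root spaces\<close>

context pos_def_form
begin

text \<open>In a linear relation the part \<open>s\<close> carried by one \<open>B i\<close> is
  minus the rest, to which it is orthogonal; so it is orthogonal to itself.\<close>

lemma independent_orthogonal_Union:
  assumes ind: "\<And>i. i \<in> I \<Longrightarrow> independent (B i)"
    and orth: "\<And>i j x y. i \<in> I \<Longrightarrow> j \<in> I \<Longrightarrow> i \<noteq> j \<Longrightarrow> x \<in> B i \<Longrightarrow> y \<in> B j \<Longrightarrow> ip x y = 0"
  shows "independent (\<Union>i\<in>I. B i)"
proof
  assume "dependent (\<Union>i\<in>I. B i)"
  then obtain T u v where T: "finite T" "T \<subseteq> (\<Union>i\<in>I. B i)" "v \<in> T" "u v \<noteq> 0" "(\<Sum>b\<in>T. u b *\<^sub>R b) = 0"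
    unfolding dependent_explicit by blast
  then obtain i where i: "i \<in> I" "v \<in> B i" by blast
  define s where "s = (\<Sum>b\<in>T \<inter> B i. u b *\<^sub>R b)"
  have "s + (\<Sum>b\<in>T - B i. u b *\<^sub>R b) = 0"
    unfolding s_def sum.Int_Diff[OF T(1), of "\<lambda>b. u b *\<^sub>R b" "B i", symmetric] by (rule T(5))
  from arg_cong[OF this, of "ip s"] have "ip s s = - ip s (\<Sum>b\<in>T - B i. u b *\<^sub>R b)"
    by (simp only: linear_add[OF lin2] linear_0[OF lin2] eq_neg_iff_add_eq_0)
  also have "ip s (\<Sum>b\<in>T - B i. u b *\<^sub>R b) = 0"
  proof -
    have "ip s b = 0" if bT: "b \<in> T - B i" for b
    proof -
      obtain j where j: "j \<in> I" "b \<in> B j" "j \<noteq> i" using bT T(2) by blast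
      show ?thesis unfolding s_def
        using orth[OF i(1) j(1) j(3)[symmetric] _ j(2)] by (auto simp: ip_simps intro!: sum.neutral)
    qed
    then show ?thesis by (simp add: ip_simps)
  qed
  finally have "s = 0" by simp
  then have "\<forall>b\<in>T \<inter> B i. u b = 0"
    using ind[OF i(1)] T(1) unfolding s_def dependent_explicit by blast
  then show False using T(3,4) i(2) by blast
qed

lemma finite_orthogonal_family:
  assumes nz: "\<And>i. i \<in> I \<Longrightarrow> \<exists>x\<in>V i. x \<noteq> 0"
    and orth: "\<And>i j x y. i \<in> I \<Longrightarrow> j \<in> I \<Longrightarrow> i \<noteq> j \<Longrightarrow> x \<in> V i \<Longrightarrow> y \<in> V j \<Longrightarrow> ip x y = 0"
  shows "finite I"
proof -
  obtain e where e: "\<And>i. i \<in> I \<Longrightarrow> e i \<in> V i \<and> e i \<noteq> 0" using nz by metis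
  have "independent (\<Union>i\<in>I. {e i})"
    by (rule independent_orthogonal_Union) (use e orth in auto)
  then have "finite (e ` I)"
    using independent_bound_general by (metis UNION_singleton_eq_range)
  moreover have "inj_on e I"
    by (rule inj_onI) (metis e orth ip_eq_0_iff)
  ultimately show ?thesis by (simp add: finite_image_iff)
qed

end

context simple_lie_algebra_rank_gt_1
begin

lemma \<aa>_props: "subspace \<aa>" "H \<in> \<aa> \<Longrightarrow> H' \<in> \<aa> \<Longrightarrow> br H H' = 0" "H \<in> \<aa> \<Longrightarrow> \<theta> H = - H"
  using maximal_abelian unfolding maximal_abelian_in_def abelian_subspace_def by auto

lemma ad_\<aa>_sym: "H \<in> \<aa> \<Longrightarrow> ip (br H X) Y = ip X (br H Y)"
  using ip_adj[of H X Y] \<aa>_props(3)[of H] by (simp add: br_simps ip.ip_simps)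

lemma subspace_root_space: "subspace (root_space \<alpha>)"
  by (auto simp: subspace_def root_space_def br_simps scaleR_add_right)

lemma br_root_space:
  assumes "X \<in> root_space \<alpha>" "Y \<in> root_space \<beta>"
  shows "br X Y \<in> root_space (\<alpha> + \<beta>)"
  unfolding root_space_def
proof (intro CollectI ballI)
  fix H assume "H \<in> \<aa>"
  then have "br H X = \<alpha> H *\<^sub>R X" "br H Y = \<beta> H *\<^sub>R Y" using assms by (auto simp: root_space_def)
  then show "br H (br X Y) = (\<alpha> + \<beta>) H *\<^sub>R br X Y"
    by (subst br_deriv) (simp add: br_simps scaleR_add_left)
qed

lemma theta_root_space:
  assumes "X \<in> root_space \<alpha>"
  shows "\<theta> X \<in> root_space (- \<alpha>)"
  unfolding root_space_def
proof (intro CollectI ballI)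
  fix H assume H: "H \<in> \<aa>"
  have "br H (\<theta> X) = \<theta> (br (\<theta> H) X)" by (simp add: theta)
  also have "\<dots> = \<theta> (- (\<alpha> H *\<^sub>R X))" using H assms by (simp add: \<aa>_props(3) br_simps root_space_def)
  finally show "br H (\<theta> X) = (- \<alpha>) H *\<^sub>R \<theta> X" by (simp add: theta_simps)
qed

abbreviation rsum where "rsum \<equiv> sum_root_spaces"

text \<open>The weights of \<open>\<aa>\<close> on g. With 0 included they index the full root space
  decomposition.\<close>

definition W :: "('g \<Rightarrow> real) set" where "W = insert 0 roots"

lemma W_dual: "\<alpha> \<in> W \<Longrightarrow> \<alpha> \<in> \<aa>_dual"
  by (auto simp: W_def roots_def \<aa>_dual_def)

lemma dual_add: "\<alpha> \<in> \<aa>_dual \<Longrightarrow> \<beta> \<in> \<aa>_dual \<Longrightarrow> \<alpha> + \<beta> \<in> \<aa>_dual"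
  by (auto simp: \<aa>_dual_def algebra_simps)

lemma dual_minus: "\<alpha> \<in> \<aa>_dual \<Longrightarrow> - \<alpha> \<in> \<aa>_dual"
  by (auto simp: \<aa>_dual_def)

lemma W_iff: "\<alpha> \<in> \<aa>_dual \<Longrightarrow> root_space \<alpha> \<noteq> {0} \<Longrightarrow> \<alpha> \<in> W"
  by (auto simp: W_def roots_def)

lemma W_minus: "\<alpha> \<in> W \<Longrightarrow> - \<alpha> \<in> W"
proof -
  assume a: "\<alpha> \<in> W"
  show ?thesis
  proof (cases "\<alpha> = 0")
    case False
    then have "root_space \<alpha> \<noteq> {0}" "\<alpha> \<in> \<aa>_dual" using a by (auto simp: W_def roots_def)
    then obtain X where X: "X \<in> root_space \<alpha>" "X \<noteq> 0"
      using subspace_0[OF subspace_root_space] by blast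
    then have "\<theta> X \<noteq> 0" by (metis theta(2) theta_simps(4))
    then have "root_space (- \<alpha>) \<noteq> {0}" using theta_root_space[OF X(1)] by blast
    then show ?thesis using \<open>\<alpha> \<in> \<aa>_dual\<close> by (intro W_iff dual_minus)
  qed (use a in simp)
qed

lemma root_space_orthogonal:
  assumes "\<alpha> \<in> \<aa>_dual" "\<beta> \<in> \<aa>_dual" "\<alpha> \<noteq> \<beta>" "X \<in> root_space \<alpha>" "Y \<in> root_space \<beta>"
  shows "ip X Y = 0"
proof -
  obtain H where "\<alpha> H \<noteq> \<beta> H" using assms(3) by blast
  then have H: "H \<in> \<aa>" "\<alpha> H \<noteq> \<beta> H"
    using assms(1,2) unfolding \<aa>_dual_def by force+
  have "\<alpha> H * ip X Y = \<beta> H * ip X Y"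
    using ad_\<aa>_sym[OF H(1), of X Y] assms(4,5) H(1) by (simp add: root_space_def ip.ip_simps)
  then show ?thesis using H(2) by simp
qed

lemma finite_W: "finite W"
proof -
  have "finite roots"
  proof (rule ip.finite_orthogonal_family[where V=root_space])
    show "\<exists>x\<in>root_space \<alpha>. x \<noteq> 0" if "\<alpha> \<in> roots" for \<alpha>
      using that subspace_0[OF subspace_root_space] by (auto simp: roots_def)
    show "ip x y = 0" if "\<alpha> \<in> roots" "\<beta> \<in> roots" "\<alpha> \<noteq> \<beta>" "x \<in> root_space \<alpha>" "y \<in> root_space \<beta>" for \<alpha> \<beta> x y
      using root_space_orthogonal[OF _ _ that(3-5)] that(1,2) by (simp add: roots_def)
  qed
  then show ?thesis by (simp add: W_def)
qed

text \<open>The operators \<open>ad H\<close> are symmetric and commute, so they are jointly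
  diagonalizable. A nonzero joint eigenvector determines its eigenvalues, which depend linearly on
  \<open>H\<close> because \<open>ad\<close> does.\<close>

lemma span_root_spaces: "rsum W = UNIV"
proof -
  have "UNIV \<subseteq> span {v \<in> UNIV. \<forall>H\<in>\<aa>. \<exists>c. br H v = c *\<^sub>R v}"
  proof (rule ip.joint_eigenvectors_span)
    show "br H (br H' x) = br H' (br H x)" if "H \<in> \<aa>" "H' \<in> \<aa>" for H H' x
      using br_br[of H H' x] \<aa>_props(2)[OF that] by (simp add: br_simps)
  qed (auto simp: ad_\<aa>_sym br_lin2)
  moreover have "{v \<in> UNIV. \<forall>H\<in>\<aa>. \<exists>c. br H v = c *\<^sub>R v} \<subseteq> (\<Union>\<alpha>\<in>W. root_space \<alpha>)"
  proof
    fix v assume "v \<in> {v \<in> UNIV. \<forall>H\<in>\<aa>. \<exists>c. br H v = c *\<^sub>R v}"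
    then obtain c where c: "\<And>H. H \<in> \<aa> \<Longrightarrow> br H v = c H *\<^sub>R v" by simp metis
    show "v \<in> (\<Union>\<alpha>\<in>W. root_space \<alpha>)"
    proof (cases "v = 0")
      case True
      have "0 \<in> root_space 0" "0 \<in> W" by (auto simp: W_def subspace_0[OF subspace_root_space])
      then show ?thesis using True by blast
    next
      case False
      \<comment> \<open>The functional is set to 0 off \<open>\<aa>\<close>, as membership in
        \<open>\<aa>_dual\<close> requires.\<close>
      define \<alpha> where "\<alpha> H = (if H \<in> \<aa> then c H else 0)" for H
      have v: "v \<in> root_space \<alpha>" using c by (simp add: root_space_def \<alpha>_def)
      have "\<alpha> (H + H') = \<alpha> H + \<alpha> H'" if "H \<in> \<aa>" "H' \<in> \<aa>" for H H'
      proof -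
        have "c (H + H') *\<^sub>R v = (c H + c H') *\<^sub>R v"
          using c[of "H + H'"] c[OF that(1)] c[OF that(2)] subspace_add[OF \<aa>_props(1) that]
          by (simp add: br_simps scaleR_add_left)
        then show ?thesis using False that subspace_add[OF \<aa>_props(1) that] by (simp add: \<alpha>_def)
      qed
      moreover have "\<alpha> (r *\<^sub>R H) = r * \<alpha> H" if "H \<in> \<aa>" for H r
      proof -
        have "c (r *\<^sub>R H) *\<^sub>R v = (r * c H) *\<^sub>R v"
          using c[of "r *\<^sub>R H"] c[OF that] subspace_scale[OF \<aa>_props(1) that]
          by (metis br_simps(3) scaleR_scaleR)
        then show ?thesis using False that subspace_scale[OF \<aa>_props(1) that] by (simp add: \<alpha>_def)
      qed
      ultimately have "\<alpha> \<in> \<aa>_dual" by (auto simp: \<aa>_dual_def \<alpha>_def)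
      then have "\<alpha> \<in> W" using v False by (intro W_iff) auto
      then show ?thesis using v by blast
    qed
  qed
  ultimately show ?thesis unfolding sum_root_spaces_def
    using span_mono by blast
qed

lemma subspace_sp: "subspace (rsum A)"
  by (simp add: sum_root_spaces_def)

lemma subspace_preimage: "linear f \<Longrightarrow> subspace V \<Longrightarrow> subspace {x. f x \<in> V}"
  by (auto simp: subspace_def linear_0 linear_add linear_cmul)

lemma sp_base: "\<alpha> \<in> A \<Longrightarrow> X \<in> root_space \<alpha> \<Longrightarrow> X \<in> rsum A"
  unfolding sum_root_spaces_def by (rule span_base) blast

lemma sp_induct:
  assumes "x \<in> rsum A" "subspace {x. P x}"
    "\<And>\<alpha> X. \<alpha> \<in> A \<Longrightarrow> X \<in> root_space \<alpha> \<Longrightarrow> P X"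
  shows "P x"
proof -
  have "rsum A \<subseteq> {x. P x}"
    unfolding sum_root_spaces_def by (rule span_minimal) (use assms in auto)
  then show ?thesis using assms(1) by blast
qed

lemma sp_mono: "A \<subseteq> B \<Longrightarrow> rsum A \<subseteq> rsum B"
  unfolding sum_root_spaces_def by (rule span_mono) blast

text \<open>The condition on \<open>D\<close> concerns only sums that are weights: for the others
  the root space is zero and the bracket vanishes. Inclusions between subalgebras and ideals built
  from root spaces thus become statements about weights.\<close>

lemma br_sp:
  assumes "\<And>\<alpha> \<beta>. \<alpha> \<in> A \<Longrightarrow> \<beta> \<in> B \<Longrightarrow> \<alpha> + \<beta> \<in> W \<Longrightarrow> \<alpha> + \<beta> \<in> D" and A: "A \<subseteq> W" "B \<subseteq> W"
    and X: "X \<in> rsum A" and Y: "Y \<in> rsum B"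
  shows "br X Y \<in> rsum D"
proof -
  have 1: "br X Y \<in> rsum D" if "\<alpha> \<in> A" "X \<in> root_space \<alpha>" "\<beta> \<in> B" "Y \<in> root_space \<beta>" for X Y \<alpha> \<beta>
  proof (cases "\<alpha> + \<beta> \<in> W")
    case True
    then show ?thesis using assms(1)[OF that(1,3)] br_root_space[OF that(2,4)] sp_base by blast
  next
    case False
    then have "root_space (\<alpha> + \<beta>) = {0}"
      using W_iff[OF dual_add[of \<alpha> \<beta>]] W_dual that A by blast
    then show ?thesis using br_root_space[OF that(2,4)] subspace_0[OF subspace_sp] by simp
  qed
  have 2: "br X Y \<in> rsum D" if "\<alpha> \<in> A" "X \<in> root_space \<alpha>" for X \<alpha>
    using Y
    by (rule sp_induct)
      (use 1[OF that] subspace_sp[of D] in \<open>auto simp: subspace_def br_simps\<close>)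
  show ?thesis
    using X
    by (rule sp_induct)
      (use 2 subspace_sp[of D] in \<open>auto simp: subspace_def br_simps\<close>)
qed

definition \<mm> :: "'g set" where "\<mm> = {Y. \<theta> Y = Y \<and> (\<forall>H\<in>\<aa>. br H Y = 0)}"

lemma root_space_0_iff: "X \<in> root_space 0 \<longleftrightarrow> (\<forall>H\<in>\<aa>. br H X = 0)"
  by (simp add: root_space_def)

lemma \<aa>_root_space_0: "\<aa> \<subseteq> root_space 0"
  using \<aa>_props(2) by (auto simp: root_space_0_iff)

text \<open>Adjoining \<open>X\<close> to \<open>\<aa>\<close> gives an abelian subspace of the -1
  eigenspace of \<open>\<theta>\<close>, so maximality puts \<open>X\<close> into
  \<open>\<aa>\<close>.\<close>

lemma \<aa>_maximal:
  assumes "\<theta> X = - X" "X \<in> root_space 0"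
  shows "X \<in> \<aa>"
proof -
  let ?V = "span (insert X \<aa>)"
  have b: "br H X = 0" if "H \<in> \<aa>" for H using assms(2) that by (simp add: root_space_0_iff)
  have mem: "\<exists>k H. H \<in> \<aa> \<and> Y = k *\<^sub>R X + H" if Y: "Y \<in> ?V" for Y
  proof -
    obtain k where "Y - k *\<^sub>R X \<in> span \<aa>" using Y span_breakdown_eq by metis
    then have "Y - k *\<^sub>R X \<in> \<aa>" using \<aa>_props(1) by (simp add: span_eq_iff[THEN iffD2])
    then show ?thesis by (metis add.commute diff_add_cancel)
  qed
  have "abelian_subspace ?V"
    unfolding abelian_subspace_def
  proof (intro conjI ballI subspace_span)
    fix Y Z assume "Y \<in> ?V" "Z \<in> ?V"
    then obtain k l H H' where "H \<in> \<aa>" "H' \<in> \<aa>" "Y = k *\<^sub>R X + H" "Z = l *\<^sub>R X + H'" using mem by metis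
    then show "br Y Z = 0"
      using b[of H] b[of H'] br_swap[of X H'] \<aa>_props(2)[of H H'] by (simp add: br_simps br_self)
  qed
  moreover have "\<aa> \<subseteq> ?V" by (meson order_trans span_superset subset_insertI)
  moreover have "?V \<subseteq> {X. \<theta> X = - X}"
  proof
    fix Y assume "Y \<in> ?V"
    then obtain k H where "H \<in> \<aa>" "Y = k *\<^sub>R X + H" using mem by metis
    then show "Y \<in> {X. \<theta> X = - X}" using assms(1) \<aa>_props(3) by (simp add: theta_simps)
  qed
  ultimately have "?V = \<aa>" using maximal_abelian unfolding maximal_abelian_in_def by blast
  then show ?thesis by (metis insertI1 span_base)
qed

lemma root_space_0_decomp:
  assumes "X \<in> root_space 0"
  shows "(1/2) *\<^sub>R (X + \<theta> X) \<in> \<mm>" "(1/2) *\<^sub>R (X - \<theta> X) \<in> \<aa>"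
proof -
  have t: "\<theta> X \<in> root_space 0" using theta_root_space[OF assms] by simp
  show "(1/2) *\<^sub>R (X + \<theta> X) \<in> \<mm>"
    using assms t by (auto simp: \<mm>_def theta theta_simps root_space_0_iff br_simps add.commute)
  show "(1/2) *\<^sub>R (X - \<theta> X) \<in> \<aa>"
    by (rule \<aa>_maximal) (use assms t in \<open>auto simp: theta theta_simps root_space_0_iff br_simps algebra_simps\<close>)
qed

end

section \<open>Adapted bases, projections, the slice and the normalizer\<close>

context hessenberg_setting
begin

definition H0 :: 'g where
  "H0 = (SOME H. H \<in> \<aa> \<and> (\<forall>\<alpha>\<in>roots. \<alpha> H \<noteq> 0) \<and> pos = {\<alpha>\<in>roots. \<alpha> H > 0})"

lemma H0: "H0 \<in> \<aa>" "\<alpha> \<in> roots \<Longrightarrow> \<alpha> H0 \<noteq> 0" "pos = {\<alpha>\<in>roots. \<alpha> H0 > 0}"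
proof -
  have "\<exists>H. H \<in> \<aa> \<and> (\<forall>\<alpha>\<in>roots. \<alpha> H \<noteq> 0) \<and> pos = {\<alpha>\<in>roots. \<alpha> H > 0}"
    using pos unfolding positive_system_def by blast
  from someI_ex[OF this] have H: "H0 \<in> \<aa> \<and> (\<forall>\<alpha>\<in>roots. \<alpha> H0 \<noteq> 0) \<and> pos = {\<alpha>\<in>roots. \<alpha> H0 > 0}"
    unfolding H0_def .
  show "H0 \<in> \<aa>" using H by (rule conjunct1)
  show "pos = {\<alpha>\<in>roots. \<alpha> H0 > 0}" using H by (elim conjE)
  show "\<alpha> \<in> roots \<Longrightarrow> \<alpha> H0 \<noteq> 0" using H by metis
qed

lemma pos_iff: "\<alpha> \<in> pos \<longleftrightarrow> \<alpha> \<in> W \<and> \<alpha> H0 > 0"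
  using eqset_imp_iff[OF H0(3), of \<alpha>] by (auto simp: W_def)

lemma W_H0: "\<alpha> \<in> W \<Longrightarrow> \<alpha> H0 = 0 \<Longrightarrow> \<alpha> = 0"
  using H0(2) by (auto simp: W_def)

lemma pos_W: "pos \<subseteq> W" and R_pos: "R \<subseteq> pos"
  using pos_iff R_proper by auto

lemma R_W: "R \<subseteq> W" and C_W: "C \<subseteq> W"
  using pos_W R_pos by auto

lemma finite_pos: "finite pos"
  using pos_W finite_W by (rule finite_subset)

definition neg :: "('g \<Rightarrow> real) set" where "neg = {\<alpha> \<in> W. \<alpha> H0 < 0}"

lemma neg_W: "neg \<subseteq> W" by (auto simp: neg_def)

lemma W_cases: "W = pos \<union> {0} \<union> neg"
proof -
  have "0 \<in> W" by (simp add: W_def)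
  then show ?thesis using W_H0 by (auto simp: neg_def pos_iff) (meson linorder_neqE_linordered_idom)
qed

text \<open>On positive roots the prescribed basis is kept, so that coordinates with respect to
  \<open>Bs\<close> agree with \<open>coord\<close> on \<open>\<nn>\<close>; elsewhere any basis of
  the root space serves.\<close>

definition bas :: "('g \<Rightarrow> real) \<Rightarrow> 'g set" where
  "bas \<alpha> = (if \<alpha> \<in> pos then E \<alpha> ` {1..m \<alpha>}
     else (SOME B. B \<subseteq> root_space \<alpha> \<and> independent B \<and> span B = root_space \<alpha>))"

lemma bas: "bas \<alpha> \<subseteq> root_space \<alpha>" "independent (bas \<alpha>)" "span (bas \<alpha>) = root_space \<alpha>"
proof -
  have "bas \<alpha> \<subseteq> root_space \<alpha> \<and> independent (bas \<alpha>) \<and> span (bas \<alpha>) = root_space \<alpha>"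
  proof (cases "\<alpha> \<in> pos")
    case True
    then show ?thesis using E_independent[OF True] E_span[OF True] span_superset[of "E \<alpha> ` {1..m \<alpha>}"] by (auto simp: bas_def)
  next
    case False
    have "\<exists>B. B \<subseteq> root_space \<alpha> \<and> independent B \<and> span B = root_space \<alpha>"
      using basis_exists[of "root_space \<alpha>"] span_minimal[OF _ subspace_root_space] by (metis subset_antisym)
    from someI_ex[OF this] show ?thesis using False by (simp add: bas_def)
  qed
  then show "bas \<alpha> \<subseteq> root_space \<alpha>" "independent (bas \<alpha>)" "span (bas \<alpha>) = root_space \<alpha>" by auto
qed

definition Bs :: "'g set" where "Bs = (\<Union>\<alpha>\<in>W. bas \<alpha>)"

lemma independent_Bs: "independent Bs"
  unfolding Bs_def
proof (rule ip.independent_orthogonal_Union)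
  show "ip x y = 0" if "\<alpha> \<in> W" "\<beta> \<in> W" "\<alpha> \<noteq> \<beta>" "x \<in> bas \<alpha>" "y \<in> bas \<beta>" for \<alpha> \<beta> x y
    using root_space_orthogonal[OF W_dual[OF that(1)] W_dual[OF that(2)] that(3)] that(4,5) bas(1) by blast
qed (rule bas)

lemma finite_Bs: "finite Bs"
  using independent_Bs by (rule independent_imp_finite)

lemma sp_eq: "rsum A = span (\<Union>\<alpha>\<in>A. bas \<alpha>)"
proof (rule subset_antisym)
  show "rsum A \<subseteq> span (\<Union>\<alpha>\<in>A. bas \<alpha>)"
    unfolding sum_root_spaces_def
  proof (rule span_minimal[OF UN_least subspace_span])
    fix \<alpha> assume "\<alpha> \<in> A"
    then show "root_space \<alpha> \<subseteq> span (\<Union>\<alpha>\<in>A. bas \<alpha>)"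
      unfolding bas(3)[of \<alpha>, symmetric] by (intro span_mono) blast
  qed
  show "span (\<Union>\<alpha>\<in>A. bas \<alpha>) \<subseteq> rsum A"
    unfolding sum_root_spaces_def using bas(1) by (intro span_mono) blast
qed

lemma span_Bs: "span Bs = UNIV"
  using sp_eq[of W] span_root_spaces by (simp add: Bs_def)

lemma bas_disjoint:
  assumes "\<alpha> \<in> W" "\<beta> \<in> W" "b \<in> bas \<alpha>" "b \<in> bas \<beta>"
  shows "\<alpha> = \<beta>"
proof (rule ccontr)
  assume "\<alpha> \<noteq> \<beta>"
  then have "ip b b = 0"
    using root_space_orthogonal[OF W_dual[OF assms(1)] W_dual[OF assms(2)], of b b] assms bas(1) by blast
  then have "0 \<in> bas \<alpha>" using assms by simp
  then show False using bas(2) dependent_zero by blast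
qed

definition rt :: "'g \<Rightarrow> ('g \<Rightarrow> real)" where "rt b = (SOME \<alpha>. \<alpha> \<in> W \<and> b \<in> bas \<alpha>)"

lemma rt: "\<alpha> \<in> W \<Longrightarrow> b \<in> bas \<alpha> \<Longrightarrow> rt b = \<alpha>"
  unfolding rt_def by (rule some_equality) (auto dest: bas_disjoint)

abbreviation rep where "rep \<equiv> representation Bs"

lemma linear_rep: "linear (\<lambda>x. rep x b)"
  by (rule linearI) (simp_all add: representation_add representation_scale independent_Bs span_Bs)

text \<open>The operator acting on each root space \<open>g\<^bsub>\<alpha>\<^esub>\<close> as the scalar \<open>d \<alpha>\<close>.\<close>
definition diag :: "(('g \<Rightarrow> real) \<Rightarrow> real) \<Rightarrow> 'g \<Rightarrow> 'g" where
  "diag d x = (\<Sum>b\<in>Bs. (d (rt b) * rep x b) *\<^sub>R b)"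

lemma linear_diag: "linear (diag d)"
  by (rule linearI)
    (simp_all add: diag_def linear_add[OF linear_rep] linear_cmul[OF linear_rep]
      algebra_simps sum.distrib scaleR_sum_right)

lemma diag_root:
  assumes a: "\<alpha> \<in> W" and X: "X \<in> root_space \<alpha>"
  shows "diag d X = d \<alpha> *\<^sub>R X"
proof -
  have "X \<in> span (bas \<alpha>)" using X bas(3) by simp
  then show ?thesis
  proof (rule linear_eq_on[OF linear_diag linear_scaleR])
    fix b assume b: "b \<in> bas \<alpha>"
    then have bB: "b \<in> Bs" using a by (auto simp: Bs_def)
    have "diag d b = (\<Sum>b'\<in>Bs. if b' = b then d \<alpha> *\<^sub>R b else 0)"
      unfolding diag_def
      by (rule sum.cong) (auto simp: representation_basis[OF independent_Bs bB] rt[OF a b])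
    also have "\<dots> = d \<alpha> *\<^sub>R b" using bB finite_Bs by simp
    finally show "diag d b = d \<alpha> *\<^sub>R b" .
  qed
qed

lemma diag_sp:
  assumes "x \<in> rsum A" "A \<subseteq> W"
  shows "diag d x \<in> rsum A"
  using assms(1)
proof (rule sp_induct)
  show "subspace {x. diag d x \<in> rsum A}"
    using subspace_preimage[OF linear_diag subspace_sp] .
  show "diag d X \<in> rsum A" if "\<alpha> \<in> A" "X \<in> root_space \<alpha>" for \<alpha> X
    using that assms(2) diag_root[of \<alpha> X d] sp_base[OF that] subspace_scale[OF subspace_sp] by auto
qed

lemma linear_eq_root_spaces:
  assumes "linear f" "linear g" "\<And>\<alpha> X. \<alpha> \<in> A \<Longrightarrow> X \<in> root_space \<alpha> \<Longrightarrow> f X = g X" "x \<in> rsum A"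
  shows "f x = g x"
  using assms(4)
proof (rule sp_induct)
  show "subspace {x. f x = g x}"
    using assms(1,2) by (auto simp: subspace_def linear_0 linear_add linear_cmul)
qed (rule assms(3))

lemma in_sp_W: "x \<in> rsum W"
  by (simp add: span_root_spaces)

lemma diag_diag: "diag d (diag d' x) = diag (\<lambda>\<alpha>. d \<alpha> * d' \<alpha>) x"
proof (rule linear_eq_root_spaces[OF _ linear_diag _ in_sp_W])
  show "linear (\<lambda>x. diag d (diag d' x))" using linear_compose[OF linear_diag linear_diag] by (simp add: o_def)
qed (simp add: diag_root linear_cmul[OF linear_diag])

definition pr :: "('g \<Rightarrow> real) set \<Rightarrow> 'g \<Rightarrow> 'g" where
  "pr A = diag (\<lambda>\<alpha>. if \<alpha> \<in> A then 1 else 0)"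

lemma linear_pr: "linear (pr A)" by (simp add: pr_def linear_diag)

lemmas pr_simps = linear_add[OF linear_pr] linear_cmul[OF linear_pr] linear_diff[OF linear_pr]
  linear_0[OF linear_pr] linear_neg[OF linear_pr]

lemma pr_root: "\<alpha> \<in> W \<Longrightarrow> X \<in> root_space \<alpha> \<Longrightarrow> pr A X = (if \<alpha> \<in> A then X else 0)"
  by (simp add: pr_def diag_root)

lemma pr_in: "pr A x \<in> rsum A"
  using in_sp_W[of x]
proof (rule sp_induct)
  show "subspace {x. pr A x \<in> rsum A}"
    using subspace_preimage[OF linear_pr subspace_sp] .
qed (auto simp: pr_root sp_base subspace_0[OF subspace_sp])

lemma pr_id: "x \<in> rsum A \<Longrightarrow> A \<subseteq> W \<Longrightarrow> A \<subseteq> B \<Longrightarrow> pr B x = x"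
  by (rule linear_eq_root_spaces[OF linear_pr linear_id[unfolded id_def]]) (auto simp: pr_root subset_iff)

lemma pr_zero: "x \<in> rsum A \<Longrightarrow> A \<subseteq> W \<Longrightarrow> A \<inter> B = {} \<Longrightarrow> pr B x = 0"
  by (rule linear_eq_root_spaces[OF linear_pr linear_zero]) (auto simp: pr_root subset_iff disjoint_iff)

lemma pr_pr: "pr A (pr B x) = pr (A \<inter> B) x"
  unfolding pr_def diag_diag by (rule arg_cong[of _ _ "\<lambda>d. diag d x"]) auto

lemma pr_add_disjoint: "A \<inter> B = {} \<Longrightarrow> pr A x + pr B x = pr (A \<union> B) x"
proof (rule linear_eq_root_spaces[OF linear_compose_add[OF linear_pr linear_pr] linear_pr _ in_sp_W])
qed (auto simp: pr_root)

lemma pr_W: "pr W x = x"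
  using pr_id[OF in_sp_W] by simp

lemma sp_iff_pr: "A \<subseteq> W \<Longrightarrow> x \<in> rsum A \<longleftrightarrow> pr A x = x"
  using pr_id[of x A A] pr_in[of A x] by auto

abbreviation pp where "pp \<equiv> neg \<union> {0}"

lemma pr_pos_pp: "pr pos x + pr pp x = x"
proof -
  have "pos \<inter> pp = {}" by (auto simp: pos_iff neg_def)
  then show ?thesis using pr_add_disjoint W_cases pr_W by (metis (no_types, lifting) Un_assoc Un_commute)
qed

lemma nn_eq: "\<nn> = rsum pos" and nnC_eq: "\<nn>\<^sub>C = rsum C"
  by (simp_all add: \<nn>_def \<nn>\<^sub>C_def)

lemma E_root: "\<gamma> \<in> pos \<Longrightarrow> k \<in> {1..m \<gamma>} \<Longrightarrow> E \<gamma> k \<in> root_space \<gamma>"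
  using span_base[of "E \<gamma> k" "E \<gamma> ` {1..m \<gamma>}"] E_span[of \<gamma>] by blast

lemma sum_E_bas:
  assumes "A \<subseteq> pos"
  shows "(\<Sum>\<gamma>\<in>A. \<Sum>k\<in>{1..m \<gamma>}. f (E \<gamma> k)) = (\<Sum>b\<in>(\<Union>\<gamma>\<in>A. bas \<gamma>). f b)"
proof -
  have fin: "finite A" using assms finite_pos finite_subset by blast
  have "(\<Sum>b\<in>(\<Union>\<gamma>\<in>A. bas \<gamma>). f b) = (\<Sum>\<gamma>\<in>A. \<Sum>b\<in>bas \<gamma>. f b)"
  proof (rule sum.UNION_disjoint[OF fin])
    show "\<forall>\<gamma>\<in>A. finite (bas \<gamma>)" using bas(2) independent_imp_finite by blast
    show "\<forall>\<gamma>\<in>A. \<forall>\<delta>\<in>A. \<gamma> \<noteq> \<delta> \<longrightarrow> bas \<gamma> \<inter> bas \<delta> = {}"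
      using bas_disjoint assms pos_W by blast
  qed
  also have "\<dots> = (\<Sum>\<gamma>\<in>A. \<Sum>k\<in>{1..m \<gamma>}. f (E \<gamma> k))"
  proof (rule sum.cong[OF refl])
    fix \<gamma> assume "\<gamma> \<in> A"
    then have "\<gamma> \<in> pos" using assms by blast
    then show "(\<Sum>b\<in>bas \<gamma>. f b) = (\<Sum>k\<in>{1..m \<gamma>}. f (E \<gamma> k))"
      by (simp only: bas_def if_True sum.reindex[OF E_inj] o_def)
  qed
  finally show ?thesis by simp
qed

lemma pr_E_expansion:
  assumes "A \<subseteq> pos"
  shows "(\<Sum>\<gamma>\<in>A. \<Sum>k\<in>{1..m \<gamma>}. rep y (E \<gamma> k) *\<^sub>R E \<gamma> k) = pr A y"
proof -
  have AW: "A \<subseteq> W" using assms pos_W by blast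
  have "pr A y = (\<Sum>b\<in>Bs. if b \<in> (\<Union>\<gamma>\<in>A. bas \<gamma>) then rep y b *\<^sub>R b else 0)"
    unfolding pr_def diag_def
  proof (rule sum.cong[OF refl])
    fix b assume "b \<in> Bs"
    then obtain \<alpha> where a: "\<alpha> \<in> W" "b \<in> bas \<alpha>" by (auto simp: Bs_def)
    have "b \<in> (\<Union>\<gamma>\<in>A. bas \<gamma>) \<longleftrightarrow> \<alpha> \<in> A"
      using a AW bas_disjoint by blast
    then show "((if rt b \<in> A then 1 else 0) * rep y b) *\<^sub>R b = (if b \<in> (\<Union>\<gamma>\<in>A. bas \<gamma>) then rep y b *\<^sub>R b else 0)"
      using rt[OF a] by simp
  qed
  also have "\<dots> = (\<Sum>b\<in>(\<Union>\<gamma>\<in>A. bas \<gamma>). rep y b *\<^sub>R b)"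
  proof -
    have "Bs \<inter> (\<Union>\<gamma>\<in>A. bas \<gamma>) = (\<Union>\<gamma>\<in>A. bas \<gamma>)" using AW by (auto simp: Bs_def)
    then show ?thesis using sum.inter_restrict[OF finite_Bs, of "\<lambda>b. rep y b *\<^sub>R b" "\<Union>\<gamma>\<in>A. bas \<gamma>"] by simp
  qed
  finally show ?thesis using sum_E_bas[OF assms, of "\<lambda>b. rep y b *\<^sub>R b"] by simp
qed

lemma rep_eq_0:
  assumes "x \<in> rsum A" "A \<subseteq> W" "\<gamma> \<in> W" "\<gamma> \<notin> A" "b \<in> bas \<gamma>"
  shows "rep x b = 0"
proof -
  have "b \<notin> (\<Union>\<alpha>\<in>A. bas \<alpha>)" using assms bas_disjoint by blast
  moreover have "(\<Union>\<alpha>\<in>A. bas \<alpha>) \<subseteq> Bs" using assms(2) by (auto simp: Bs_def)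
  ultimately show ?thesis
    using representation_extend[OF independent_Bs, of x "\<Union>\<alpha>\<in>A. bas \<alpha>"] assms(1) representation_ne_zero
    unfolding sp_eq by metis
qed

lemma bas_pos: "(\<Union>\<gamma>\<in>pos. E \<gamma> ` {1..m \<gamma>}) = (\<Union>\<gamma>\<in>pos. bas \<gamma>)"
  by (rule SUP_cong) (auto simp: bas_def)

lemma coord_eq_rep: "y \<in> \<nn> \<Longrightarrow> coord \<gamma> k y = rep y (E \<gamma> k)"
proof -
  assume y: "y \<in> \<nn>"
  have "(\<Union>\<gamma>\<in>pos. bas \<gamma>) \<subseteq> Bs" using pos_W by (auto simp: Bs_def)
  from representation_extend[OF independent_Bs _ this, of y] y show ?thesis
    unfolding coord_def bas_pos nn_eq sp_eq by metis
qed

text \<open>This makes \<open>S\<close> a linear complement of \<open>\<nn>\<^sub>C\<close> in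
  \<open>\<nn>\<close>, with \<open>pr R\<close> as the quotient map.\<close>

lemma S_eq: "S = rsum R"
proof (intro set_eqI iffI)
  fix x assume x: "x \<in> S"
  then have "x \<in> \<nn>" by (simp add: S_def)
  have "pr C x = 0"
    unfolding pr_E_expansion[of C, OF Diff_subset, symmetric]
    using x coord_eq_rep[OF \<open>x \<in> \<nn>\<close>] by (auto simp: S_def intro!: sum.neutral)
  moreover have "pr R x + pr C x = x"
    using pr_add_disjoint[of R C x] pr_id[of x pos pos] pos_W \<open>x \<in> \<nn>\<close> R_pos by (simp add: nn_eq Un_absorb1)
  ultimately show "x \<in> rsum R" using pr_in[of R x] by simp
next
  fix x assume x: "x \<in> rsum R"
  then have n: "x \<in> \<nn>" using sp_mono[OF R_pos] by (auto simp: nn_eq)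
  have "coord \<alpha> j x = 0" if "\<alpha> \<in> C" "j \<in> {1..m \<alpha>}" for \<alpha> j
    unfolding coord_eq_rep[OF n]
    by (rule rep_eq_0[OF x R_W]) (use that pos_W in \<open>auto simp: bas_def\<close>)
  then show "x \<in> S" using n by (simp add: S_def)
qed

text \<open>The Hessenberg condition read backwards: if \<open>\<beta> + \<gamma>\<close> were in
  \<open>R\<close>, subtracting the positive root \<open>\<beta>\<close> would put
  \<open>\<gamma>\<close> into \<open>R\<close>.\<close>

lemma C_ideal:
  assumes "X \<in> rsum (pos \<union> {0})" "Y \<in> \<nn>\<^sub>C"
  shows "br X Y \<in> \<nn>\<^sub>C"
  unfolding nnC_eq
proof (rule br_sp[OF _ _ _ assms(1) assms(2)[unfolded nnC_eq]])
  fix \<beta> \<gamma> assume b: "\<beta> \<in> pos \<union> {0}" and g: "\<gamma> \<in> C" and w: "\<beta> + \<gamma> \<in> W"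
  show "\<beta> + \<gamma> \<in> C"
  proof (cases "\<beta> = 0")
    case False
    then have b': "\<beta> \<in> pos" using b by blast
    then have p: "\<beta> + \<gamma> \<in> pos" using g w by (auto simp: pos_iff)
    have "\<beta> + \<gamma> \<notin> R"
    proof
      assume "\<beta> + \<gamma> \<in> R"
      then have "(\<beta> + \<gamma>) + (- \<beta>) \<in> R" using R_hessenberg[of "\<beta> + \<gamma>" "- \<beta>"] b' g by simp
      then show False using g by simp
    qed
    with p show ?thesis by blast
  qed (use g in simp)
qed (use pos_W in \<open>auto simp: W_def\<close>)

lemma subspace_\<qq>: "subspace \<qq>"
  unfolding \<qq>_def nnC_eq
  using subspace_sp[of C] by (auto simp: subspace_def br_simps)

lemma \<qq>_br: "X \<in> \<qq> \<Longrightarrow> Y \<in> \<qq> \<Longrightarrow> br X Y \<in> \<qq>"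
  unfolding \<qq>_def using subspace_diff[OF subspace_sp[of C]] by (auto simp: br_br nnC_eq)

lemma \<qq>_pos: "rsum (pos \<union> {0}) \<subseteq> \<qq>"
  using C_ideal by (auto simp: \<qq>_def)

lemma nn_\<qq>: "\<nn> \<subseteq> \<qq>"
  using \<qq>_pos sp_mono[of pos "pos \<union> {0}"] by (auto simp: nn_eq)

lemma \<aa>_\<qq>: "\<aa> \<subseteq> \<qq>"
  using \<qq>_pos \<aa>_root_space_0 sp_base[of 0 "pos \<union> {0}"] by blast

lemma nnC_\<qq>: "\<nn>\<^sub>C \<subseteq> \<qq>" and nnC_nn: "\<nn>\<^sub>C \<subseteq> \<nn>"
  using nn_\<qq> sp_mono[of C pos] by (auto simp: nn_eq nnC_eq)

lemma \<qq>_nnC: "X \<in> \<qq> \<Longrightarrow> Y \<in> \<nn>\<^sub>C \<Longrightarrow> br X Y \<in> \<nn>\<^sub>C" "X \<in> \<qq> \<Longrightarrow> Y \<in> \<nn>\<^sub>C \<Longrightarrow> br Y X \<in> \<nn>\<^sub>C"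
  using subspace_neg[OF subspace_sp[of C]] br_swap[of Y X] by (auto simp: \<qq>_def nnC_eq)

text \<open>The filtration by eigenvalues of \<open>ad H0\<close>, which elements of \<open>\<nn>\<close> raise by at least \<open>eps\<close>.\<close>
definition Fil :: "real \<Rightarrow> 'g set" where "Fil c = rsum {\<alpha>\<in>W. \<alpha> H0 \<ge> c}"

text \<open>The least value of a positive root at \<open>H0\<close>, capped at 1; the cap keeps the
  set under \<open>Min\<close> nonempty.\<close>

definition eps :: real where "eps = Min (insert 1 ((\<lambda>\<alpha>. \<alpha> H0) ` pos))"
definition mx :: real where "mx = Max ((\<lambda>\<alpha>. \<bar>\<alpha> H0\<bar>) ` W)"

lemma eps: "eps > 0" "\<alpha> \<in> pos \<Longrightarrow> eps \<le> \<alpha> H0"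
  unfolding eps_def using finite_pos by (auto simp: pos_iff)

lemma mx: "\<alpha> \<in> W \<Longrightarrow> \<bar>\<alpha> H0\<bar> \<le> mx"
  unfolding mx_def using finite_W by simp

lemma subspace_Fil: "subspace (Fil c)" by (simp add: Fil_def subspace_sp)

lemma Fil_top: "Fil (- mx) = UNIV"
proof -
  have "{\<alpha>\<in>W. \<alpha> H0 \<ge> - mx} = W" using mx by force
  then show ?thesis by (simp add: Fil_def span_root_spaces)
qed

lemma Fil_bot: "c > mx \<Longrightarrow> Fil c = {0}"
proof -
  assume "c > mx"
  then have "{\<alpha>\<in>W. \<alpha> H0 \<ge> c} = {}" using mx by force
  then show ?thesis by (simp only: Fil_def sum_root_spaces_def UN_empty span_empty)
qed

lemma Fil_br: "X \<in> Fil c \<Longrightarrow> Y \<in> Fil c' \<Longrightarrow> br X Y \<in> Fil (c + c')"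
  unfolding Fil_def by (rule br_sp) auto

lemma nn_Fil: "\<nn> \<subseteq> Fil eps"
  unfolding nn_eq Fil_def using eps by (intro sp_mono) (auto simp: pos_iff)

lemma Fil_mono: "c \<le> c' \<Longrightarrow> Fil c' \<subseteq> Fil c"
  unfolding Fil_def by (rule sp_mono) auto

lemma Fil_pos: "c > 0 \<Longrightarrow> Fil c \<subseteq> \<nn>"
  unfolding Fil_def nn_eq by (rule sp_mono) (auto simp: pos_iff)

lemma diag_Fil: "x \<in> Fil c \<Longrightarrow> diag d x \<in> Fil c"
  unfolding Fil_def by (rule diag_sp) auto

end

section \<open>The group law and left-invariant fields\<close>

lemma Fd_chain:
  fixes p :: "'b::euclidean_space \<Rightarrow> 'c::euclidean_space" and q :: "'a::euclidean_space \<Rightarrow> 'b"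
  assumes "polynomial_function p" "polynomial_function q"
  shows "Fd (\<lambda>x. p (q x)) x v = Fd p (q x) (Fd q x v)"
  using Fd_eqI[OF has_derivative_compose[OF Fd_poly[OF assms(2)] Fd_poly[OF assms(1)], of x]] by simp

lemma sums_in_subspace:
  fixes V :: "'a::euclidean_space set"
  assumes V: "subspace V" and f: "f sums s" "\<And>k. f k \<in> V"
  shows "s \<in> V"
proof (rule closed_sequentially[OF closed_subspace[OF V]])
  show "(\<lambda>n. \<Sum>k<n. f k) \<longlonglongrightarrow> s" using f(1) by (simp add: sums_def)
  show "(\<Sum>k<n. f k) \<in> V" for n using f(2) by (intro subspace_sum[OF V])
qed

context real_lie_algebra
begin

lemma exp_ad_diff_in:
  assumes V: "subspace V" and XY: "br X Y \<in> V" and XV: "\<And>Z. Z \<in> V \<Longrightarrow> br X Z \<in> V"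
  shows "exp_ad X Y - Y \<in> V"
proof (rule sums_in_subspace[OF V])
  show "(\<lambda>n. (br X ^^ (n + 1)) Y /\<^sub>R fact (n + 1)) sums (exp_ad X Y - Y)"
    using sums_split_initial_segment[OF exp_ad_sums[of X Y], of 1] by simp
  have "(br X ^^ (n + 1)) Y \<in> V" for n
    by (induction n) (use XY XV in auto)
  then show "(br X ^^ (n + 1)) Y /\<^sub>R fact (n + 1) \<in> V" for n
    by (rule subspace_scale[OF V])
qed

lemma exp_ad_in:
  assumes V: "subspace V" and Y: "Y \<in> V" and XV: "\<And>Z. Z \<in> V \<Longrightarrow> br X Z \<in> V"
  shows "exp_ad X Y \<in> V"
  using subspace_add[OF V exp_ad_diff_in[OF V XV[OF Y] XV] Y] by simp

lemma exp_ad_inj: "exp_ad X Y = exp_ad X Z \<Longrightarrow> Y = Z"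
  by (metis exp_ad_uminus)

end

section \<open>Nilpotency of \<open>\<nn>\<close> and polynomial exponentials\<close>

context hessenberg_setting
begin

abbreviation pn where "pn \<equiv> pr pos"

lemma subspace_nn: "subspace \<nn>" by (simp add: nn_eq subspace_sp)
lemma subspace_nnC: "subspace \<nn>\<^sub>C" by (simp add: nnC_eq subspace_sp)

lemma pn_in: "pn x \<in> \<nn>" by (simp add: nn_eq pr_in)
lemma pn_id: "x \<in> \<nn> \<Longrightarrow> pn x = x" using pr_id[of x pos pos] pos_W by (simp add: nn_eq)
lemma pn_pn [simp]: "pn (pn x) = pn x" by (rule pn_id[OF pn_in])

lemma nn_eq_Fil: "\<nn> = Fil eps"
  using nn_Fil Fil_pos[OF eps(1)] by blast

lemma nn_br: "X \<in> \<nn> \<Longrightarrow> Y \<in> \<nn> \<Longrightarrow> br X Y \<in> \<nn>"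
  using Fil_br[of X eps Y eps] Fil_mono[of eps "eps + eps"] eps(1) by (auto simp: nn_eq_Fil)

lemma nn_br_Fil: "X \<in> \<nn> \<Longrightarrow> Y \<in> Fil c \<Longrightarrow> br X Y \<in> Fil (c + eps)"
  using Fil_br[of X eps Y c] by (simp add: nn_eq_Fil add.commute)

lemma nn_br_Fil': "X \<in> \<nn> \<Longrightarrow> Y \<in> Fil c \<Longrightarrow> br X Y \<in> Fil c"
  using nn_br_Fil[of X Y c] Fil_mono[of c "c + eps"] eps(1) by auto

lemma exp_ad_Fil_diff: "X \<in> \<nn> \<Longrightarrow> Y \<in> Fil c \<Longrightarrow> exp_ad X Y - Y \<in> Fil (c + eps)"
  by (rule exp_ad_diff_in[OF subspace_Fil]) (auto intro: nn_br_Fil nn_br_Fil')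

lemma exp_ad_Fil: "X \<in> \<nn> \<Longrightarrow> Y \<in> Fil c \<Longrightarrow> exp_ad X Y \<in> Fil c"
  by (rule exp_ad_in[OF subspace_Fil]) (auto intro: nn_br_Fil')

lemma ad_pow_Fil: "X \<in> \<nn> \<Longrightarrow> (br X ^^ k) Y \<in> Fil (- mx + real k * eps)"
proof (induction k)
  case (Suc k)
  then show ?case using nn_br_Fil[of X "(br X ^^ k) Y" "- mx + real k * eps"] by (simp add: algebra_simps)
qed (simp add: Fil_top)

text \<open>Weights take values between \<open>- mx\<close> and \<open>mx\<close> at
  \<open>H0\<close>, so \<open>NN\<close> steps of size \<open>eps\<close> leave every nonzero
  filtration stage. The same number bounds the nilpotency order and the iterations in
  \<open>binv\<close>.\<close>

definition NN :: nat where "NN = Suc (nat \<lceil>2 * mx / eps\<rceil>)"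

lemma mx_nonneg: "mx \<ge> 0"
  using mx[of 0] by (simp add: W_def)

lemma NN: "k \<ge> NN \<Longrightarrow> real k * eps > 2 * mx"
proof -
  assume "k \<ge> NN"
  then have "2 * mx / eps < real k" unfolding NN_def by linarith
  then show ?thesis using eps(1) by (simp add: divide_simps)
qed

lemma ad_pow_nilpotent: "X \<in> \<nn> \<Longrightarrow> k \<ge> NN \<Longrightarrow> (br X ^^ k) Y = 0"
  using ad_pow_Fil[of X k Y] Fil_bot[of "- mx + real k * eps"] NN[of k] by auto

lemma exp_ad_nilpotent: "X \<in> \<nn> \<Longrightarrow> exp_ad X Y = (\<Sum>k<NN. (br X ^^ k) Y /\<^sub>R fact k)"
  unfolding exp_ad_def by (rule suminf_finite) (auto simp: ad_pow_nilpotent)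

text \<open>On \<open>\<nn>\<close> the series stops after \<open>NN\<close> terms. The projection
  \<open>pn\<close> inside makes the expression polynomial on the whole space.\<close>

lemma polynomial_exp_ad:
  fixes f g :: "'z::real_normed_vector \<Rightarrow> 'g"
  assumes f: "polynomial_function f" and g: "polynomial_function g"
  shows "polynomial_function (\<lambda>x. exp_ad (pn (f x)) (g x))"
proof -
  have "polynomial_function (\<lambda>x. (br (pn (f x)) ^^ k) (g x))" for k
    by (induction k) (use g polynomial_function_bilinear[OF bilinear_br polynomial_function_linear[OF linear_pr f]] in auto)
  then have "polynomial_function (\<lambda>x. \<Sum>k<NN. (br (pn (f x)) ^^ k) (g x) /\<^sub>R fact k)"
    by (intro polynomial_function_sum polynomial_function_cmul) auto
  then show ?thesis by (simp add: exp_ad_nilpotent[OF pn_in])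
qed

section \<open>Inversion of the orbit map of \<open>H0\<close>\<close>

lemma H0_Fil: "H0 \<in> Fil 0"
proof -
  have "H0 \<in> root_space 0" using \<aa>_root_space_0 H0(1) by blast
  then show ?thesis unfolding Fil_def by (rule sp_base[rotated]) (simp add: W_def)
qed

text \<open>The inverse on \<open>\<nn>\<close> of \<open>x \<mapsto> br x H0\<close>, which acts on
  the root space of \<open>\<alpha>\<close> as the scalar \<open>- \<alpha> H0\<close>.\<close>

definition Tinv :: "'g \<Rightarrow> 'g" where "Tinv = diag (\<lambda>\<alpha>. if \<alpha> \<in> pos then - 1 / \<alpha> H0 else 0)"

lemma linear_Tinv: "linear Tinv" by (simp add: Tinv_def linear_diag)

lemma ad_H0_diag: "br H0 x = diag (\<lambda>\<alpha>. \<alpha> H0) x"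
  by (rule linear_eq_root_spaces[OF br_lin2 linear_diag _ in_sp_W])
    (use H0(1) in \<open>simp add: diag_root, simp add: root_space_def\<close>)

lemma diag_cong:
  assumes "x \<in> rsum A" "A \<subseteq> W" "\<And>\<alpha>. \<alpha> \<in> A \<Longrightarrow> d \<alpha> = d' \<alpha>"
  shows "diag d x = diag d' x"
  by (rule linear_eq_root_spaces[OF linear_diag linear_diag _ assms(1)]) (use assms in \<open>auto simp: diag_root subset_iff\<close>)

lemma diag_1: "diag (\<lambda>\<alpha>. 1) x = x"
  by (rule linear_eq_root_spaces[OF linear_diag linear_id[unfolded id_def] _ in_sp_W]) (simp add: diag_root)

lemma diag_minus: "diag (\<lambda>\<alpha>. - d \<alpha>) x = - diag d x"
  by (simp add: diag_def sum_negf)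

lemma Tinv_in: "Tinv x \<in> \<nn>"
proof -
  have "Tinv x = pn (Tinv x)"
    unfolding Tinv_def pr_def diag_diag by (rule arg_cong[of _ _ "\<lambda>d. diag d x"]) auto
  then show ?thesis by (metis pn_in)
qed

lemma br_H0: "br x H0 = diag (\<lambda>\<alpha>. - \<alpha> H0) x"
  by (simp add: br_swap[of x] ad_H0_diag diag_minus)

lemma Tinv_br: "x \<in> \<nn> \<Longrightarrow> Tinv (br x H0) = x"
  unfolding Tinv_def br_H0 diag_diag
  by (subst diag_cong[of x pos _ "\<lambda>\<alpha>. 1"]) (auto simp: diag_1 nn_eq pos_iff)

lemma br_Tinv: "x \<in> \<nn> \<Longrightarrow> br (Tinv x) H0 = x"
  unfolding Tinv_def br_H0 diag_diag
  by (subst diag_cong[of x pos _ "\<lambda>\<alpha>. 1"]) (auto simp: diag_1 nn_eq pos_iff)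

lemma Tinv_Fil: "x \<in> Fil c \<Longrightarrow> Tinv x \<in> Fil c" unfolding Tinv_def by (rule diag_Fil)

lemma Tinv_nnC: "x \<in> \<nn>\<^sub>C \<Longrightarrow> Tinv x \<in> \<nn>\<^sub>C"
  unfolding Tinv_def nnC_eq by (rule diag_sp) (use C_W in auto)

text \<open>The terms of order at least 2 in the series of \<open>exp_ad z H0\<close>.\<close>

definition \<beta>2 :: "'g \<Rightarrow> 'g" where "\<beta>2 z = exp_ad z H0 - H0 - br z H0"

lemma \<beta>2_sums: "(\<lambda>k. (br z ^^ (k + 2)) H0 /\<^sub>R fact (k + 2)) sums \<beta>2 z"
  using sums_split_initial_segment[OF exp_ad_sums[of z H0], of 2]
  by (simp add: \<beta>2_def numeral_2_eq_2 diff_diff_eq)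

text \<open>Each term contains at least two factors \<open>z\<close> or \<open>z'\<close>.
  Telescoping exchanges one of them for \<open>z - z'\<close>, and another raises the degree by
  \<open>eps\<close>; this gain makes the iteration contract.\<close>

lemma \<beta>2_Fil:
  assumes z: "z \<in> \<nn>" "z' \<in> \<nn>" and d: "z - z' \<in> Fil s"
  shows "\<beta>2 z - \<beta>2 z' \<in> Fil (s + eps)"
proof (rule sums_in_subspace[OF subspace_Fil sums_diff[OF \<beta>2_sums \<beta>2_sums]])
  have p: "(br z' ^^ (k + 1)) H0 \<in> Fil eps" for k
  proof (induction k)
    case 0
    show ?case using nn_br_Fil[OF z(2) H0_Fil] by simp
  next
    case (Suc k)
    then show ?case using nn_br_Fil'[OF z(2)] by simp
  qed
  have q: "br (z - z') ((br z' ^^ (k + 1)) H0) \<in> Fil (s + eps)" for k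
    using Fil_br[OF d p] .
  have step: "(br z ^^ Suc k) H0 - (br z' ^^ Suc k) H0 = br z ((br z ^^ k) H0 - (br z' ^^ k) H0) + br (z - z') ((br z' ^^ k) H0)" for k
    by (simp add: br_simps)
  \<comment> \<open>Two orders are carried at once: a single bracket with \<open>H0\<close> yields
    only degree \<open>s\<close>, and the gain of \<open>eps\<close> begins at order 2.\<close>
  have "(br z ^^ (k + 1)) H0 - (br z' ^^ (k + 1)) H0 \<in> Fil s \<and> (br z ^^ (k + 2)) H0 - (br z' ^^ (k + 2)) H0 \<in> Fil (s + eps)" for k
  proof (induction k)
    case 0
    have 1: "(br z ^^ 1) H0 - (br z' ^^ 1) H0 \<in> Fil s" using Fil_br[OF d H0_Fil] by (simp add: br_simps)
    have "(br z ^^ 2) H0 - (br z' ^^ 2) H0 \<in> Fil (s + eps)"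
      using step[of 1] subspace_add[OF subspace_Fil nn_br_Fil[OF z(1) 1] q[of 0]] by (simp add: numeral_2_eq_2)
    with 1 show ?case by (simp add: numeral_2_eq_2)
  next
    case (Suc k)
    then have 1: "(br z ^^ (k + 2)) H0 - (br z' ^^ (k + 2)) H0 \<in> Fil s"
      using Fil_mono[of s "s + eps"] eps(1) by auto
    have "(br z ^^ Suc (k + 2)) H0 - (br z' ^^ Suc (k + 2)) H0 \<in> Fil (s + eps)"
      unfolding step[of "k + 2"] using subspace_add[OF subspace_Fil nn_br_Fil[OF z(1) 1] q[of "Suc k"]] by simp
    with 1 show ?case by (simp add: numeral_eq_Suc)
  qed
  then have "(br z ^^ (k + 2)) H0 - (br z' ^^ (k + 2)) H0 \<in> Fil (s + eps)" for k by blast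
  from subspace_scale[OF subspace_Fil this]
  show "(br z ^^ (k + 2)) H0 /\<^sub>R fact (k + 2) - (br z' ^^ (k + 2)) H0 /\<^sub>R fact (k + 2) \<in> Fil (s + eps)" for k
    by (simp add: scaleR_diff_right)
qed

text \<open>\<open>\<nn>\<^sub>C\<close> is an ideal of \<open>\<qq>\<close>, so the two series
  agree term by term modulo it; telescoping expresses the difference of powers through brackets with
  elements of \<open>\<nn>\<^sub>C\<close>.\<close>

lemma exp_ad_mod_nnC:
  assumes z: "z \<in> \<qq>" "z' \<in> \<qq>" "z - z' \<in> \<nn>\<^sub>C" and Y: "Y \<in> \<qq>" "Y' \<in> \<qq>" "Y - Y' \<in> \<nn>\<^sub>C"
  shows "exp_ad z Y - exp_ad z' Y' \<in> \<nn>\<^sub>C"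
proof (rule sums_in_subspace[OF subspace_nnC sums_diff[OF exp_ad_sums exp_ad_sums]])
  have q: "(br z' ^^ k) Y' \<in> \<qq>" for k
    by (induction k) (use Y \<qq>_br[OF z(2)] in auto)
  have "(br z ^^ k) Y - (br z' ^^ k) Y' \<in> \<nn>\<^sub>C" for k
  proof (induction k)
    case (Suc k)
    have "(br z ^^ Suc k) Y - (br z' ^^ Suc k) Y' = br z ((br z ^^ k) Y - (br z' ^^ k) Y') + br (z - z') ((br z' ^^ k) Y')"
      by (simp add: br_simps)
    then show ?case
      using subspace_add[OF subspace_nnC \<qq>_nnC(1)[OF z(1) Suc.IH] \<qq>_nnC(2)[OF q z(3)]] by simp
  qed (use Y in simp)
  from subspace_scale[OF subspace_nnC this]
  show "(br z ^^ k) Y /\<^sub>R fact k - (br z' ^^ k) Y' /\<^sub>R fact k \<in> \<nn>\<^sub>C" for k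
    by (simp add: scaleR_diff_right)
qed

text \<open>\<open>\<beta> z = exp_ad z H0 - H0\<close> is inverted on \<open>\<nn>\<close> by iterating \<open>\<Psi> y\<close>: its fixed points are
  the solutions of \<open>\<beta> z = y\<close>, and each step raises the filtration degree of differences.\<close>
definition \<Psi> :: "'g \<Rightarrow> 'g \<Rightarrow> 'g" where "\<Psi> y z = Tinv (y - \<beta>2 (pn z))"

definition binv :: "'g \<Rightarrow> 'g" where "binv y = (\<Psi> y ^^ NN) 0"

lemma \<Psi>_in: "\<Psi> y z \<in> \<nn>" by (simp add: \<Psi>_def Tinv_in)

lemma \<Psi>_pow_in: "z \<in> \<nn> \<Longrightarrow> (\<Psi> y ^^ k) z \<in> \<nn>"
  by (cases k) (auto simp: \<Psi>_in)

text \<open>The difference of two iterations gains \<open>eps\<close> in filtration degree at each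
  step, so after \<open>NN\<close> steps the starting point is forgotten.\<close>

lemma \<Psi>_stable:
  assumes z: "z \<in> \<nn>" "z' \<in> \<nn>"
  shows "(\<Psi> y ^^ NN) z = (\<Psi> y ^^ NN) z'"
proof -
  have "(\<Psi> y ^^ k) z - (\<Psi> y ^^ k) z' \<in> Fil (real (k + 1) * eps)" for k
  proof (induction k)
    case 0
    show ?case using subspace_diff[OF subspace_nn z] by (simp add: nn_eq_Fil)
  next
    case (Suc k)
    have "(\<Psi> y ^^ Suc k) z - (\<Psi> y ^^ Suc k) z' = - Tinv (\<beta>2 ((\<Psi> y ^^ k) z) - \<beta>2 ((\<Psi> y ^^ k) z'))"
      using \<Psi>_pow_in[OF z(1)] \<Psi>_pow_in[OF z(2)]
      by (simp add: \<Psi>_def pn_id linear_diff[OF linear_Tinv])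
    moreover have "- Tinv (\<beta>2 ((\<Psi> y ^^ k) z) - \<beta>2 ((\<Psi> y ^^ k) z')) \<in> Fil (real (k + 1) * eps + eps)"
      by (intro subspace_neg[OF subspace_Fil] Tinv_Fil \<beta>2_Fil \<Psi>_pow_in z Suc.IH)
    moreover have "real (Suc k + 1) * eps = real (k + 1) * eps + eps" by (simp add: algebra_simps)
    ultimately show ?case by (simp only:)
  qed
  from this[of NN] Fil_bot[of "real (NN + 1) * eps"] NN[of "NN + 1"] mx_nonneg show ?thesis by auto
qed

lemma binv_in: "binv y \<in> \<nn>"
  unfolding binv_def by (rule \<Psi>_pow_in) (simp add: subspace_0[OF subspace_nn])

lemma exp_ad_H0_in: "x \<in> \<nn> \<Longrightarrow> y \<in> Fil 0 \<Longrightarrow> exp_ad x y - y \<in> \<nn>"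
  using exp_ad_Fil_diff[of x y 0] by (simp add: nn_eq_Fil)

lemma binv_right: "y \<in> \<nn> \<Longrightarrow> exp_ad (binv y) H0 - H0 = y"
proof -
  assume y: "y \<in> \<nn>"
  \<comment> \<open>One more step after the iteration from 0 is the iteration from
    \<open>\<Psi> y 0\<close>, which by stability again ends in \<open>binv y\<close>.\<close>
  have "\<Psi> y (binv y) = (\<Psi> y ^^ NN) (\<Psi> y 0)" unfolding binv_def by (rule funpow_swap1)
  also have "\<dots> = binv y" unfolding binv_def by (rule \<Psi>_stable[OF \<Psi>_in subspace_0[OF subspace_nn]])
  finally have "Tinv (y - \<beta>2 (binv y)) = binv y" by (simp add: \<Psi>_def pn_id[OF binv_in])
  moreover have "y - \<beta>2 (binv y) \<in> \<nn>"
    unfolding \<beta>2_def using nn_br_Fil[OF binv_in H0_Fil]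
    by (intro subspace_diff[OF subspace_nn] y exp_ad_H0_in binv_in H0_Fil) (simp add: nn_eq_Fil)
  ultimately have "br (binv y) H0 = y - \<beta>2 (binv y)" using br_Tinv by metis
  then show ?thesis by (simp add: \<beta>2_def algebra_simps)
qed

lemma binv_left: "z \<in> \<nn> \<Longrightarrow> binv (exp_ad z H0 - H0) = z"
proof -
  assume z: "z \<in> \<nn>"
  let ?y = "exp_ad z H0 - H0"
  have "\<Psi> ?y z = z" unfolding \<Psi>_def pn_id[OF z] \<beta>2_def by (simp add: Tinv_br[OF z])
  then have "(\<Psi> ?y ^^ k) z = z" for k by (induction k) auto
  then show ?thesis
    unfolding binv_def using \<Psi>_stable[OF z subspace_0[OF subspace_nn], of ?y] by simp
qed

text \<open>All weights occurring in \<open>Fil c\<close> exceed \<open>l\<close> at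
  \<open>H0\<close>, so \<open>ad H0 - l\<close> is invertible there.\<close>

lemma eigen_Fil:
  assumes v: "v \<in> Fil c" "c > l" "br H0 v = l *\<^sub>R v"
  shows "v = 0"
proof -
  let ?A = "{\<alpha>\<in>W. \<alpha> H0 \<ge> c}"
  have "diag (\<lambda>\<alpha>. \<alpha> H0 - l) v = 0"
  proof -
    have "diag (\<lambda>\<alpha>. \<alpha> H0 - l) v = diag (\<lambda>\<alpha>. \<alpha> H0) v - l *\<^sub>R diag (\<lambda>\<alpha>. 1) v"
      by (simp add: diag_def algebra_simps sum_subtractf scaleR_sum_right)
    then show ?thesis using v(3) by (simp add: ad_H0_diag diag_1)
  qed
  then have "diag (\<lambda>\<alpha>. 1 / (\<alpha> H0 - l)) (diag (\<lambda>\<alpha>. \<alpha> H0 - l) v) = 0"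
    by (simp add: linear_0[OF linear_diag])
  moreover have "diag (\<lambda>\<alpha>. 1 / (\<alpha> H0 - l)) (diag (\<lambda>\<alpha>. \<alpha> H0 - l) v) = diag (\<lambda>\<alpha>. 1) v"
    unfolding diag_diag by (rule diag_cong[OF v(1)[unfolded Fil_def]]) (use v(2) in auto)
  ultimately show ?thesis by (simp add: diag_1)
qed

text \<open>\<open>u\<close> commutes with \<open>ad H0\<close>, so \<open>u X - X\<close> keeps the
  eigenvalue of \<open>X\<close>, yet it lies in a strictly higher filtration stage.\<close>

lemma unipotent_fixing_H0:
  assumes u: "lie_auto u" "u H0 = H0" and uni: "\<And>c Y. Y \<in> Fil c \<Longrightarrow> u Y - Y \<in> Fil (c + eps)"
  shows "u = id"
proof
  fix Y
  have "u Y = Y"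
  proof (rule linear_eq_root_spaces[OF _ linear_id[unfolded id_def] _ in_sp_W])
    show "linear u" using u by (simp add: lie_auto_def)
    fix \<alpha> X assume a: "\<alpha> \<in> W" and X: "X \<in> root_space \<alpha>"
    have "br H0 (u X) = u (br H0 X)" using u by (simp add: lie_auto_def)
    also have "\<dots> = \<alpha> H0 *\<^sub>R u X"
      using X H0(1) linear_cmul[OF \<open>linear u\<close>] by (simp add: root_space_def)
    finally have "br H0 (u X - X) = \<alpha> H0 *\<^sub>R (u X - X)"
      using X H0(1) by (simp add: br_simps root_space_def scaleR_diff_right)
    moreover have "X \<in> Fil (\<alpha> H0)" unfolding Fil_def by (rule sp_base[OF _ X]) (use a in simp)
    then have "u X - X \<in> Fil (\<alpha> H0 + eps)" by (rule uni)
    ultimately have "u X - X = 0" using eigen_Fil eps(1) by (metis less_add_same_cancel1)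
    then show "u X = X" by simp
  qed
  then show "u Y = id Y" by simp
qed

text \<open>The product of \<open>exp x\<close> and \<open>exp y\<close> in the exponential chart,
  recovered from where it sends \<open>H0\<close>.\<close>

definition mu :: "'g \<Rightarrow> 'g \<Rightarrow> 'g" where
  "mu x y = binv (exp_ad (pn x) (exp_ad (pn y) H0) - H0)"

lemma mu_in: "mu x y \<in> \<nn>" by (simp add: mu_def binv_in)

lemma mu_arg_in: "exp_ad (pn x) (exp_ad (pn y) H0) - H0 \<in> \<nn>"
proof -
  have 1: "exp_ad (pn y) H0 \<in> Fil 0" by (rule exp_ad_Fil[OF pn_in H0_Fil])
  have "(exp_ad (pn x) (exp_ad (pn y) H0) - exp_ad (pn y) H0) + (exp_ad (pn y) H0 - H0) \<in> \<nn>"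
    by (rule subspace_add[OF subspace_nn exp_ad_H0_in[OF pn_in 1] exp_ad_H0_in[OF pn_in H0_Fil]])
  then show ?thesis by simp
qed

text \<open>Both sides agree on \<open>H0\<close> by construction; their quotient is unipotent for
  the filtration and fixes \<open>H0\<close>, hence is the identity.\<close>

lemma exp_ad_mu: "exp_ad (mu x y) Y = exp_ad (pn x) (exp_ad (pn y) Y)"
proof -
  let ?z = "mu x y"
  have z: "?z \<in> \<nn>" "- ?z \<in> \<nn>" using mu_in subspace_neg[OF subspace_nn] by auto
  have zH: "exp_ad ?z H0 = exp_ad (pn x) (exp_ad (pn y) H0)"
    using binv_right[OF mu_arg_in, of x y] by (simp add: mu_def)
  define u where "u = exp_ad (- ?z) \<circ> (exp_ad (pn x) \<circ> exp_ad (pn y))"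
  have "u = id"
  proof (rule unipotent_fixing_H0)
    show "lie_auto u" unfolding u_def by (intro lie_auto_comp lie_auto_exp_ad)
    show "u H0 = H0" by (simp add: u_def zH[symmetric] exp_ad_uminus)
    fix c Y assume Y: "Y \<in> Fil c"
    have 1: "exp_ad (pn y) Y \<in> Fil c" by (rule exp_ad_Fil[OF pn_in Y])
    have 2: "exp_ad (pn x) (exp_ad (pn y) Y) \<in> Fil c" by (rule exp_ad_Fil[OF pn_in 1])
    have "(u Y - exp_ad (pn x) (exp_ad (pn y) Y)) + ((exp_ad (pn x) (exp_ad (pn y) Y) - exp_ad (pn y) Y) + (exp_ad (pn y) Y - Y)) \<in> Fil (c + eps)"
      unfolding u_def o_def
      by (intro subspace_add[OF subspace_Fil] exp_ad_Fil_diff z(2) pn_in 1 2 Y)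
    then show "u Y - Y \<in> Fil (c + eps)" by simp
  qed
  then have "exp_ad ?z (u Y) = exp_ad ?z Y" by simp
  then show ?thesis by (simp add: u_def exp_ad_uminus')
qed

section \<open>The logarithm and polynomiality of the product\<close>

lemma exp_ad_inj_on: "inj_on exp_ad \<nn>"
  by (rule inj_onI) (metis binv_left)

lemma log_N_exp: "x \<in> \<nn> \<Longrightarrow> log_N (exp_ad x) = x"
  unfolding log_N_def by (rule inv_into_f_f[OF exp_ad_inj_on])

lemma log_N_mult: "x \<in> \<nn> \<Longrightarrow> y \<in> \<nn> \<Longrightarrow> log_N (exp_ad x \<circ> exp_ad y) = mu x y"
proof -
  assume "x \<in> \<nn>" "y \<in> \<nn>"
  then have "exp_ad x \<circ> exp_ad y = exp_ad (mu x y)" by (simp add: fun_eq_iff exp_ad_mu pn_id)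
  then show ?thesis by (simp add: log_N_exp mu_in)
qed

lemma mu_0: "mu x 0 = pn x"
  by (simp add: mu_def pr_simps binv_left[OF pn_in])

lemma polynomial_binv:
  fixes f :: "'z::real_normed_vector \<Rightarrow> 'g"
  assumes f: "polynomial_function f"
  shows "polynomial_function (\<lambda>x. binv (f x))"
proof -
  have "polynomial_function (\<lambda>x. (\<Psi> (f x) ^^ k) 0)" for k
  proof (induction k)
    case (Suc k)
    define q where "q x = (\<Psi> (f x) ^^ k) 0" for x
    have q: "polynomial_function q" using Suc.IH by (simp add: q_def[abs_def])
    let ?g = "\<lambda>x. pn (q x)"
    have g: "polynomial_function ?g" by (rule polynomial_function_linear[OF linear_pr q])
    have "polynomial_function (\<lambda>x. f x - (exp_ad (?g x) H0 - H0 - br (?g x) H0))"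
      by (intro polynomial_function_diff f polynomial_exp_ad q polynomial_function_const
          polynomial_function_linear[OF br_lin1 g])
    from polynomial_function_linear[OF linear_Tinv this] have "polynomial_function (\<lambda>x. \<Psi> (f x) (q x))"
      by (simp add: \<Psi>_def \<beta>2_def)
    then show ?case by (simp add: q_def)
  qed simp
  then show ?thesis by (simp add: binv_def)
qed

lemma polynomial_mu:
  fixes f g :: "'z::real_normed_vector \<Rightarrow> 'g"
  assumes "polynomial_function f" "polynomial_function g"
  shows "polynomial_function (\<lambda>x. mu (f x) (g x))"
  unfolding mu_def
  by (intro polynomial_binv polynomial_function_diff polynomial_exp_ad assms polynomial_function_const)

abbreviation mu2 :: "'g \<times> 'g \<Rightarrow> 'g" where "mu2 z \<equiv> mu (fst z) (snd z)"

lemma polynomial_mu2: "polynomial_function mu2"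
  by (intro polynomial_mu polynomial_function_bounded_linear bounded_linear_fst bounded_linear_snd)

text \<open>The value at \<open>x\<close> of the left-invariant vector field with value \<open>A\<close> at the identity.\<close>
definition Linv :: "'g \<Rightarrow> 'g \<Rightarrow> 'g" where "Linv A x = Fd mu2 (x, 0) (0, A)"

lemma linear_Linv: "linear (\<lambda>A. Linv A x)"
  unfolding Linv_def using Fd_linear[OF polynomial_mu2, of "(x, 0)"]
  by (intro linearI) (simp_all add: linear_add[symmetric] linear_cmul[symmetric])

lemma polynomial_Pair:
  fixes f :: "'z::real_normed_vector \<Rightarrow> 'a::euclidean_space" and g :: "'z \<Rightarrow> 'b::euclidean_space"
  assumes "polynomial_function f" "polynomial_function g"
  shows "polynomial_function (\<lambda>x. (f x, g x))"
proof -
  have "polynomial_function (\<lambda>x. (f x, 0) + (0, g x))"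
    by (intro polynomial_function_add polynomial_function_linear[of "\<lambda>a. (a, 0)"] polynomial_function_linear[of "\<lambda>a. (0, a)"] assms)
      (auto intro!: linearI)
  then show ?thesis by simp
qed

lemma polynomial_Linv:
  assumes f: "polynomial_function f"
  shows "polynomial_function (\<lambda>x. Linv (f x) x)"
proof -
  have "polynomial_function (\<lambda>z. Fd mu2 z (0, f (fst z)))"
    using polynomial_function_compose[OF polynomial_function_bounded_linear[OF bounded_linear_fst] f]
    by (intro polynomial_Fd polynomial_mu2 polynomial_Pair polynomial_function_const) (simp add: o_def)
  from polynomial_function_compose[OF polynomial_Pair[OF polynomial_function_id polynomial_function_const[of 0]] this]
  show ?thesis by (simp add: o_def Linv_def)
qed

text \<open>Only the velocity at 0 enters, so the lemma applies to a curve merely differentiable at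
  0, such as the one given by the local factorization.\<close>

lemma Linv_curve:
  assumes y: "(y has_vector_derivative A) (at 0)" "y 0 = 0"
  shows "((\<lambda>t. mu x (y t)) has_vector_derivative Linv A x) (at 0)"
proof -
  have "((\<lambda>t. (x, y t)) has_derivative (\<lambda>t. (0, t *\<^sub>R A))) (at 0)"
    using y(1) unfolding has_vector_derivative_def
    by (intro has_derivative_Pair has_derivative_const)
  moreover have "(mu2 has_derivative Fd mu2 (x, 0)) (at (x, y 0))"
    using Fd_poly[OF polynomial_mu2] y(2) by simp
  ultimately have "((\<lambda>t. mu2 (x, y t)) has_derivative (\<lambda>t. Fd mu2 (x, 0) (0, t *\<^sub>R A))) (at 0)"
    using has_derivative_compose by blast
  moreover have "Fd mu2 (x, 0) (0, t *\<^sub>R A) = t *\<^sub>R Linv A x" for t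
    using linear_cmul[OF linear_Linv, of t A x] by (simp add: Linv_def)
  ultimately show ?thesis by (simp add: has_vector_derivative_def)
qed

lemma Linv_line: "((\<lambda>t. mu x (t *\<^sub>R A)) has_vector_derivative Linv A x) (at 0)"
  by (rule Linv_curve) (auto intro!: derivative_eq_intros simp: has_vector_derivative_def)

text \<open>Curves that coincide have the same velocity, so identities for linear images of
  \<open>mu\<close> pass to \<open>Linv\<close>.\<close>

lemma Linv_linear_image:
  assumes L: "linear L" and eq: "\<And>t. L (mu x (t *\<^sub>R A)) = g t" and g: "(g has_vector_derivative g') (at 0)"
  shows "L (Linv A x) = g'"
proof -
  have "((\<lambda>t. L (mu x (t *\<^sub>R A))) has_vector_derivative L (Linv A x)) (at 0)"
    by (rule linear_has_vector_derivative[OF L Linv_line])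
  from this[unfolded eq] g show ?thesis by (rule vector_derivative_unique_at)
qed

lemma Linv_in: "Linv A x \<in> \<nn>"
proof -
  have "pn (Linv A x) = Linv A x"
    by (rule Linv_linear_image[OF linear_pr _ Linv_line]) (rule pn_id[OF mu_in])
  then show ?thesis by (metis pn_in)
qed

lemma pn_Linv [simp]: "pn (Linv A x) = Linv A x" by (rule pn_id[OF Linv_in])

lemma Linv_A_pn: "Linv (pn A) x = Linv A x"
  by (rule Linv_linear_image[OF linear_id[unfolded id_def] _ Linv_line]) (simp add: mu_def pr_simps)

section \<open>Brackets of left-invariant fields, tested on orbit maps\<close>

abbreviation ex :: "'g \<Rightarrow> 'g \<Rightarrow> 'g" where "ex x Y \<equiv> exp_ad (pn x) Y"

lemma polynomial_ex: "polynomial_function (\<lambda>x. ex x Y)"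
  by (intro polynomial_exp_ad polynomial_function_id polynomial_function_const)

lemma Fd_pn: "Fd pn x = pn"
  by (rule Fd_bounded_linear) (rule linear_imp_bounded_linear[OF linear_pr])

lemma polynomial_pn: "polynomial_function pn"
  by (rule polynomial_function_bounded_linear) (rule linear_imp_bounded_linear[OF linear_pr])

text \<open>The curve \<open>mu x (t *\<^sub>R A)\<close> starts at \<open>pn x\<close> rather than
  \<open>x\<close>; invariance of \<open>h\<close> under \<open>pn\<close> moves the derivative back
  to \<open>x\<close>.\<close>

lemma Fd_along_Linv:
  fixes h :: "'g \<Rightarrow> 'g"
  assumes h: "polynomial_function h" "\<And>x. h (pn x) = h x"
    and d: "((\<lambda>t. h (mu x (t *\<^sub>R A))) has_vector_derivative d) (at 0)"
  shows "Fd h x (Linv A x) = d"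
proof -
  have "((\<lambda>t. h (mu x (t *\<^sub>R A))) has_derivative (\<lambda>t. Fd h (pn x) (t *\<^sub>R Linv A x))) (at 0)"
    using has_derivative_compose[OF Linv_line[unfolded has_vector_derivative_def], of h "Fd h (pn x)" x A]
      Fd_poly[OF h(1)] by (simp add: mu_0)
  then have "((\<lambda>t. h (mu x (t *\<^sub>R A))) has_vector_derivative Fd h (pn x) (Linv A x)) (at 0)"
    unfolding has_vector_derivative_def by (simp add: linear_cmul[OF Fd_linear[OF h(1)]])
  from vector_derivative_unique_at[OF this d] have "Fd h (pn x) (pn (Linv A x)) = d" by simp
  then show ?thesis using Fd_chain[OF h(1) polynomial_pn, of x "Linv A x"] by (simp add: Fd_pn h(2))
qed

lemma exp_ad_line: "((\<lambda>t. exp_ad (t *\<^sub>R A) Y) has_vector_derivative br A Y) (at 0)"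
  using line_deriv[OF exp_ad_has_derivative_0, of A Y] by simp

lemma Fd_ex_Linv: "Fd (\<lambda>x. ex x Y) x (Linv A x) = ex x (br (pn A) Y)"
proof (rule Fd_along_Linv)
  show "polynomial_function (\<lambda>x. ex x Y)" by (rule polynomial_ex)
  have "ex (mu x (t *\<^sub>R A)) Y = ex x (exp_ad (t *\<^sub>R pn A) Y)" for t
    by (simp add: pn_id[OF mu_in] exp_ad_mu pr_simps)
  then show "((\<lambda>t. ex (mu x (t *\<^sub>R A)) Y) has_vector_derivative ex x (br (pn A) Y)) (at 0)"
    using linear_has_vector_derivative[OF linear_exp_ad exp_ad_line]
    by simp
qed simp

text \<open>Differentiating \<open>binv (ex x H0 - H0) = pn x\<close> shows that the orbit map of
  \<open>H0\<close> is an immersion along \<open>\<nn>\<close>.\<close>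

lemma Fd_ex_H0_inj:
  assumes "Fd (\<lambda>x. ex x H0) x v = 0"
  shows "pn v = 0"
proof -
  have p: "polynomial_function (\<lambda>x. ex x H0 - H0)"
    by (intro polynomial_function_diff polynomial_ex polynomial_function_const)
  have bp: "polynomial_function binv" using polynomial_binv[OF polynomial_function_id] by simp
  have d: "Fd (\<lambda>x. ex x H0 - H0) x v = Fd (\<lambda>x. ex x H0) x v"
    using Fd_eqI[OF has_derivative_diff[OF Fd_poly[OF polynomial_ex[of H0], of x] has_derivative_const[of H0]]] by simp
  have "pn v = Fd (\<lambda>x. binv (ex x H0 - H0)) x v"
    by (simp add: binv_left[OF pn_in] Fd_pn)
  also have "\<dots> = Fd binv (ex x H0 - H0) (Fd (\<lambda>x. ex x H0 - H0) x v)"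
    by (rule Fd_chain[OF bp p])
  also have "\<dots> = 0" by (simp add: d assms linear_0[OF Fd_linear[OF bp]])
  finally show ?thesis .
qed

lemma Fd_ex_app:
  fixes w :: "'g \<Rightarrow> 'g"
  assumes w: "polynomial_function w"
  shows "Fd (\<lambda>x. ex x (w x)) x v = Fd (\<lambda>y. ex y (w x)) x v + ex x (Fd w x v)"
proof -
  have expand: "ex y z = (\<Sum>b\<in>Basis. (z \<bullet> b) *\<^sub>R ex y b)" for y z
    by (subst (1) euclidean_representation[symmetric])
      (simp only: linear_sum[OF linear_exp_ad] linear_cmul[OF linear_exp_ad])
  have wb: "((\<lambda>y. w y \<bullet> b) has_derivative (\<lambda>v. Fd w x v \<bullet> b)) (at x)" for b
    by (rule bounded_linear.has_derivative[OF bounded_linear_inner_left Fd_poly[OF w]])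
  have eb: "((\<lambda>y. ex y b) has_derivative Fd (\<lambda>y. ex y b) x) (at x)" for b
    by (rule Fd_poly[OF polynomial_ex])
  have "((\<lambda>y. \<Sum>b\<in>Basis. (w y \<bullet> b) *\<^sub>R ex y b) has_derivative
     (\<lambda>v. \<Sum>b\<in>Basis. (w x \<bullet> b) *\<^sub>R Fd (\<lambda>y. ex y b) x v + (Fd w x v \<bullet> b) *\<^sub>R ex x b)) (at x)"
    by (intro has_derivative_sum has_derivative_scaleR wb eb)
  from Fd_eqI[OF this] have 1: "Fd (\<lambda>y. ex y (w y)) x v =
     (\<Sum>b\<in>Basis. (w x \<bullet> b) *\<^sub>R Fd (\<lambda>y. ex y b) x v) + (\<Sum>b\<in>Basis. (Fd w x v \<bullet> b) *\<^sub>R ex x b)"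
    by (simp only: expand[symmetric] sum.distrib)
  have "((\<lambda>y. \<Sum>b\<in>Basis. (w x \<bullet> b) *\<^sub>R ex y b) has_derivative
     (\<lambda>v. \<Sum>b\<in>Basis. (w x \<bullet> b) *\<^sub>R Fd (\<lambda>y. ex y b) x v)) (at x)"
    by (intro has_derivative_sum has_derivative_scaleR_right eb)
  from Fd_eqI[OF this] have "Fd (\<lambda>y. ex y (w x)) x v = (\<Sum>b\<in>Basis. (w x \<bullet> b) *\<^sub>R Fd (\<lambda>y. ex y b) x v)"
    by (simp only: expand[symmetric])
  with 1 show ?thesis by (simp only: expand[symmetric])
qed

text \<open>Both sides are compared under the derivative of the orbit map of \<open>H0\<close>,
  which is injective on \<open>\<nn>\<close>. On orbit maps the field \<open>Linv A\<close> acts by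
  inserting \<open>br A\<close>, so the bracket of g appears without second derivatives of
  \<open>mu\<close>. The two extra terms come from coefficients that vary with the point.\<close>

lemma Linv_bracket:
  assumes f: "polynomial_function f" "\<And>x. f x \<in> \<nn>" and g: "polynomial_function g" "\<And>x. g x \<in> \<nn>"
  defines "F \<equiv> \<lambda>x. Linv (f x) x" and "G \<equiv> \<lambda>x. Linv (g x) x"
  shows "Fd G x (F x) - Fd F x (G x) = Linv (br (f x) (g x) + Fd g x (F x) - Fd f x (G x)) x"
proof -
  have pF: "polynomial_function F" and pG: "polynomial_function G"
    unfolding F_def G_def by (intro polynomial_Linv f g)+
  have Fd_in: "Fd p x v \<in> \<nn>" if "polynomial_function p" "\<And>x. p x \<in> \<nn>" for p :: "'g \<Rightarrow> 'g" and v
  proof -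
    have "pn (Fd p x v) = Fd (\<lambda>x. pn (p x)) x v" by (rule Fd_linear_comp[OF linear_pr that(1), symmetric])
    also have "\<dots> = Fd p x v" using that(2) by (simp add: pn_id)
    finally show ?thesis by (metis pn_in)
  qed
  let ?k = "br (f x) (g x) + Fd g x (F x) - Fd f x (G x)"
  have k: "?k \<in> \<nn>"
    by (intro subspace_add[OF subspace_nn] subspace_diff[OF subspace_nn] nn_br f g Fd_in)
  have half: "Fd (\<lambda>y. Fd (\<lambda>x. ex x H0) y (Linv (g y) y)) x (Linv (f x) x)
      = ex x (br (f x) (br (g x) H0)) + ex x (br (Fd g x (Linv (f x) x)) H0)"
    if f: "polynomial_function f" "\<And>x. f x \<in> \<nn>" and g: "polynomial_function g" "\<And>x. g x \<in> \<nn>" for f g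
  proof -
    have w: "polynomial_function (\<lambda>y. br (g y) H0)" by (rule polynomial_function_linear[OF br_lin1 g(1)])
    have "Fd (\<lambda>y. Fd (\<lambda>x. ex x H0) y (Linv (g y) y)) x (Linv (f x) x) = Fd (\<lambda>y. ex y (br (g y) H0)) x (Linv (f x) x)"
      by (simp add: Fd_ex_Linv pn_id[OF g(2)])
    also have "\<dots> = ex x (br (f x) (br (g x) H0)) + ex x (Fd (\<lambda>y. br (g y) H0) x (Linv (f x) x))"
      by (simp only: Fd_ex_app[OF w] Fd_ex_Linv pn_id[OF f(2)])
    finally show ?thesis by (simp only: Fd_linear_comp[OF br_lin1 g(1)])
  qed
  have "Fd (\<lambda>x. ex x H0) x (Fd G x (F x) - Fd F x (G x)) =
     Fd (\<lambda>y. Fd (\<lambda>x. ex x H0) y (G y)) x (F x) - Fd (\<lambda>y. Fd (\<lambda>x. ex x H0) y (F y)) x (G x)"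
    by (rule Fd_commutator[OF polynomial_ex pF pG, symmetric])
  also have "\<dots> = ex x (br ?k H0)"
    unfolding F_def G_def half[OF f g] half[OF g f]
    by (simp add: br_br br_simps exp_ad_simps)
  also have "\<dots> = Fd (\<lambda>x. ex x H0) x (Linv ?k x)"
    by (simp add: Fd_ex_Linv pn_id[OF k])
  finally have "Fd (\<lambda>x. ex x H0) x (Fd G x (F x) - Fd F x (G x) - Linv ?k x) = 0"
    by (simp add: linear_diff[OF Fd_linear[OF polynomial_ex]])
  then have "pn (Fd G x (F x) - Fd F x (G x) - Linv ?k x) = 0" by (rule Fd_ex_H0_inj)
  moreover have "Fd G x (F x) - Fd F x (G x) - Linv ?k x \<in> \<nn>"
    by (intro subspace_diff[OF subspace_nn] Fd_in pF pG Linv_in) (simp_all add: F_def G_def Linv_in)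
  ultimately show ?thesis using pn_id by simp
qed

text \<open>Differentiating the orbit maps of all \<open>Y\<close> gives \<open>br A Y = 0\<close>,
  and the centre is trivial.\<close>

lemma Linv_eq_0_imp: "A \<in> \<nn> \<Longrightarrow> Linv A x = 0 \<Longrightarrow> A = 0"
proof -
  assume A: "A \<in> \<nn>" "Linv A x = 0"
  have "ex x (br A Y) = 0" for Y
    using Fd_ex_Linv[of Y x A] A linear_0[OF Fd_linear[OF polynomial_ex]] by (simp add: pn_id)
  then have "br A Y = 0" for Y using exp_ad_inj[of "pn x" "br A Y" 0] exp_ad_simps(4) by metis
  then show "A = 0" by (rule ad_eq_0_imp)
qed

section \<open>Reduction modulo the ideal\<close>

lemma pr_C_R: "x \<in> \<nn> \<Longrightarrow> pr R x + pr C x = x"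
  using pr_add_disjoint[of R C x] pn_id[of x] R_pos by (simp add: Un_absorb1)

lemma nnC_iff: "x \<in> \<nn>\<^sub>C \<longleftrightarrow> x \<in> \<nn> \<and> pr R x = 0"
proof
  assume "x \<in> \<nn>\<^sub>C"
  then show "x \<in> \<nn> \<and> pr R x = 0" using nnC_nn pr_zero[of x C R] C_W by (auto simp: nnC_eq)
next
  assume x: "x \<in> \<nn> \<and> pr R x = 0"
  then have "pr C x = x" using pr_C_R[of x] by simp
  then show "x \<in> \<nn>\<^sub>C" unfolding nnC_eq by (metis pr_in)
qed

lemma nnC_diff_iff: "x \<in> \<nn> \<Longrightarrow> y \<in> \<nn> \<Longrightarrow> x - y \<in> \<nn>\<^sub>C \<longleftrightarrow> pr R x = pr R y"
  using subspace_diff[OF subspace_nn, of x y] by (auto simp: nnC_iff pr_simps)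

lemma pn_in_\<qq>: "pn x \<in> \<qq>" using nn_\<qq> pn_in by blast

lemma H0_\<qq>: "H0 \<in> \<qq>" using \<aa>_\<qq> H0(1) by blast

lemma zero_nnC: "0 \<in> \<nn>\<^sub>C" by (rule subspace_0[OF subspace_nnC])

text \<open>Each step of the iteration is built from exponentials, \<open>Tinv\<close> and a bracket
  with \<open>H0\<close>. As \<open>H0\<close> lies in \<open>\<qq>\<close>, all of these respect
  congruence modulo \<open>\<nn>\<^sub>C\<close>.\<close>

lemma binv_mod:
  assumes "y - y' \<in> \<nn>\<^sub>C"
  shows "binv y - binv y' \<in> \<nn>\<^sub>C"
proof -
  have "(\<Psi> y ^^ k) 0 - (\<Psi> y' ^^ k) 0 \<in> \<nn>\<^sub>C" for k
  proof (induction k)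
    case (Suc k)
    let ?z = "(\<Psi> y ^^ k) 0" and ?z' = "(\<Psi> y' ^^ k) 0"
    have z: "?z \<in> \<nn>" "?z' \<in> \<nn>" by (intro \<Psi>_pow_in subspace_0[OF subspace_nn])+
    then have zq: "?z \<in> \<qq>" "?z' \<in> \<qq>" using nn_\<qq> by auto
    have e: "exp_ad ?z H0 - exp_ad ?z' H0 \<in> \<nn>\<^sub>C"
      by (rule exp_ad_mod_nnC[OF zq Suc.IH H0_\<qq> H0_\<qq>]) (simp add: zero_nnC)
    have b: "br (?z - ?z') H0 \<in> \<nn>\<^sub>C" by (rule \<qq>_nnC(2)[OF H0_\<qq> Suc.IH])
    have "\<beta>2 ?z - \<beta>2 ?z' = (exp_ad ?z H0 - exp_ad ?z' H0) - br (?z - ?z') H0"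
      by (simp add: \<beta>2_def br_simps)
    then have "\<beta>2 ?z - \<beta>2 ?z' \<in> \<nn>\<^sub>C" using subspace_diff[OF subspace_nnC e b] by simp
    from Tinv_nnC[OF subspace_diff[OF subspace_nnC assms this]]
    moreover have "(\<Psi> y ^^ Suc k) 0 - (\<Psi> y' ^^ Suc k) 0 = Tinv (y - y' - (\<beta>2 ?z - \<beta>2 ?z'))"
      using z by (simp add: \<Psi>_def[of y ?z] \<Psi>_def[of y' ?z'] pn_id linear_diff[OF linear_Tinv])
    ultimately show ?case by (simp only:)
  qed (simp add: zero_nnC)
  then show ?thesis by (simp add: binv_def)
qed

lemma mu_mod:
  assumes x: "pn x - pn x' \<in> \<nn>\<^sub>C" and y: "pn y - pn y' \<in> \<nn>\<^sub>C"
  shows "pr R (mu x y) = pr R (mu x' y')"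
proof -
  have e_in: "ex y H0 \<in> \<qq>" for y
    by (rule exp_ad_in[OF subspace_\<qq> H0_\<qq>]) (rule \<qq>_br[OF pn_in_\<qq>])
  have "ex y H0 - ex y' H0 \<in> \<nn>\<^sub>C"
    by (rule exp_ad_mod_nnC[OF pn_in_\<qq> pn_in_\<qq> y H0_\<qq> H0_\<qq>]) (simp add: zero_nnC)
  then have "ex x (ex y H0) - ex x' (ex y' H0) \<in> \<nn>\<^sub>C"
    by (rule exp_ad_mod_nnC[OF pn_in_\<qq> pn_in_\<qq> x e_in e_in])
  then have "mu x y - mu x' y' \<in> \<nn>\<^sub>C"
    unfolding mu_def by (intro binv_mod) simp
  then show ?thesis by (simp add: nnC_diff_iff mu_in)
qed

lemma Linv_mod:
  assumes "pn x - pn x' \<in> \<nn>\<^sub>C"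
  shows "pr R (Linv A x) = pr R (Linv A x')"
proof (rule Linv_linear_image[OF linear_pr])
  show "pr R (mu x (t *\<^sub>R A)) = pr R (mu x' (t *\<^sub>R A))" for t
    by (rule mu_mod[OF assms]) (simp add: zero_nnC)
  show "((\<lambda>t. pr R (mu x' (t *\<^sub>R A))) has_vector_derivative pr R (Linv A x')) (at 0)"
    by (rule linear_has_vector_derivative[OF linear_pr Linv_line])
qed

lemma Linv_nnC:
  assumes "A \<in> \<nn>\<^sub>C"
  shows "pr R (Linv A x) = 0"
proof (rule Linv_linear_image[OF linear_pr])
  show "pr R (mu x (t *\<^sub>R A)) = pr R (mu x 0)" for t
    using subspace_scale[OF subspace_nnC assms, of t] nnC_nn
    using assms pn_id[of A] by (intro mu_mod) (auto simp: zero_nnC pr_simps)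
qed (rule has_vector_derivative_const)

text \<open>If \<open>Linv A x\<close> lies in \<open>\<nn>\<^sub>C\<close>, moving along it changes
  the orbit map of \<open>H0\<close> only within \<open>\<nn>\<^sub>C\<close>. The derivative
  \<open>ex x (br A H0)\<close> is then in \<open>\<nn>\<^sub>C\<close>, and undoing the exponential
  and the bracket with \<open>H0\<close> recovers \<open>A\<close>.\<close>

lemma Linv_nnC_iff:
  assumes A: "A \<in> \<nn>"
  shows "pr R (Linv A x) = 0 \<longleftrightarrow> A \<in> \<nn>\<^sub>C"
proof
  assume "pr R (Linv A x) = 0"
  then have v: "Linv A x \<in> \<nn>\<^sub>C" by (simp add: nnC_iff Linv_in)
  let ?v = "Linv A x" and ?h = "\<lambda>x. ex x H0"
  have "?h (x + t *\<^sub>R ?v) - ?h x \<in> \<nn>\<^sub>C" for t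
    by (rule exp_ad_mod_nnC[OF pn_in_\<qq> pn_in_\<qq> _ H0_\<qq> H0_\<qq>])
      (simp_all add: pr_simps zero_nnC subspace_scale[OF subspace_nnC v])
  \<comment> \<open>Membership in \<open>\<nn>\<^sub>C\<close> is rewritten as an equation with
    \<open>pr C\<close>, which can be differentiated in \<open>t\<close>.\<close>
  then have z: "?h (x + t *\<^sub>R ?v) - ?h x - pr C (?h (x + t *\<^sub>R ?v) - ?h x) = 0" for t
    using sp_iff_pr[OF C_W] by (simp add: nnC_eq)
  have "((\<lambda>t. ?h (x + t *\<^sub>R ?v) - ?h x) has_vector_derivative Fd ?h x ?v) (at 0)"
    using has_vector_derivative_diff[OF Fd_poly_line[OF polynomial_ex] has_vector_derivative_const] by simp
  from has_vector_derivative_diff[OF this linear_has_vector_derivative[OF linear_pr[of C] this]]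
  have "((\<lambda>t::real. 0) has_vector_derivative (Fd ?h x ?v - pr C (Fd ?h x ?v))) (at 0)"
    by (simp only: z)
  then have "Fd ?h x ?v - pr C (Fd ?h x ?v) = 0"
    using vector_derivative_unique_at has_vector_derivative_const by blast
  then have "Fd ?h x ?v \<in> \<nn>\<^sub>C" unfolding nnC_eq using pr_in[of C "Fd ?h x ?v"] by simp
  then have "ex x (br A H0) \<in> \<nn>\<^sub>C" by (simp add: Fd_ex_Linv pn_id[OF A])
  then have "exp_ad (- pn x) (ex x (br A H0)) \<in> \<nn>\<^sub>C"
    by (rule exp_ad_in[OF subspace_nnC]) (rule \<qq>_nnC(1)[OF subspace_neg[OF subspace_\<qq> pn_in_\<qq>]])
  then have "br A H0 \<in> \<nn>\<^sub>C" by (simp add: exp_ad_uminus)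
  from Tinv_nnC[OF this] show "A \<in> \<nn>\<^sub>C" by (simp add: Tinv_br[OF A])
qed (rule Linv_nnC)

end

section \<open>The fields \<open>\<tau> Z\<close> and their projections\<close>

lemma linear_inj_image_eq:
  fixes f :: "'a::euclidean_space \<Rightarrow> 'a"
  assumes f: "linear f" "inj f" and V: "subspace V" "\<And>x. x \<in> V \<Longrightarrow> f x \<in> V"
  shows "f ` V = V"
proof (rule subspace_dim_equal)
  show "subspace (f ` V)" by (rule linear_subspace_image[OF f(1) V(1)])
  show "dim V \<le> dim (f ` V)" using dim_image_eq[OF f(1)] f(2) by (metis inj_on_subset order_refl top_greatest)
qed (use V in auto)

lemma representation_image:
  fixes f :: "'a::real_vector \<Rightarrow> 'b::real_vector"
  assumes f: "linear f" "inj_on f (span B)" and B: "independent B" and v: "v \<in> span B" and b: "b \<in> B"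
  shows "representation (f ` B) (f v) (f b) = representation B v b"
proof -
  have ind: "independent (f ` B)" by (rule linear_independent_injective_image[OF f(1) B f(2)])
  have in_span: "f w \<in> span (f ` B)" if "w \<in> span B" for w
    using that linear_span_image[OF f(1), of B] by blast
  have "v \<in> span B \<and> representation (f ` B) (f v) (f b) = representation B v b"
    using v
  proof (induction rule: span_induct_alt)
    case base
    show ?case by (simp add: linear_0[OF f(1)] representation_zero span_zero)
  next
    case (step c x y)
    have xs: "x \<in> span B" "c *\<^sub>R x \<in> span B" using step(1) by (auto intro: span_base span_scale)
    have "representation (f ` B) (f x) (f b) = representation B x b"
      using inj_onD[OF f(2)] span_base[OF b] xs(1)
      by (auto simp: representation_basis[OF B step(1)] representation_basis[OF ind imageI[OF step(1)]])
    then show ?case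
      using step(2) in_span[OF xs(1)] in_span[OF xs(2)] in_span[of y] xs span_add[OF xs(2), of y]
      by (simp add: linear_add[OF f(1)] linear_cmul[OF f(1)] representation_add[OF ind] representation_add[OF B]
          representation_scale[OF ind] representation_scale[OF B])
  qed
  then show ?thesis ..
qed

section \<open>Uniqueness of the factorization through \<open>N\<close> and \<open>P\<close>\<close>

context hessenberg_setting
begin

lemma theta_neg: "X \<in> rsum neg \<Longrightarrow> \<theta> X \<in> \<nn>"
  unfolding nn_eq
  by (erule sp_induct)
    (auto simp: neg_def pos_iff intro!: sp_base[OF _ theta_root_space] subspace_preimage[OF theta(1) subspace_sp] W_minus)

lemma theta_nn: "X \<in> \<nn> \<Longrightarrow> \<theta> X \<in> rsum neg"
  unfolding nn_eq
  by (erule sp_induct)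
    (auto simp: neg_def pos_iff intro!: sp_base[OF _ theta_root_space] subspace_preimage[OF theta(1) subspace_sp] W_minus)

lemma sp_zero: "rsum {0} = root_space 0"
  by (simp add: sum_root_spaces_def span_eq_iff[THEN iffD2] subspace_root_space)

lemma theta_nn_eq: "\<theta> ` \<nn> = rsum neg"
proof
  show "rsum neg \<subseteq> \<theta> ` \<nn>"
    using theta_neg theta(2) by (metis imageI subsetI)
qed (use theta_nn in auto)

lemma lie_auto_K: "k \<in> connected_subgroup h \<Longrightarrow> lie_auto k"
proof (induction rule: connected_subgroup.induct)
  case one
  show ?case by (simp add: lie_auto_def id_def linear_id[unfolded id_def] bij_id[unfolded id_def])
next
  case (mult X g)
  show ?case by (rule lie_auto_comp[OF lie_auto_exp_ad mult(3)])
qed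

lemma neg_br: "X \<in> rsum pp \<Longrightarrow> Y \<in> rsum neg \<Longrightarrow> br X Y \<in> rsum neg"
  by (rule br_sp[of pp neg]) (auto simp: neg_def W_def)

lemma \<aa>_pp: "\<aa> \<subseteq> rsum pp"
  using \<aa>_root_space_0 sp_base[of 0 pp] by blast

text \<open>Of the three factors of \<open>P\<close> only their joint effect is retained: an element
  of \<open>P\<close> preserves the opposite nilradical and fixes \<open>H0\<close> modulo it.
  Uniqueness of the factorization rests on this.\<close>

lemma P_props:
  assumes "p \<in> P"
  shows "lie_auto p" "\<And>Y. Y \<in> rsum neg \<Longrightarrow> p Y \<in> rsum neg" "p H0 - H0 \<in> rsum neg"
proof -
  obtain k a u where p: "p = k \<circ> a \<circ> u" and k: "k \<in> M" and "a \<in> exp_ad ` \<aa>" "u \<in> exp_ad ` \<theta> ` \<nn>"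
    using assms unfolding P_def by blast
  then obtain H U where H: "H \<in> \<aa>" "a = exp_ad H" and U: "U \<in> rsum neg" "u = exp_ad U"
    by (auto simp: theta_nn_eq)
  have kl: "lie_auto k" using k lie_auto_K by (auto simp: M_def K_def)
  then show "lie_auto p" unfolding p H U by (intro lie_auto_comp lie_auto_exp_ad)
  have lk: "linear k" "\<And>X Y. k (br X Y) = br (k X) (k Y)" using kl by (auto simp: lie_auto_def)
  have kH: "k H = H" if "H \<in> \<aa>" for H using k that by (simp add: M_def)
  have kn: "k Y \<in> rsum neg" if "Y \<in> rsum neg" for Y
    using that
  proof (rule sp_induct)
    show "subspace {x. k x \<in> rsum neg}" by (rule subspace_preimage[OF lk(1) subspace_sp])
    fix \<alpha> X assume a: "\<alpha> \<in> neg" and X: "X \<in> root_space \<alpha>"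
    have "k X \<in> root_space \<alpha>"
      using X kH lk by (auto simp: root_space_def) (metis linear_cmul)
    then show "k X \<in> rsum neg" using a by (rule sp_base[rotated])
  qed
  have Hpp: "H \<in> rsum pp" using H \<aa>_pp by blast
  have Upp: "U \<in> rsum pp" using U sp_mono[of neg pp] by blast
  have an: "a Y \<in> rsum neg" if "Y \<in> rsum neg" for Y
    unfolding H(2) by (rule exp_ad_in[OF subspace_sp that neg_br[OF Hpp]])
  have un: "u Y \<in> rsum neg" if "Y \<in> rsum neg" for Y
    unfolding U(2) by (rule exp_ad_in[OF subspace_sp that neg_br[OF Upp]])
  show "p Y \<in> rsum neg" if "Y \<in> rsum neg" for Y
    unfolding p o_def by (rule kn[OF an[OF un[OF that]]])
  have "H0 \<in> rsum pp" using H0(1) \<aa>_pp by blast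
  then have "br U H0 \<in> rsum neg"
    using neg_br[OF _ U(1)] br_swap[of U H0] subspace_neg[OF subspace_sp] by metis
  then have 1: "u H0 - H0 \<in> rsum neg"
    unfolding U(2) by (rule exp_ad_diff_in[OF subspace_sp _ neg_br[OF Upp]])
  have aH: "a H0 = H0" unfolding H(2) by (rule exp_ad_fixed) (rule \<aa>_props(2)[OF H(1) H0(1)])
  have "k (a (u H0 - H0)) = p H0 - H0"
    using linear_diff[OF lk(1)] by (simp add: p H(2) exp_ad_simps aH[unfolded H(2)] kH[OF H0(1)])
  then show "p H0 - H0 \<in> rsum neg" using kn[OF an[OF 1]] by simp
qed

text \<open>A vector \<open>v\<close>, congruent to \<open>H0\<close> modulo the opposite
  nilradical, is chosen with \<open>p v = H0\<close>. Then \<open>p' v - H0\<close> lies both in the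
  opposite nilradical and in \<open>\<nn>\<close>, so it vanishes, and \<open>x\<close> and
  \<open>x'\<close> act alike on \<open>H0\<close>.\<close>

lemma NP_unique:
  assumes x: "x \<in> \<nn>" "x' \<in> \<nn>" and p: "p \<in> P" "p' \<in> P" and eq: "exp_ad x \<circ> p = exp_ad x' \<circ> p'"
  shows "x = x'"
proof -
  note pp = P_props[OF p(1)] and pp' = P_props[OF p(2)]
  have l: "linear p" "linear p'" "inj p" using pp(1) pp'(1) by (auto simp: lie_auto_def bij_is_inj)
  have "p ` rsum neg = rsum neg"
    by (rule linear_inj_image_eq[OF l(1,3) subspace_sp pp(2)])
  then obtain Y where Y: "Y \<in> rsum neg" "p Y = - (p H0 - H0)"
    using subspace_neg[OF subspace_sp pp(3)] by (metis imageE)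
  define v where "v = H0 + Y"
  have "p v = H0" using Y(2) by (simp add: v_def linear_add[OF l(1)])
  then have e: "exp_ad x H0 = exp_ad x' (p' v)" using fun_cong[OF eq, of v] by simp
  have 1: "p' v - H0 \<in> rsum neg"
    using subspace_add[OF subspace_sp pp'(3) pp'(2)[OF Y(1)]] by (simp add: v_def linear_add[OF l(2)] algebra_simps)
  have mx: "- x' \<in> \<nn>" by (rule subspace_neg[OF subspace_nn x(2)])
  have "p' v = exp_ad (- x') (exp_ad x H0)" by (simp add: e exp_ad_uminus)
  then have "p' v - H0 = (exp_ad (- x') (exp_ad x H0) - exp_ad x H0) + (exp_ad x H0 - H0)" by simp
  also have "\<dots> \<in> \<nn>"
    by (rule subspace_add[OF subspace_nn exp_ad_H0_in[OF mx exp_ad_Fil[OF x(1) H0_Fil]] exp_ad_H0_in[OF x(1) H0_Fil]])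
  finally have 2: "p' v - H0 \<in> \<nn>" .
  have "neg \<inter> pos = {}" by (auto simp: neg_def pos_iff)
  then have "pn (p' v - H0) = 0" using pr_zero[OF 1 neg_W] by simp
  then have "p' v = H0" using pn_id[OF 2] by simp
  with e have e0: "exp_ad x H0 = exp_ad x' H0" by (simp only:)
  have "x = binv (exp_ad x H0 - H0)" by (rule binv_left[OF x(1), symmetric])
  also have "\<dots> = x'" unfolding e0 by (rule binv_left[OF x(2)])
  finally show "x = x'" .
qed

lemma N_part_eq:
  assumes "x \<in> \<nn>" "p \<in> P"
  shows "N_part (exp_ad x \<circ> p) = exp_ad x"
  unfolding N_part_def
proof (rule the_equality)
  show "exp_ad x \<in> N \<and> (\<exists>p'\<in>P. exp_ad x \<circ> p = exp_ad x \<circ> p')" using assms by (auto simp: N_def)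
next
  fix n assume "n \<in> N \<and> (\<exists>p'\<in>P. exp_ad x \<circ> p = n \<circ> p')"
  then obtain x' p' where "x' \<in> \<nn>" "n = exp_ad x'" "p' \<in> P" "exp_ad x \<circ> p = exp_ad x' \<circ> p'"
    unfolding N_def by blast
  then show "n = exp_ad x" using NP_unique[OF assms(1) _ assms(2)] by blast
qed

lemma P_I:
  assumes Y: "Y \<in> \<mm>" and H: "H \<in> \<aa>" and U: "U \<in> rsum neg"
  shows "exp_ad Y \<circ> exp_ad H \<circ> exp_ad U \<in> P"
proof -
  have "exp_ad Y \<circ> id \<in> K"
    unfolding K_def using Y by (intro connected_subgroup.intros) (simp add: \<mm>_def)
  moreover have "exp_ad Y H' = H'" if "H' \<in> \<aa>" for H'
    using Y that br_swap[of Y H'] by (intro exp_ad_fixed) (simp add: \<mm>_def)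
  ultimately have "exp_ad Y \<in> M" by (simp add: M_def)
  moreover have "exp_ad U \<in> exp_ad ` \<theta> ` \<nn>" using U by (simp add: theta_nn_eq)
  ultimately show ?thesis using H unfolding P_def by blast
qed

definition iv :: "'g \<Rightarrow> 'g \<Rightarrow> 'g" where "iv x Z = exp_ad (pn (- x)) Z"

text \<open>The coefficients of \<open>\<tau> Z\<close> in the left-invariant frame, as an element of \<open>\<nn>\<close>.\<close>
definition tc :: "'g \<Rightarrow> 'g \<Rightarrow> 'g" where "tc Z x = - pn (iv x Z)"

definition tauN :: "'g \<Rightarrow> 'g \<Rightarrow> 'g" where "tauN Z x = Linv (tc Z x) x"

lemma tau_eq:
  assumes x: "x \<in> \<nn>"
  shows "\<tau> Z x = tauN Z x"
proof -
  define w where "w = - iv x Z"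
  \<comment> \<open>The \<open>\<theta>\<close>-even and \<open>\<theta>\<close>-odd parts of the
    weight 0 component, which lie in \<open>\<mm>\<close> and \<open>\<aa>\<close>. Together with
    the positive and negative parts they add up to the identity, as the local factorization
    demands.\<close>
  define p2 where "p2 v = (1/2) *\<^sub>R (pr {0} v + \<theta> (pr {0} v))" for v
  define p3 where "p3 v = (1/2) *\<^sub>R (pr {0} v - \<theta> (pr {0} v))" for v
  have sum: "pn v + p2 v + p3 v + pr neg v = v" for v
  proof -
    have "p2 v + p3 v = pr {0} v"
      by (simp add: p2_def p3_def scaleR_add_right[symmetric] scaleR_2[symmetric])
    moreover have "pr {0} v + pr neg v = pr pp v"
      using pr_add_disjoint[of "{0}" neg v] by (simp add: neg_def Un_commute)
    moreover have "pn v + p2 v + p3 v + pr neg v = pn v + ((p2 v + p3 v) + pr neg v)"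
      by (simp only: add.assoc)
    ultimately have "pn v + p2 v + p3 v + pr neg v = pn v + pr pp v" by (simp only:)
    then show ?thesis by (simp only: pr_pos_pp)
  qed
  have l2: "linear p2" "linear p3"
    unfolding p2_def p3_def by (auto intro!: linearI simp: pr_simps theta_simps algebra_simps)
  obtain v where v: "(v has_vector_derivative w) (at 0)" "v 0 = 0"
    and ev: "\<forall>\<^sub>F t in at (0::real). exp_ad (t *\<^sub>R w) =
       exp_ad (pn (v t)) \<circ> (exp_ad (p2 (v t)) \<circ> exp_ad (p3 (v t)) \<circ> exp_ad (pr neg (v t)))"
    using exp_ad_local_factorization[OF linear_pr l2 linear_pr sum, of w] by blast
  have inP: "exp_ad (p2 v) \<circ> exp_ad (p3 v) \<circ> exp_ad (pr neg v) \<in> P" for v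
  proof (rule P_I[OF _ _ pr_in])
    have "pr {0} v \<in> root_space 0" using pr_in[of "{0}" v] by (simp add: sp_zero)
    from root_space_0_decomp[OF this] show "p2 v \<in> \<mm>" "p3 v \<in> \<aa>" by (simp_all add: p2_def p3_def)
  qed
  let ?f = "\<lambda>t. log_N (N_part (exp_ad (- t *\<^sub>R Z) \<circ> exp_ad x))"
  have key: "?f t = mu x (v t)"
    if "exp_ad (t *\<^sub>R w) = exp_ad (pn (v t)) \<circ> (exp_ad (p2 (v t)) \<circ> exp_ad (p3 (v t)) \<circ> exp_ad (pr neg (v t)))" for t
  proof -
    have xw: "exp_ad x (t *\<^sub>R w) = - t *\<^sub>R Z"
      by (simp add: w_def iv_def pr_simps pn_id[OF x] exp_ad_simps exp_ad_uminus')
    have "exp_ad (- t *\<^sub>R Z) (exp_ad x Y) = exp_ad x (exp_ad (t *\<^sub>R w) Y)" for Y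
      unfolding lie_auto_exp_ad_conj[OF lie_auto_exp_ad, of x "t *\<^sub>R w"] xw ..
    then have "exp_ad (- t *\<^sub>R Z) \<circ> exp_ad x = exp_ad x \<circ> exp_ad (t *\<^sub>R w)" by (simp add: fun_eq_iff)
    also have "\<dots> = exp_ad (mu x (v t)) \<circ> (exp_ad (p2 (v t)) \<circ> exp_ad (p3 (v t)) \<circ> exp_ad (pr neg (v t)))"
      unfolding that by (simp add: fun_eq_iff exp_ad_mu pn_id[OF x])
    finally show ?thesis by (simp only: N_part_eq[OF mu_in inP] log_N_exp[OF mu_in])
  qed
  \<comment> \<open>\<open>ev\<close> says nothing at t = 0 itself, where transferring the
    derivative also needs equal values.\<close>
  have "exp_ad (0 *\<^sub>R w) = exp_ad (pn (v 0)) \<circ> (exp_ad (p2 (v 0)) \<circ> exp_ad (p3 (v 0)) \<circ> exp_ad (pr neg (v 0)))"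
    by (simp add: v(2) pr_simps p2_def p3_def theta_simps)
  then have f0: "?f 0 = mu x (v 0)" by (rule key)
  have fe: "\<forall>\<^sub>F t in at (0::real). mu x (v t) = ?f t"
    using ev by eventually_elim (rule key[symmetric])
  have "((\<lambda>t. mu x (v t)) has_vector_derivative Linv w x) (at 0)" by (rule Linv_curve[OF v])
  then have "(?f has_vector_derivative Linv w x) (at 0)"
    unfolding has_vector_derivative_def
    by (rule has_derivative_transform_eventually[OF _ fe]) (use f0 in auto)
  then have "\<tau> Z x = Linv w x" unfolding \<tau>_def by (rule vector_derivative_at)
  also have "\<dots> = Linv (pn w) x" by (simp add: Linv_A_pn)
  finally show ?thesis by (simp add: tauN_def tc_def w_def pr_simps)
qed

section \<open>The frame, the coefficients and \<open>\<nu>\<close> in terms of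
  \<open>Linv\<close>\<close>

lemma X_field_eq:
  assumes "x \<in> \<nn>" "\<alpha> \<in> pos" "j \<in> {1..m \<alpha>}"
  shows "X_field \<alpha> j x = Linv (E \<alpha> j) x"
proof -
  have "t *\<^sub>R E \<alpha> j \<in> \<nn>" for t
    using sp_base[OF assms(2) E_root[OF assms(2,3)]] by (simp add: nn_eq subspace_scale[OF subspace_sp])
  then have "X_field \<alpha> j x = vector_derivative (\<lambda>t. mu x (t *\<^sub>R E \<alpha> j)) (at 0)"
    by (simp add: X_field_def log_N_mult[OF assms(1)])
  then show ?thesis using Linv_line by (simp add: vector_derivative_at)
qed

lemma S_nn: "x \<in> S \<Longrightarrow> x \<in> \<nn>" by (simp add: S_def)

lemma X_bar_eq:
  assumes "\<alpha> \<in> pos" "j \<in> {1..m \<alpha>}"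
  shows "X_bar \<alpha> j x = (if x \<in> S then pr R (Linv (E \<alpha> j) x) else 0)"
proof (cases "x \<in> S")
  case True
  have "X_bar \<alpha> j x = (\<Sum>\<gamma>\<in>R. \<Sum>k\<in>{1..m \<gamma>}. rep (Linv (E \<alpha> j) x) (E \<gamma> k) *\<^sub>R E \<gamma> k)"
    using True by (simp add: X_bar_def X_field_eq[OF S_nn assms] coord_eq_rep[OF Linv_in])
  then show ?thesis using True by (simp only: pr_E_expansion[OF R_pos] if_True)
qed (simp add: X_bar_def)

text \<open>At fixed \<open>x\<close> the map \<open>A \<mapsto> Linv A x\<close> is linear,
  injective on \<open>\<nn>\<close> and carries the basis \<open>E\<close> to the frame, so
  coefficients in the frame are coordinates of \<open>tc Z x\<close>.\<close>

lemma tau_coeff_eq: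
  assumes x: "x \<in> \<nn>" and g: "\<gamma> \<in> pos" "j \<in> {1..m \<gamma>}"
  shows "\<tau>_coeff Z \<gamma> j x = rep (tc Z x) (E \<gamma> j)"
proof -
  let ?B = "\<Union>\<alpha>\<in>pos. E \<alpha> ` {1..m \<alpha>}" and ?f = "\<lambda>A. Linv A x"
  have B: "?B = (\<Union>\<alpha>\<in>pos. bas \<alpha>)" by (rule bas_pos)
  have sB: "span ?B = \<nn>" unfolding B nn_eq sp_eq ..
  have BB: "?B \<subseteq> Bs" unfolding B Bs_def using pos_W by blast
  have ind: "independent ?B" using independent_Bs BB independent_mono by blast
  have inj: "inj_on ?f (span ?B)"
    unfolding sB
  proof (rule inj_onI)
    fix A A' assume "A \<in> \<nn>" "A' \<in> \<nn>" "Linv A x = Linv A' x"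
    then have "A - A' = 0"
      using Linv_eq_0_imp[OF subspace_diff[OF subspace_nn]] by (simp add: linear_diff[OF linear_Linv])
    then show "A = A'" by simp
  qed
  have "(\<Union>\<alpha>\<in>pos. (\<lambda>k. X_field \<alpha> k x) ` {1..m \<alpha>}) = ?f ` ?B"
    unfolding image_UN image_image by (intro SUP_cong image_cong refl X_field_eq[OF x]) auto
  moreover have mem: "E \<gamma> j \<in> ?B" using g by blast
  moreover have tn: "tc Z x \<in> \<nn>" unfolding tc_def by (rule subspace_neg[OF subspace_nn pn_in])
  ultimately have "\<tau>_coeff Z \<gamma> j x = representation ?B (tc Z x) (E \<gamma> j)"
    unfolding \<tau>_coeff_def tau_eq[OF x] tauN_def X_field_eq[OF x g]
    using representation_image[OF linear_Linv inj ind _ mem, of "tc Z x"] sB by simp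
  also have "\<dots> = rep (tc Z x) (E \<gamma> j)"
    using representation_extend[OF independent_Bs _ BB, of "tc Z x"] tn sB by simp
  finally show ?thesis .
qed

lemma tc_in: "tc Z x \<in> \<nn>" unfolding tc_def by (rule subspace_neg[OF subspace_nn pn_in])

lemma Linv_mod_A:
  assumes "A - A' \<in> \<nn>\<^sub>C"
  shows "pr R (Linv A x) = pr R (Linv A' x)"
  using Linv_nnC[OF assms, of x] by (simp add: linear_diff[OF linear_Linv] pr_simps)

text \<open>Cutting the sum down to \<open>R\<close> drops the part of \<open>tc Z x\<close> in
  \<open>\<nn>\<^sub>C\<close>, whose left-invariant field projects to 0. The truncated combination
  is therefore the projection of the whole field.\<close>

lemma nu_eq: "\<nu> Z x = (if x \<in> S then pr R (tauN Z x) else 0)"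
proof (cases "x \<in> S")
  case True
  have "\<nu> Z x = (\<Sum>\<gamma>\<in>R. \<Sum>j\<in>{1..m \<gamma>}. rep (tc Z x) (E \<gamma> j) *\<^sub>R pr R (Linv (E \<gamma> j) x))"
    unfolding \<nu>_def if_P[OF True]
  proof (intro sum.cong refl)
    fix \<gamma> j assume "\<gamma> \<in> R" "j \<in> {1..m \<gamma>}"
    then show "\<tau>_coeff Z \<gamma> j x *\<^sub>R X_bar \<gamma> j x = rep (tc Z x) (E \<gamma> j) *\<^sub>R pr R (Linv (E \<gamma> j) x)"
      using R_pos True tau_coeff_eq[OF S_nn[OF True], of \<gamma> j] X_bar_eq[of \<gamma> j x] by auto
  qed
  also have "\<dots> = pr R (Linv (\<Sum>\<gamma>\<in>R. \<Sum>j\<in>{1..m \<gamma>}. rep (tc Z x) (E \<gamma> j) *\<^sub>R E \<gamma> j) x)"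
    by (simp only: linear_sum[OF linear_Linv] linear_cmul[OF linear_Linv] linear_sum[OF linear_pr] linear_cmul[OF linear_pr])
  also have "\<dots> = pr R (Linv (pr R (tc Z x)) x)" by (simp only: pr_E_expansion[OF R_pos])
  also have "\<dots> = pr R (Linv (tc Z x) x)"
  proof (rule Linv_mod_A)
    have "pr R (tc Z x) - tc Z x = - pr C (tc Z x)" using pr_C_R[OF tc_in, of Z x] by (simp add: algebra_simps)
    then show "pr R (tc Z x) - tc Z x \<in> \<nn>\<^sub>C"
      using pr_in[of C "tc Z x"] subspace_neg[OF subspace_nnC] by (simp add: nnC_eq)
  qed
  finally show ?thesis using True by (simp add: tauN_def)
qed (simp add: \<nu>_def)

text \<open>Fields that can be pushed forward to the quotient of \<open>\<nn>\<close> by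
  \<open>\<nn>\<^sub>C\<close>. They need not be tangent to \<open>S\<close>, so \<open>desc\<close>
  is a push-forward and not a restriction.\<close>

definition projectable :: "('g \<Rightarrow> 'g) \<Rightarrow> bool" where
  "projectable F \<longleftrightarrow> polynomial_function F \<and> (\<forall>x. F x \<in> \<nn>) \<and>
     (\<forall>x x'. pn x - pn x' \<in> \<nn>\<^sub>C \<longrightarrow> pr R (F x) = pr R (F x'))"

definition desc :: "('g \<Rightarrow> 'g) \<Rightarrow> 'g \<Rightarrow> 'g" where
  "desc F x = (if x \<in> S then pr R (F x) else 0)"

lemma subspace_S: "subspace S" by (simp add: S_eq subspace_sp)

lemma pr_R_S: "pr R x \<in> S" by (simp add: S_eq pr_in)

lemma desc_vector_field: "projectable F \<Longrightarrow> desc F \<in> vector_fields S"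
  unfolding vector_fields_def
  by (auto simp: projectable_def desc_def pr_R_S
      intro!: smooth_on_polynomial[OF subspace_S polynomial_function_linear[OF linear_pr]])

text \<open>Related vector fields have related brackets; here the relation is the linear projection
  \<open>pr R\<close>.\<close>

lemma desc_bracket:
  assumes F: "projectable F" and G: "projectable G" and x: "x \<in> S"
  shows "vf_bracket S (desc F) (desc G) x = pr R (Fd G x (F x) - Fd F x (G x))"
proof -
  have half: "vector_derivative (\<lambda>t. desc G (x + t *\<^sub>R desc F x)) (at 0) = pr R (Fd G x (F x))"
    if F: "projectable F" and G: "projectable G" for F G
  proof -
    have pG: "polynomial_function G" using G by (simp add: projectable_def)
    have bl: "bounded_linear (pr R)" by (rule linear_imp_bounded_linear[OF linear_pr])
    have d: "((\<lambda>t. pr R (G (x + t *\<^sub>R v))) has_vector_derivative pr R (Fd G x v)) (at 0)" for v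
      by (rule bounded_linear.has_vector_derivative[OF bl Fd_poly_line[OF pG]])
    have "x + t *\<^sub>R pr R (F x) \<in> S" for t
      by (intro subspace_add[OF subspace_S x] subspace_scale[OF subspace_S pr_R_S])
    then have "vector_derivative (\<lambda>t. desc G (x + t *\<^sub>R desc F x)) (at 0) = pr R (Fd G x (pr R (F x)))"
      using x vector_derivative_at[OF d[of "pr R (F x)"]] by (simp add: desc_def)
    \<comment> \<open>The component of \<open>F x\<close> in \<open>\<nn>\<^sub>C\<close> may be
      restored, since \<open>pr R\<close> of \<open>G\<close> is constant in that direction.\<close>
    also have "\<dots> = pr R (Fd G x (F x))"
    proof -
      have c: "pr C (F x) \<in> \<nn>\<^sub>C" by (simp add: nnC_eq pr_in)
      have "pr R (G (x + t *\<^sub>R pr C (F x))) = pr R (G x)" for t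
      proof -
        have "pn (x + t *\<^sub>R pr C (F x)) - pn x = t *\<^sub>R pr C (F x)"
          using c nnC_nn by (simp add: pr_simps pn_id subset_iff)
        then show ?thesis using G subspace_scale[OF subspace_nnC c, of t] unfolding projectable_def by metis
      qed
      then have "((\<lambda>t::real. pr R (G x)) has_vector_derivative pr R (Fd G x (pr C (F x)))) (at 0)"
        using d[of "pr C (F x)"] by simp
      then have "pr R (Fd G x (pr C (F x))) = 0"
        using vector_derivative_unique_at has_vector_derivative_const by blast
      moreover have "F x = pr R (F x) + pr C (F x)" using F pr_C_R by (simp add: projectable_def)
      ultimately show ?thesis
        by (metis (no_types, lifting) Fd_linear[OF pG] linear_add pr_simps(1) add_0_right)
    qed
    finally show ?thesis .
  qed
  show ?thesis using x half[OF F G] half[OF G F] by (simp add: vf_bracket_def pr_simps)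
qed

section \<open>Projectability and brackets of the fields \<open>tauN Z\<close>\<close>

lemma polynomial_iv: "polynomial_function (\<lambda>x. iv x Z)"
  unfolding iv_def by (intro polynomial_exp_ad polynomial_function_minus polynomial_function_id polynomial_function_const)

lemma polynomial_tc: "polynomial_function (tc Z)"
  unfolding tc_def[abs_def] by (intro polynomial_function_minus polynomial_function_linear[OF linear_pr] polynomial_iv)

lemma iv_pn: "iv (pn x) Z = iv x Z" by (simp add: iv_def pr_simps)

lemma linear_iv: "linear (iv x)" unfolding iv_def by (rule linear_exp_ad)

lemma iv_br: "iv x (br Y Z) = br (iv x Y) (iv x Z)" by (simp add: iv_def exp_ad_br)

lemma iv_mu: "iv (mu x y) Z = iv y (iv x Z)"
proof -
  have "exp_ad (mu x y) (iv y (iv x Z)) = exp_ad (pn x) (exp_ad (pn y) (exp_ad (- pn y) (exp_ad (- pn x) Z)))"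
    by (simp add: exp_ad_mu iv_def pr_simps)
  also have "\<dots> = Z" by (simp add: exp_ad_uminus')
  finally have "exp_ad (- mu x y) Z = iv y (iv x Z)" by (metis exp_ad_uminus)
  then show ?thesis by (simp add: iv_def pr_simps pn_id[OF mu_in])
qed

lemma Fd_tc:
  assumes A: "A \<in> \<nn>"
  shows "Fd (tc Z) x (Linv A x) = pn (br A (iv x Z))"
proof (rule Fd_along_Linv[OF polynomial_tc])
  show "tc Z (pn x) = tc Z x" for x by (simp add: tc_def iv_pn)
  have e: "tc Z (mu x (t *\<^sub>R A)) = - pn (exp_ad (t *\<^sub>R (- A)) (iv x Z))" for t
    by (simp add: tc_def iv_mu) (simp add: iv_def pr_simps pn_id[OF A])
  have "linear (\<lambda>y. - pn y)" by (rule linear_compose_neg[OF linear_pr])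
  from linear_has_vector_derivative[OF this exp_ad_line[of "- A" "iv x Z"]]
  show "((\<lambda>t. tc Z (mu x (t *\<^sub>R A))) has_vector_derivative pn (br A (iv x Z))) (at 0)"
    unfolding e by (simp add: br_simps pr_simps)
qed

lemma iv_mod:
  assumes "Z \<in> \<qq>" "pn x - pn x' \<in> \<nn>\<^sub>C"
  shows "iv x Z - iv x' Z \<in> \<nn>\<^sub>C"
  unfolding iv_def
proof (rule exp_ad_mod_nnC[OF pn_in_\<qq> pn_in_\<qq> _ assms(1) assms(1)])
  show "pn (- x) - pn (- x') \<in> \<nn>\<^sub>C"
    using subspace_neg[OF subspace_nnC assms(2)] by (simp add: pr_simps)
qed (simp add: zero_nnC)

lemma tauN_projectable:
  assumes Z: "Z \<in> \<qq>"
  shows "projectable (tauN Z)"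
  unfolding projectable_def
proof (intro conjI allI impI)
  show "polynomial_function (tauN Z)" unfolding tauN_def[abs_def] by (rule polynomial_Linv[OF polynomial_tc])
  show "tauN Z x \<in> \<nn>" for x by (simp add: tauN_def Linv_in)
  fix x x' assume xx: "pn x - pn x' \<in> \<nn>\<^sub>C"
  have i: "iv x Z - iv x' Z \<in> \<nn>\<^sub>C" by (rule iv_mod[OF Z xx])
  have "tc Z x - tc Z x' = - pn (iv x Z - iv x' Z)" by (simp add: tc_def pr_simps)
  also have "\<dots> \<in> \<nn>\<^sub>C" using i nnC_nn subspace_neg[OF subspace_nnC i] by (simp add: pn_id subset_iff)
  finally have "pr R (Linv (tc Z x) x) = pr R (Linv (tc Z x') x)" by (rule Linv_mod_A)
  then show "pr R (tauN Z x) = pr R (tauN Z x')" using Linv_mod[OF xx] by (simp add: tauN_def)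
qed

lemma Linv_projectable: "projectable (Linv A)"
  unfolding projectable_def
  using polynomial_Linv[OF polynomial_function_const[of A]] Linv_mod Linv_in by auto

lemma nu_desc: "\<nu> Z = desc (tauN Z)" by (rule ext) (simp add: nu_eq desc_def)

lemma pp_br: "X \<in> rsum pp \<Longrightarrow> Y \<in> rsum pp \<Longrightarrow> br X Y \<in> rsum pp"
  by (rule br_sp[of pp pp]) (auto simp: neg_def W_def)

lemma pp_W: "pp \<subseteq> W" by (auto simp: neg_def W_def)

lemma pn_pp: "X \<in> rsum pp \<Longrightarrow> pn X = 0"
  by (rule pr_zero[OF _ pp_W]) (auto simp: neg_def pos_iff)

text \<open>The root spaces of the weights outside \<open>pos\<close> span a subalgebra, so the
  bracket of the two non-positive parts has no component in \<open>\<nn>\<close>. The left side is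
  the coefficient that \<open>Linv_bracket\<close> produces for two fields \<open>tauN\<close>: the
  bracket of their coefficients and the mutual derivatives.\<close>

lemma pn_br_split:
  "br (pn w) (pn w') + pn (br (- pn w) w') - pn (br (- pn w') w) = - pn (br w w')"
proof -
  define u u' where "u = pr pp w" and "u' = pr pp w'"
  have w: "w = pn w + u" "w' = pn w' + u'" using pr_pos_pp[of w] pr_pos_pp[of w'] by (simp_all add: u_def u'_def)
  have 0: "pn (br u u') = 0" unfolding u_def u'_def by (intro pn_pp pp_br pr_in)
  have 1: "pn (br (pn w) (pn w')) = br (pn w) (pn w')" by (intro pn_id nn_br pn_in)
  have a: "br w w' = br (pn w) (pn w') + br (pn w) u' + br u (pn w') + br u u'"
    by (subst (1) w(1), subst (1) w(2)) (simp add: br_simps)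
  have b: "br (- pn w) w' = - br (pn w) (pn w') - br (pn w) u'"
    by (subst w(2)) (simp add: br_simps)
  have c: "br (- pn w') w = br (pn w) (pn w') + br u (pn w')"
  proof -
    have "br (- pn w') (pn w + u) = br (pn w) (pn w') + br u (pn w')"
      by (simp add: br_simps br_swap[of "pn w'"])
    then show ?thesis using w(1) by simp
  qed
  show ?thesis unfolding a b c by (simp add: pr_simps 0 1)
qed

lemma tauN_bracket:
  "Fd (tauN Z') x (tauN Z x) - Fd (tauN Z) x (tauN Z' x) = tauN (br Z Z') x"
proof -
  have "Fd (tauN Z') x (tauN Z x) - Fd (tauN Z) x (tauN Z' x)
     = Linv (br (tc Z x) (tc Z' x) + Fd (tc Z') x (Linv (tc Z x) x) - Fd (tc Z) x (Linv (tc Z' x) x)) x"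
    unfolding tauN_def[abs_def] by (rule Linv_bracket[OF polynomial_tc tc_in polynomial_tc tc_in])
  also have "br (tc Z x) (tc Z' x) + Fd (tc Z') x (Linv (tc Z x) x) - Fd (tc Z) x (Linv (tc Z' x) x)
     = - pn (br (iv x Z) (iv x Z'))"
    unfolding Fd_tc[OF tc_in] unfolding tc_def using pn_br_split[of "iv x Z" "iv x Z'"] by (simp add: br_simps)
  also have "\<dots> = tc (br Z Z') x" by (simp add: tc_def iv_br)
  finally show ?thesis by (simp only: tauN_def[of "br Z Z'"])
qed

lemma nu_bracket:
  assumes "Z \<in> \<qq>" "Z' \<in> \<qq>"
  shows "\<nu> (br Z Z') = vf_bracket S (\<nu> Z) (\<nu> Z')"
proof
  fix x
  show "\<nu> (br Z Z') x = vf_bracket S (\<nu> Z) (\<nu> Z') x"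
  proof (cases "x \<in> S")
    case True
    show ?thesis
      unfolding nu_desc desc_bracket[OF tauN_projectable[OF assms(1)] tauN_projectable[OF assms(2)] True] tauN_bracket
      using True by (simp add: desc_def)
  qed (simp add: vf_bracket_def nu_eq)
qed

lemma linear_tauN: "linear (\<lambda>Z. tauN Z x)"
  unfolding tauN_def tc_def
  by (auto intro!: linearI simp: linear_add[OF linear_iv] linear_cmul[OF linear_iv] pr_simps
     linear_add[OF linear_Linv] linear_cmul[OF linear_Linv] linear_neg[OF linear_Linv])

lemma nu_add: "\<nu> (Z + Z') x = \<nu> Z x + \<nu> Z' x" and nu_scale: "\<nu> (c *\<^sub>R Z) x = c *\<^sub>R \<nu> Z x"
  by (simp_all add: nu_eq linear_add[OF linear_tauN] linear_cmul[OF linear_tauN] pr_simps)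

lemma nu_lie_hom: "\<nu> \<in> lie_hom (sub_lie br \<qq>) (vf_lie S)"
  unfolding lie_hom_def sub_lie_def vf_lie_def
  by (auto simp: nu_add nu_scale nu_bracket nu_desc desc_vector_field tauN_projectable fun_eq_iff
      simp del: nu_desc) (simp_all add: nu_desc desc_vector_field tauN_projectable)

text \<open>If \<open>\<delta> + \<beta>\<close> were positive for a negative
  \<open>\<beta>\<close>, then \<open>\<delta>\<close> would be the sum of the positive roots
  \<open>\<delta> + \<beta>\<close> and \<open>- \<beta>\<close>. Hence only the weight 0 part of
  \<open>w\<close> contributes on the right, and it stays in the root space of
  \<open>\<delta>\<close>.\<close>

lemma simple_bracket:
  assumes d: "\<delta> \<in> simple_roots" and A: "A \<in> root_space \<delta>"
  shows "br A (pn w) - pn (br A w) = - pr {\<delta>} (br A (pr pp w))"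
proof -
  have dp: "\<delta> \<in> pos" using d by (simp add: simple_roots_def)
  have An: "A \<in> \<nn>" unfolding nn_eq by (rule sp_base[OF dp A])
  have Ad: "A \<in> rsum {\<delta>}" by (rule sp_base[OF _ A]) simp
  have "pn (br A w) = pn (br A (pn w)) + pn (br A (pr pp w))"
    by (subst pr_pos_pp[symmetric, of w]) (simp only: br_simps pr_simps)
  then have 1: "br A (pn w) - pn (br A w) = - pn (br A (pr pp w))"
    using pn_id[OF nn_br[OF An pn_in]] by simp
  have "br A (pr pp w) \<in> rsum (insert \<delta> pp)"
  proof (rule br_sp[OF _ _ pp_W Ad pr_in])
    fix \<alpha> \<beta> assume a: "\<alpha> \<in> {\<delta>}" and b: "\<beta> \<in> pp" and w: "\<alpha> + \<beta> \<in> W"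
    show "\<alpha> + \<beta> \<in> insert \<delta> pp"
    proof (rule ccontr)
      assume n: "\<alpha> + \<beta> \<notin> insert \<delta> pp"
      then have "\<beta> \<noteq> 0" using a by auto
      then have "- \<beta> \<in> pos" using b W_minus by (auto simp: pos_iff neg_def)
      moreover have "\<delta> + \<beta> \<in> pos" using n w a W_cases by auto
      moreover have "\<delta> = (\<delta> + \<beta>) + (- \<beta>)" by simp
      ultimately show False using d unfolding simple_roots_def by blast
    qed
  qed (use dp pos_W in auto)
  moreover have "insert \<delta> pp \<subseteq> W" using dp pos_W pp_W by auto
  ultimately have "pn (br A (pr pp w)) = pr {\<delta>} (br A (pr pp w))"
    unfolding pr_def
  proof (rule diag_cong)
    fix \<alpha> assume "\<alpha> \<in> insert \<delta> pp"
    then show "(if \<alpha> \<in> pos then 1 else 0) = (if \<alpha> \<in> {\<delta>} then 1 else (0::real))"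
      using dp by (auto simp: pos_iff neg_def)
  qed
  with 1 show ?thesis by simp
qed

lemma nu_multicontact:
  assumes Z: "Z \<in> \<qq>"
  shows "multicontact (\<nu> Z)"
  unfolding multicontact_def
proof (intro conjI ballI)
  show "\<nu> Z \<in> vector_fields S" unfolding nu_desc by (rule desc_vector_field[OF tauN_projectable[OF Z]])
  fix \<delta> i assume d: "\<delta> \<in> simple_roots \<inter> R" and i: "i \<in> {1..m \<delta>}"
  have dp: "\<delta> \<in> pos" using d by (simp add: simple_roots_def)
  define A where "A = E \<delta> i"
  have A: "A \<in> root_space \<delta>" unfolding A_def by (rule E_root[OF dp i])
  have An: "A \<in> \<nn>" unfolding nn_eq by (rule sp_base[OF dp A])
  have Xb: "X_bar \<delta> k = desc (Linv (E \<delta> k))" if "k \<in> {1..m \<delta>}" for k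
    by (rule ext) (simp add: X_bar_eq[OF dp that] desc_def)
  define c where "c x = - br A (pr pp (iv x Z))" for x
  \<comment> \<open>\<open>c x\<close> may have components outside the root space of
    \<open>\<delta>\<close>; its coordinates along \<open>E \<delta> k\<close> select the right part
    and are polynomial in \<open>x\<close>.\<close>
  define l where "l k x = rep (c x) (E \<delta> k)" for k x
  have pc: "polynomial_function c"
    unfolding c_def[abs_def]
    by (intro polynomial_function_minus polynomial_function_linear[OF br_lin2] polynomial_function_linear[OF linear_pr] polynomial_iv)
  have bracket: "vf_bracket S (\<nu> Z) (X_bar \<delta> i) x = (\<Sum>k\<in>{1..m \<delta>}. l k x *\<^sub>R X_bar \<delta> k x)" if x: "x \<in> S" for x
  proof -
    have "vf_bracket S (\<nu> Z) (X_bar \<delta> i) x = pr R (Fd (Linv A) x (tauN Z x) - Fd (tauN Z) x (Linv A x))"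
      unfolding nu_desc Xb[OF i] A_def[symmetric] by (rule desc_bracket[OF tauN_projectable[OF Z] Linv_projectable x])
    also have "Fd (Linv A) x (tauN Z x) - Fd (tauN Z) x (Linv A x) = Linv (br (tc Z x) A - Fd (tc Z) x (Linv A x)) x"
      using Linv_bracket[OF polynomial_tc[of Z] tc_in polynomial_function_const[of A] An, of x]
      by (simp add: tauN_def[abs_def])
    also have "br (tc Z x) A - Fd (tc Z) x (Linv A x) = br A (pn (iv x Z)) - pn (br A (iv x Z))"
      unfolding Fd_tc[OF An] by (simp add: tc_def br_simps br_swap[of _ A])
    also have "\<dots> = pr {\<delta>} (c x)"
      using d simple_bracket[OF _ A] by (simp add: c_def pr_simps)
    also have "\<dots> = (\<Sum>k\<in>{1..m \<delta>}. l k x *\<^sub>R E \<delta> k)"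
      using pr_E_expansion[of "{\<delta>}" "c x"] dp by (simp add: l_def)
    also have "pr R (Linv \<dots> x) = (\<Sum>k\<in>{1..m \<delta>}. l k x *\<^sub>R pr R (Linv (E \<delta> k) x))"
      by (simp only: linear_sum[OF linear_Linv] linear_cmul[OF linear_Linv] linear_sum[OF linear_pr] linear_cmul[OF linear_pr])
    also have "\<dots> = (\<Sum>k\<in>{1..m \<delta>}. l k x *\<^sub>R X_bar \<delta> k x)"
      using x by (intro sum.cong) (auto simp: Xb desc_def)
    finally show ?thesis .
  qed
  have "smooth_on S (l k)" for k
    by (rule smooth_on_polynomial[OF subspace_S polynomial_function_linear[OF linear_rep pc]]) (simp add: l_def)
  then show "\<exists>l. (\<forall>k\<in>{1..m \<delta>}. smooth_on S (l k)) \<and>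
     (\<forall>x\<in>S. vf_bracket S (\<nu> Z) (X_bar \<delta> i) x = (\<Sum>k\<in>{1..m \<delta>}. l k x *\<^sub>R X_bar \<delta> k x))"
    using bracket by blast
qed

section \<open>The kernel\<close>

lemma simple_pos: "\<delta> \<in> simple_roots \<Longrightarrow> \<delta> \<in> pos"
  by (simp add: simple_roots_def)

text \<open>Heights \<open>\<alpha> H0\<close> are real numbers, so well-foundedness comes from the
  number of positive roots of smaller height.\<close>

lemma pos_induct [consumes 1, case_names less]:
  assumes "\<alpha> \<in> pos" "\<And>\<alpha>. \<alpha> \<in> pos \<Longrightarrow> (\<And>\<beta>. \<beta> \<in> pos \<Longrightarrow> \<beta> H0 < \<alpha> H0 \<Longrightarrow> Q \<beta>) \<Longrightarrow> Q \<alpha>"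
  shows "Q \<alpha>"
  using assms(1)
proof (induction "card {\<beta>\<in>pos. \<beta> H0 < \<alpha> H0}" arbitrary: \<alpha> rule: less_induct)
  case less
  show ?case
  proof (rule assms(2)[OF less.prems])
    fix \<beta> assume b: "\<beta> \<in> pos" "\<beta> H0 < \<alpha> H0"
    have "{\<gamma>\<in>pos. \<gamma> H0 < \<beta> H0} \<subset> {\<gamma>\<in>pos. \<gamma> H0 < \<alpha> H0}" using b by auto
    then have "card {\<gamma>\<in>pos. \<gamma> H0 < \<beta> H0} < card {\<gamma>\<in>pos. \<gamma> H0 < \<alpha> H0}"
      by (rule psubset_card_mono[rotated]) (simp add: finite_pos)
    then show "Q \<beta>" using less.hyps b(1) by blast
  qed
qed

lemma simple_nonpos_imp_nonpos:
  assumes h: "\<And>\<delta>. \<delta> \<in> simple_roots \<Longrightarrow> \<delta> h \<le> 0" and a: "\<alpha> \<in> pos"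
  shows "\<alpha> h \<le> 0"
  using a
proof (induction rule: pos_induct)
  case (less \<alpha>)
  show ?case
  proof (cases "\<alpha> \<in> simple_roots")
    case False
    then obtain \<beta> \<gamma> where "\<beta> \<in> pos" "\<gamma> \<in> pos" "\<alpha> = \<beta> + \<gamma>" using less(1) by (auto simp: simple_roots_def)
    then show ?thesis using less(2)[of \<beta>] less(2)[of \<gamma>] by (simp add: pos_iff)
  qed (rule h)
qed

text \<open>For nonzero \<open>E'\<close> the bracket is a positive multiple of the vector that
  represents \<open>\<alpha>\<close> through the Killing form, so signs of inner products of roots
  can be read off from root vectors.\<close>

lemma coroot_props:
  assumes E: "E' \<in> root_space \<alpha>"
  shows "br (\<theta> E') E' \<in> \<aa>" "H \<in> \<aa> \<Longrightarrow> killing (br (\<theta> E') E') H = \<alpha> H * ip E' E'"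
proof -
  show "br (\<theta> E') E' \<in> \<aa>"
  proof (rule \<aa>_maximal)
    show "\<theta> (br (\<theta> E') E') = - br (\<theta> E') E'" by (simp add: theta br_swap[of E'])
    show "br (\<theta> E') E' \<in> root_space 0" using br_root_space[OF theta_root_space[OF E] E] by simp
  qed
  assume H: "H \<in> \<aa>"
  have "killing (br (\<theta> E') E') H = killing (\<theta> E') (br E' H)" by (rule killing_br)
  also have "br E' H = - (\<alpha> H *\<^sub>R E')" using E H by (simp add: br_swap[of E'] root_space_def)
  finally show "killing (br (\<theta> E') E') H = \<alpha> H * ip E' E'"
    by (simp add: killing_simps ip_def killing_sym[of "\<theta> E'"])
qed

text \<open>Orthogonality to the brackets makes \<open>br (\<theta> X) E'\<close> vanish, so
  \<open>E'\<close> behaves like a lowest weight vector. Then \<open>\<alpha>\<close> has inner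
  product at most 0 with each simple root, hence with itself, against positive definiteness.\<close>

lemma nonsimple_orthogonal_imp_0:
  assumes a: "\<alpha> \<in> pos" and E: "E' \<in> root_space \<alpha>"
    and orth: "\<And>\<delta> X X'. \<delta> \<in> simple_roots \<Longrightarrow> X \<in> root_space \<delta> \<Longrightarrow> X' \<in> root_space (\<alpha> - \<delta>) \<Longrightarrow> ip E' (br X X') = 0"
  shows "E' = 0"
proof (rule ccontr)
  assume nz: "E' \<noteq> 0"
  then have pE: "ip E' E' > 0" by (rule ip.pd)
  define h where "h = br (\<theta> E') E'"
  have h: "h \<in> \<aa>" "\<And>H. H \<in> \<aa> \<Longrightarrow> killing h H = \<alpha> H * ip E' E'"
    using coroot_props[OF E] by (simp_all add: h_def)
  have "\<delta> h \<le> 0" if d: "\<delta> \<in> simple_roots" for \<delta>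
  proof -
    have "\<delta> \<in> roots" using simple_pos[OF d] H0(3) by blast
    then obtain X where X: "X \<in> root_space \<delta>" "X \<noteq> 0"
      using subspace_0[OF subspace_root_space] by (auto simp: roots_def)
    have "br (\<theta> X) E' \<in> root_space (\<alpha> - \<delta>)"
      using br_root_space[OF theta_root_space[OF X(1)] E] by simp
    from orth[OF d X(1) this] have "ip (br (\<theta> X) E') (br (\<theta> X) E') = 0"
      by (simp add: ip_adj theta)
    then have 0: "br (\<theta> X) E' = 0" by simp
    define k where "k = br (\<theta> X) X"
    have k: "k \<in> \<aa>" "\<And>H. H \<in> \<aa> \<Longrightarrow> killing k H = \<delta> H * ip X X"
      using coroot_props[OF X(1)] by (simp_all add: k_def)
    \<comment> \<open>The sl2 computation: the squared norm of \<open>br X E'\<close> becomes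
      \<open>- (\<alpha> k * ip E' E')\<close>, which fixes the sign of
      \<open>\<alpha> k\<close>.\<close>
    have "br (\<theta> X) (br X E') = \<alpha> k *\<^sub>R E'"
      using E k(1) 0 by (subst br_deriv) (simp add: k_def[symmetric] root_space_def br_simps)
    then have "ip (br X E') (br X E') = - (\<alpha> k * ip E' E')"
      using ip_adj[of X E' "br X E'"] by (simp add: ip.ip_simps)
    then have "\<alpha> k * ip E' E' \<le> 0" using ip.ip_nonneg[of "br X E'"] by simp
    then have "killing h k \<le> 0" using h(2)[OF k(1)] by simp
    then have "\<delta> h * ip X X \<le> 0" using k(2)[OF h(1)] killing_sym[of k h] by simp
    then show ?thesis using ip.pd[OF X(2)] by (simp add: mult_le_0_iff)
  qed
  then have "\<alpha> h \<le> 0" by (rule simple_nonpos_imp_nonpos[OF _ a])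
  then have "killing h h \<le> 0" using h(2)[OF h(1)] pE by (simp add: mult_nonpos_nonneg)
  then have "ip h h \<le> 0" using \<aa>_props(3)[OF h(1)] by (simp add: ip_def killing_simps)
  then have "h = 0" using ip.pd[of h] by force
  then have "\<alpha> H0 * ip E' E' = 0" using h(2)[OF H0(1)] by (simp add: killing_simps)
  then show False using a nz by (simp add: pos_iff)
qed

text \<open>In effect, \<open>\<nn>\<close> is generated by the simple root spaces.\<close>
lemma centralizes_simple_imp_centralizes_pos:
  assumes Z: "Z \<in> root_space 0" and s: "\<And>\<delta> X. \<delta> \<in> simple_roots \<Longrightarrow> X \<in> root_space \<delta> \<Longrightarrow> br Z X = 0"
    and a: "\<alpha> \<in> pos"
  shows "\<forall>X \<in> root_space \<alpha>. br Z X = 0"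
  using a
proof (induction rule: pos_induct)
  case (less \<alpha>)
  show ?case
  proof (cases "\<alpha> \<in> simple_roots")
    case True
    then show ?thesis using s by blast
  next
    case False
    have tZ: "\<theta> Z \<in> root_space 0" using theta_root_space[OF Z] by simp
    \<comment> \<open>The orthogonality test moves \<open>\<theta> Z\<close> across
      \<open>ip\<close> as \<open>- Z\<close>, and \<open>Z\<close> annihilates both factors by
      hypothesis and induction. Applied to \<open>br Z Y\<close>, the result gives
      \<open>br Z Y\<close> norm 0.\<close>
    have 1: "br (\<theta> Z) Y = 0" if Y: "Y \<in> root_space \<alpha>" for Y
    proof (rule nonsimple_orthogonal_imp_0[OF less(1)])
      show "br (\<theta> Z) Y \<in> root_space \<alpha>" using br_root_space[OF tZ Y] by simp
      fix \<delta> X X' assume d: "\<delta> \<in> simple_roots" and X: "X \<in> root_space \<delta>" and X': "X' \<in> root_space (\<alpha> - \<delta>)"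
      have "br Z X' = 0"
      proof (cases "X' = 0")
        case False
        have dp: "\<delta> \<in> pos" by (rule simple_pos[OF d])
        have ad: "\<alpha> - \<delta> \<in> \<aa>_dual"
          using dual_add[OF W_dual dual_minus[OF W_dual], of \<alpha> \<delta>] less(1) dp pos_W by auto
        have w: "\<alpha> - \<delta> \<in> W" using W_iff[OF ad] X' False by blast
        have "\<alpha> - \<delta> \<noteq> 0" using d \<open>\<alpha> \<notin> simple_roots\<close> by auto
        moreover have "\<alpha> - \<delta> \<notin> neg"
        proof
          assume "\<alpha> - \<delta> \<in> neg"
          then have "- (\<alpha> - \<delta>) \<in> pos" using W_minus[of "\<alpha> - \<delta>"] by (auto simp: neg_def pos_iff)
          moreover have "\<delta> = \<alpha> + - (\<alpha> - \<delta>)" by simp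
          ultimately show False using d less(1) unfolding simple_roots_def by blast
        qed
        ultimately have "\<alpha> - \<delta> \<in> pos" using w W_cases by blast
        moreover have "(\<alpha> - \<delta>) H0 < \<alpha> H0" using dp by (simp add: pos_iff)
        ultimately show ?thesis using less(2) X' by blast
      qed (simp add: br_simps)
      then have "br Z (br X X') = 0" using s[OF d X] by (subst br_deriv) (simp add: br_simps)
      then show "ip (br (\<theta> Z) Y) (br X X') = 0" by (simp add: ip_adj theta ip.ip_simps)
    qed
    show ?thesis
    proof
      fix Y assume Y: "Y \<in> root_space \<alpha>"
      have "br Z Y \<in> root_space \<alpha>" using br_root_space[OF Z Y] by simp
      from 1[OF this] have "ip (br Z Y) (br Z Y) = 0" by (simp add: ip_adj ip.ip_simps)
      then show "br Z Y = 0" by simp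
    qed
  qed
qed

text \<open>In \<open>Z = Y + H\<close> the part \<open>Y\<close> acts by a skew operator and
  \<open>H\<close> by scalars on root spaces, so every root vanishes on \<open>H\<close>, which is
  then central and hence 0. What remains is fixed by \<open>\<theta>\<close>, so it annihilates the
  negative root spaces too; the elements of \<open>root_space 0\<close> that annihilate all root
  spaces of roots form an ideal.\<close>

lemma centralizes_pos_imp_0:
  assumes Z: "Z \<in> root_space 0" and c: "\<And>\<alpha> X. \<alpha> \<in> pos \<Longrightarrow> X \<in> root_space \<alpha> \<Longrightarrow> br Z X = 0"
  shows "Z = 0"
proof -
  define Y where "Y = (1/2) *\<^sub>R (Z + \<theta> Z)"
  define H where "H = (1/2) *\<^sub>R (Z - \<theta> Z)"
  have YH: "Y \<in> \<mm>" "H \<in> \<aa>" using root_space_0_decomp[OF Z] by (simp_all add: Y_def H_def)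
  have ZYH: "Z = Y + H" by (simp add: Y_def H_def scaleR_add_right[symmetric] scaleR_2[symmetric])
  have aH: "\<alpha> H = 0" if a: "\<alpha> \<in> pos" for \<alpha>
  proof -
    have "\<alpha> \<in> roots" using a H0(3) by blast
    then obtain X where X: "X \<in> root_space \<alpha>" "X \<noteq> 0"
      using subspace_0[OF subspace_root_space] by (auto simp: roots_def)
    have "br Y X + \<alpha> H *\<^sub>R X = 0" using c[OF a X(1)] X(1) YH(2) by (simp add: ZYH br_simps root_space_def)
    from arg_cong[OF this, of "\<lambda>v. ip v X"] have "ip (br Y X) X + \<alpha> H * ip X X = 0"
      by (simp only: ip.ip_simps real_scaleR_def)
    moreover have "ip (br Y X) X = - ip X (br Y X)"
      using ip_adj[of Y X X] YH(1) by (simp add: \<mm>_def)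
    then have "ip (br Y X) X = 0" using ip.sym[of X "br Y X"] by linarith
    ultimately show ?thesis using X(2) by simp
  qed
  have "br H X = 0" for X
    using in_sp_W[of X]
  proof (rule sp_induct)
    show "subspace {x. br H x = 0}" by (auto simp: subspace_def br_simps)
    fix \<alpha> X assume a: "\<alpha> \<in> W" and X: "X \<in> root_space \<alpha>"
    have "\<alpha> H = 0"
    proof (cases "\<alpha> \<in> neg")
      case True
      then have "- \<alpha> \<in> pos" using W_minus by (auto simp: neg_def pos_iff)
      from aH[OF this] show ?thesis by simp
    next
      case False
      then show ?thesis using a W_cases aH by auto
    qed
    then show "br H X = 0" using X YH(2) by (simp add: root_space_def)
  qed
  then have H_0: "H = 0" by (rule ad_eq_0_imp)
  then have ZY: "Z = Y" "\<theta> Z = Z" using ZYH YH(1) by (auto simp: \<mm>_def)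
  define I where "I = {Z \<in> root_space 0. \<forall>\<alpha>\<in>pos. \<forall>X\<in>root_space \<alpha>. br Z X = 0 \<and> br Z (\<theta> X) = 0}"
  have ZI: "Z \<in> I"
  proof -
    have e: "br Z (\<theta> X) = \<theta> (br Z X)" for X by (simp only: theta(3) ZY(2))
    have "br Z (\<theta> X) = 0" if "\<alpha> \<in> pos" "X \<in> root_space \<alpha>" for \<alpha> X
      by (simp only: e c[OF that] theta_simps(4))
    then show ?thesis unfolding I_def using Z c by blast
  qed
  have sI: "subspace I"
    using subspace_root_space[of 0] by (auto simp: I_def subspace_def br_simps)
  have kill: "br Y X = 0" if Y: "Y \<in> I" and X: "\<alpha> \<in> W" "X \<in> root_space \<alpha>" "\<alpha> \<noteq> 0" for Y \<alpha> X
  proof (cases "\<alpha> \<in> pos")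
    case False
    then have "\<alpha> \<in> neg" using X W_cases by blast
    then have "- \<alpha> \<in> pos" using W_minus by (auto simp: neg_def pos_iff)
    then have "br Y (\<theta> (\<theta> X)) = 0" using Y theta_root_space[OF X(2)] by (auto simp: I_def)
    then show ?thesis by (simp add: theta)
  qed (use Y X in \<open>auto simp: I_def\<close>)
  have "br X Y \<in> I" if Y: "Y \<in> I" for X Y
    using in_sp_W[of X]
  proof (rule sp_induct)
    show "subspace {x. br x Y \<in> I}" by (rule subspace_preimage[OF br_lin1 sI])
    fix \<alpha> X assume a: "\<alpha> \<in> W" and X: "X \<in> root_space \<alpha>"
    show "br X Y \<in> I"
    proof (cases "\<alpha> = 0")
      case True
      have Y0: "Y \<in> root_space 0" using Y by (simp add: I_def)
      have X0: "X \<in> root_space 0" using X True by simp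
      have "br X Y \<in> root_space 0" using br_root_space[OF X0 Y0] by simp
      moreover have "br (br X Y) V = 0 \<and> br (br X Y) (\<theta> V) = 0" if b: "\<beta> \<in> pos" and V: "V \<in> root_space \<beta>" for \<beta> V
      proof -
        have 1: "br X V \<in> root_space \<beta>" using br_root_space[OF X0 V] by simp
        have tX: "\<theta> X \<in> root_space 0" using theta_root_space[OF X0] by simp
        have "br (\<theta> X) V \<in> root_space \<beta>" using br_root_space[OF tX V] by simp
        then have "br Y (\<theta> (br (\<theta> X) V)) = 0" using Y b by (auto simp: I_def)
        then have "br Y (br X (\<theta> V)) = 0" by (simp add: theta)
        moreover have "br Y (br X V) = 0" "br Y V = 0" "br Y (\<theta> V) = 0" using Y b 1 V by (auto simp: I_def)
        ultimately show ?thesis by (simp add: br_br br_simps)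
      qed
      ultimately show ?thesis by (auto simp: I_def)
    next
      case False
      then show ?thesis using kill[OF Y a X] br_swap[of X Y] subspace_0[OF sI] by simp
    qed
  qed
  then have "lie_ideal I" using sI by (simp add: lie_ideal_def)
  then have "I = {0} \<or> I = UNIV" using simple by (simp add: simple_def)
  \<comment> \<open>Elements of \<open>I\<close> commute with \<open>\<aa>\<close>. Were
    \<open>I\<close> everything, \<open>\<aa>\<close> would be central and hence zero, against the
    assumption on the rank.\<close>
  moreover have "I \<noteq> UNIV"
  proof
    assume "I = UNIV"
    then have "br H X = 0" if "H \<in> \<aa>" for H X
      using that by (auto simp: I_def root_space_0_iff)
    then have "\<aa> \<subseteq> {0}" using ad_eq_0_imp by blast
    then have "dim \<aa> \<le> dim {0::'g}" by (rule dim_subset)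
    also have "dim {0::'g} = 0" by simp
    finally show False using real_rank by linarith
  qed
  ultimately show "Z = 0" using ZI by blast
qed

section \<open>The kernel of \<open>\<nu>\<close> as an ideal of \<open>\<qq>\<close>\<close>

lemma tc_0: "tc Z 0 = - pn Z"
  by (simp add: tc_def iv_def pr_simps)

lemma nu_zero_iff: "\<nu> Z = 0 \<longleftrightarrow> (\<forall>x\<in>S. tc Z x \<in> \<nn>\<^sub>C)"
proof -
  have "\<nu> Z = 0 \<longleftrightarrow> (\<forall>x\<in>S. pr R (tauN Z x) = 0)"
    by (auto simp: nu_eq fun_eq_iff)
  then show ?thesis by (simp add: tauN_def Linv_nnC_iff[OF tc_in])
qed

lemma nnC_imp_nu_zero: "Z \<in> \<nn>\<^sub>C \<Longrightarrow> \<nu> Z = 0"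
proof -
  assume Z: "Z \<in> \<nn>\<^sub>C"
  have "tc Z x \<in> \<nn>\<^sub>C" for x
  proof -
    have "iv x Z \<in> \<nn>\<^sub>C"
      unfolding iv_def by (rule exp_ad_in[OF subspace_nnC Z \<qq>_nnC(1)[OF pn_in_\<qq>]])
    then show ?thesis using nnC_nn subspace_neg[OF subspace_nnC] by (simp add: tc_def pn_id subset_iff)
  qed
  then show ?thesis by (simp add: nu_zero_iff)
qed

definition J :: "'g set" where "J = {Z\<in>\<qq>. \<nu> Z = 0}"

lemma subspace_J: "subspace J"
  using subspace_\<qq> nnC_imp_nu_zero[OF zero_nnC]
  by (auto simp: J_def subspace_def fun_eq_iff nu_add nu_scale)

lemma J_br:
  assumes "Z \<in> J" "Y \<in> \<qq>"
  shows "br Z Y \<in> J" "br Y Z \<in> J"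
proof -
  have Z: "Z \<in> \<qq>" "\<nu> Z = 0" using assms(1) by (auto simp: J_def)
  have "\<nu> (br Z Y) = 0"
    by (rule ext) (simp add: nu_bracket[OF Z(1) assms(2)] vf_bracket_def Z(2))
  then show "br Z Y \<in> J" using \<qq>_br[OF Z(1) assms(2)] by (simp add: J_def)
  then show "br Y Z \<in> J" using subspace_neg[OF subspace_J] br_swap[of Y Z] by simp
qed

lemma zero_S: "0 \<in> S" by (rule subspace_0[OF subspace_S])

lemma J_pn: "Z \<in> J \<Longrightarrow> pn Z \<in> \<nn>\<^sub>C"
proof -
  assume "Z \<in> J"
  then have "tc Z 0 \<in> \<nn>\<^sub>C" using nu_zero_iff zero_S by (auto simp: J_def)
  from subspace_neg[OF subspace_nnC this] show ?thesis by (simp add: tc_0)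
qed

text \<open>\<open>J\<close> absorbs brackets with \<open>\<nn>\<close>, so \<open>br Z X\<close>
  lies in \<open>\<nn>\<^sub>C\<close> as well as in the root space of \<open>\<delta>\<close>.
  Since \<open>\<delta>\<close> is in \<open>R\<close>, these meet only in 0.\<close>

lemma J_root_space_0:
  assumes s: "simple_roots \<subseteq> R" and Z: "Z \<in> J" "Z \<in> root_space 0"
  shows "Z = 0"
proof -
  have "br Z X = 0" if d: "\<delta> \<in> simple_roots" and X: "X \<in> root_space \<delta>" for \<delta> X
  proof -
    have dp: "\<delta> \<in> pos" by (rule simple_pos[OF d])
    have Xn: "X \<in> \<nn>" unfolding nn_eq by (rule sp_base[OF dp X])
    have b: "br Z X \<in> root_space \<delta>" using br_root_space[OF Z(2) X] by simp
    then have bn: "br Z X \<in> \<nn>" unfolding nn_eq by (rule sp_base[OF dp])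
    have "br Z X \<in> J" using J_br(1)[OF Z(1)] Xn nn_\<qq> by blast
    then have "br Z X \<in> \<nn>\<^sub>C" using J_pn[of "br Z X"] pn_id[OF bn] by simp
    then have "pr R (br Z X) = 0" by (simp add: nnC_iff)
    then show ?thesis using pr_root[OF subsetD[OF pos_W dp] b, of R] subsetD[OF s d] by simp
  qed
  then have "\<forall>X\<in>root_space \<alpha>. br Z X = 0" if "\<alpha> \<in> pos" for \<alpha>
    using centralizes_simple_imp_centralizes_pos[OF Z(2) _ that] by blast
  then show ?thesis by (intro centralizes_pos_imp_0[OF Z(2)]) blast
qed

text \<open>Lagrange interpolation: the projection is a polynomial in \<open>ad H0\<close> with one
  linear factor for each other eigenvalue.\<close>

lemma eigenprojection_in:
  assumes V: "subspace V" "\<And>X. X \<in> V \<Longrightarrow> br H0 X \<in> V" and Z: "Z \<in> V"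
  shows "pr {\<alpha>\<in>W. \<alpha> H0 = c} Z \<in> V"
proof -
  have 1: "diag (\<lambda>\<alpha>. \<Prod>c'\<in>T. (\<alpha> H0 - c') / (c - c')) Z \<in> V" if "finite T" for T
    using that
  proof (induction T rule: finite_induct)
    case empty
    show ?case using Z by (simp add: diag_1)
  next
    case (insert c' T)
    let ?Y = "diag (\<lambda>\<alpha>. \<Prod>c'\<in>T. (\<alpha> H0 - c') / (c - c')) Z"
    have "diag (\<lambda>\<alpha>. \<Prod>c'\<in>insert c' T. (\<alpha> H0 - c') / (c - c')) Z = diag (\<lambda>\<alpha>. (\<alpha> H0 - c') / (c - c')) ?Y"
      unfolding diag_diag using insert(1,2) by simp
    also have "\<dots> = (1 / (c - c')) *\<^sub>R (diag (\<lambda>\<alpha>. \<alpha> H0) ?Y - c' *\<^sub>R diag (\<lambda>\<alpha>. 1) ?Y)"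
      unfolding diag_def[of _ ?Y]
      by (simp add: scaleR_sum_right sum_subtractf[symmetric] algebra_simps diff_divide_distrib)
    also have "\<dots> \<in> V"
      unfolding ad_H0_diag[symmetric] diag_1
      by (intro subspace_scale[OF V(1)] subspace_diff[OF V(1)] V(2) insert.IH)
    finally show ?case .
  qed
  define T where "T = (\<lambda>\<alpha>. \<alpha> H0) ` W - {c}"
  have fT: "finite T" by (simp add: T_def finite_W)
  have "diag (\<lambda>\<alpha>. \<Prod>c'\<in>T. (\<alpha> H0 - c') / (c - c')) Z = pr {\<alpha>\<in>W. \<alpha> H0 = c} Z"
    unfolding pr_def
  proof (rule diag_cong[OF in_sp_W order_refl])
    fix \<alpha> assume a: "\<alpha> \<in> W"
    show "(\<Prod>c'\<in>T. (\<alpha> H0 - c') / (c - c')) = (if \<alpha> \<in> {\<alpha>\<in>W. \<alpha> H0 = c} then 1 else 0)"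
    proof (cases "\<alpha> H0 = c")
      case True
      then show ?thesis using a by (auto simp: T_def intro!: prod.neutral)
    next
      case False
      then have "\<alpha> H0 \<in> T" using a by (simp add: T_def)
      then have "(\<Prod>c'\<in>T. (\<alpha> H0 - c') / (c - c')) = 0" using fT by (auto intro!: prod_zero bexI[of _ "\<alpha> H0"])
      then show ?thesis using False by simp
    qed
  qed
  then show ?thesis using 1[OF fT] by simp
qed

lemma J_eigen:
  assumes Z: "Z \<in> J"
  shows "pr {\<alpha>\<in>W. \<alpha> H0 = c} Z \<in> J"
  by (rule eigenprojection_in[OF subspace_J _ Z]) (rule J_br(2)[OF _ H0_\<qq>])

lemma W_H0_zero: "{\<alpha>\<in>W. \<alpha> H0 = 0} = {0}"
  using W_H0 by (auto simp: W_def)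

lemma J_negative:
  assumes s: "simple_roots \<subseteq> R" and Z: "Z \<in> J" and c: "c < 0"
  shows "pr {\<alpha>\<in>W. \<alpha> H0 = c} Z = 0"
proof (rule ccontr)
  let ?A = "{\<alpha>\<in>W. \<alpha> H0 = c}" and ?B = "{\<alpha>\<in>W. \<alpha> H0 = - c}"
  define Y where "Y = pr ?A Z"
  assume "pr ?A Z \<noteq> 0"
  then have nz: "Y \<noteq> 0" by (simp add: Y_def)
  have YJ: "Y \<in> J" unfolding Y_def by (rule J_eigen[OF Z])
  have YA: "Y \<in> rsum ?A" unfolding Y_def by (rule pr_in)
  have tY: "\<theta> Y \<in> rsum ?B"
    using YA
  proof (rule sp_induct)
    show "subspace {x. \<theta> x \<in> rsum ?B}" by (rule subspace_preimage[OF theta(1) subspace_sp])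
  qed (use W_minus in \<open>auto intro!: sp_base[OF _ theta_root_space]\<close>)
  have "?B \<subseteq> pos" using c by (auto simp: pos_iff)
  then have "\<theta> Y \<in> \<nn>" using tY sp_mono unfolding nn_eq by blast
  \<comment> \<open>\<open>J\<close> is an ideal of \<open>\<qq>\<close>, so the bracket with
    \<open>\<theta> Y\<close> is available only inside \<open>\<qq>\<close>; the sign of
    \<open>c\<close> is what puts \<open>\<theta> Y\<close> there.\<close>
  then have "\<theta> Y \<in> \<qq>" using nn_\<qq> by blast
  then have UJ: "br Y (\<theta> Y) \<in> J" using J_br(1)[OF YJ] by blast
  have "br Y (\<theta> Y) \<in> rsum {0}"
    by (rule br_sp[OF _ _ _ YA tY]) (use W_H0 in auto)
  then have "br Y (\<theta> Y) = 0" using J_root_space_0[OF s UJ] by (simp add: sp_zero)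
  \<comment> \<open>Pairing with \<open>H0\<close> and invariance of the form turn the vanishing
    bracket into \<open>c * killing Y (\<theta> Y) = 0\<close>.\<close>
  then have "killing (br Y (\<theta> Y)) H0 = 0" by (simp add: killing_simps)
  then have "killing Y (br (\<theta> Y) H0) = 0" by (simp add: killing_br)
  moreover have "br (\<theta> Y) H0 = c *\<^sub>R \<theta> Y"
  proof -
    have "br (\<theta> Y) H0 = diag (\<lambda>\<alpha>. c) (\<theta> Y)"
      unfolding br_H0 by (rule diag_cong[OF tY]) auto
    also have "\<dots> = c *\<^sub>R diag (\<lambda>\<alpha>. 1) (\<theta> Y)" by (simp add: diag_def scaleR_sum_right)
    finally show ?thesis by (simp add: diag_1)
  qed
  ultimately have "killing Y (\<theta> Y) = 0" using c by (simp add: killing_simps)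
  then show False using theta(4)[OF nz] by simp
qed

lemma J_eq:
  assumes s: "simple_roots \<subseteq> R"
  shows "J = \<nn>\<^sub>C"
proof
  show "\<nn>\<^sub>C \<subseteq> J" using nnC_\<qq> nnC_imp_nu_zero by (auto simp: J_def)
  show "J \<subseteq> \<nn>\<^sub>C"
  proof
    fix Z assume Z: "Z \<in> J"
    have "pr {0} Z \<in> J" using J_eigen[OF Z, of 0] by (simp only: W_H0_zero)
    moreover have "pr {0} Z \<in> root_space 0" using pr_in[of "{0}" Z] by (simp add: sp_zero)
    ultimately have 0: "pr {0} Z = 0" by (rule J_root_space_0[OF s])
    \<comment> \<open>Distinct roots may take the same value at \<open>H0\<close>; the projection to
      one root space factors through the eigenprojection.\<close>
    have single: "pr {\<alpha>} Z = 0" if a: "\<alpha> \<in> neg" for \<alpha>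
    proof -
      have "pr {\<alpha>} Z = pr {\<alpha>} (pr {\<beta>\<in>W. \<beta> H0 = \<alpha> H0} Z)"
        using a by (simp add: pr_pr neg_def Int_absorb2)
      then show ?thesis using J_negative[OF s Z, of "\<alpha> H0"] a by (simp add: neg_def pr_simps)
    qed
    have "pr A Z = 0" if "finite A" "A \<subseteq> neg" for A
      using that
    proof (induction A rule: finite_induct)
      case empty
      show ?case using pr_zero[OF in_sp_W, of "{}" Z] by simp
    next
      case (insert \<alpha> A)
      then show ?case using pr_add_disjoint[of "{\<alpha>}" A Z] single by simp
    qed
    then have "pr neg Z = 0" using finite_subset[OF neg_W finite_W] by blast
    then have "pr pp Z = 0" using 0 pr_add_disjoint[of neg "{0}" Z] by (simp add: neg_def)
    then have "pn Z = Z" using pr_pos_pp[of Z] by simp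
    then show "Z \<in> \<nn>\<^sub>C" using J_pn[OF Z] by simp
  qed
qed

lemma kernel_eq: "simple_roots \<subseteq> R \<Longrightarrow> {Z\<in>\<qq>. \<nu> Z = 0} = \<nn>\<^sub>C"
  using J_eq by (simp add: J_def)

text \<open>The inverse isomorphism sends a field to its fibre under \<open>\<nu>\<close>, which is a coset of \<open>\<nn>\<^sub>C\<close>.\<close>
lemma image_isomorphic_quotient:
  assumes s: "simple_roots \<subseteq> R"
  shows "lie_isomorphic ((vf_lie S)\<lparr>lcarrier := \<nu> ` \<qq>\<rparr>) (quot_lie br \<qq> \<nn>\<^sub>C)"
proof -
  define cs where "cs X = {X + Z |Z. Z \<in> \<nn>\<^sub>C}" for X
  define f where "f F = {Z\<in>\<qq>. \<nu> Z = F}" for F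
  have diff: "\<nu> X = \<nu> Y \<longleftrightarrow> X - Y \<in> \<nn>\<^sub>C" if "X \<in> \<qq>" "Y \<in> \<qq>" for X Y
  proof -
    have "\<nu> X x = \<nu> (X - Y) x + \<nu> Y x" for x using nu_add[of "X - Y" Y x] by simp
    then have "\<nu> X = \<nu> Y \<longleftrightarrow> \<nu> (X - Y) = 0" by (auto simp: fun_eq_iff)
    then show ?thesis using kernel_eq[OF s] subspace_diff[OF subspace_\<qq> that] by blast
  qed
  have cs_iff: "Y \<in> cs X \<longleftrightarrow> Y - X \<in> \<nn>\<^sub>C" for X Y
    by (force simp: cs_def algebra_simps intro: exI[of _ "Y - X"])
  have f_nu: "f (\<nu> X) = cs X" if X: "X \<in> \<qq>" for X
  proof -
    have "Y \<in> \<qq>" if "Y - X \<in> \<nn>\<^sub>C" for Y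
      using subspace_add[OF subspace_\<qq> subsetD[OF nnC_\<qq> that] X] by simp
    then show ?thesis using diff X by (auto simp: f_def cs_iff)
  qed
  have cs_eqI: "cs X = cs Y" if "X - Y \<in> \<nn>\<^sub>C" for X Y
  proof -
    have "Z - X \<in> \<nn>\<^sub>C \<longleftrightarrow> Z - Y \<in> \<nn>\<^sub>C" for Z
      using subspace_add[OF subspace_nnC _ that, of "Z - X"] subspace_diff[OF subspace_nnC _ that, of "Z - Y"] by auto
    then show ?thesis by (auto simp: cs_iff)
  qed
  have cs_self: "X \<in> cs X" for X by (simp add: cs_iff zero_nnC)
  \<comment> \<open>The set on the right is the sum of cosets in \<open>quot_lie\<close>. From left
    to right \<open>X\<close> and \<open>Y\<close> represent their own cosets, and the rest of the
    element is absorbed by \<open>Z\<close>.\<close>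
  have add: "cs (X + Y) = {X' + Y' + Z |X' Y' Z. X' \<in> cs X \<and> Y' \<in> cs Y \<and> Z \<in> \<nn>\<^sub>C}" for X Y
  proof (intro set_eqI iffI)
    fix V assume "V \<in> cs (X + Y)"
    then have "V = X + Y + (V - (X + Y)) \<and> X \<in> cs X \<and> Y \<in> cs Y \<and> V - (X + Y) \<in> \<nn>\<^sub>C"
      by (simp add: cs_iff zero_nnC)
    then show "V \<in> {X' + Y' + Z |X' Y' Z. X' \<in> cs X \<and> Y' \<in> cs Y \<and> Z \<in> \<nn>\<^sub>C}" by blast
  next
    fix V assume "V \<in> {X' + Y' + Z |X' Y' Z. X' \<in> cs X \<and> Y' \<in> cs Y \<and> Z \<in> \<nn>\<^sub>C}"
    then obtain X' Y' Z where V: "V = X' + Y' + Z" "X' - X \<in> \<nn>\<^sub>C" "Y' - Y \<in> \<nn>\<^sub>C" "Z \<in> \<nn>\<^sub>C" by (auto simp: cs_iff)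
    have "(X' - X) + (Y' - Y) + Z \<in> \<nn>\<^sub>C" by (intro subspace_add[OF subspace_nnC] V)
    then show "V \<in> cs (X + Y)" by (simp add: V(1) cs_iff algebra_simps)
  qed
  have scale: "cs (c *\<^sub>R X) = {c *\<^sub>R X' + Z |X' Z. X' \<in> cs X \<and> Z \<in> \<nn>\<^sub>C}" for c X
  proof (intro set_eqI iffI)
    fix V assume "V \<in> cs (c *\<^sub>R X)"
    then have "V = c *\<^sub>R X + (V - c *\<^sub>R X) \<and> X \<in> cs X \<and> V - c *\<^sub>R X \<in> \<nn>\<^sub>C"
      by (simp add: cs_iff zero_nnC)
    then show "V \<in> {c *\<^sub>R X' + Z |X' Z. X' \<in> cs X \<and> Z \<in> \<nn>\<^sub>C}" by blast
  next
    fix V assume "V \<in> {c *\<^sub>R X' + Z |X' Z. X' \<in> cs X \<and> Z \<in> \<nn>\<^sub>C}"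
    then obtain X' Z where V: "V = c *\<^sub>R X' + Z" "X' - X \<in> \<nn>\<^sub>C" "Z \<in> \<nn>\<^sub>C" by (auto simp: cs_iff)
    have "c *\<^sub>R (X' - X) + Z \<in> \<nn>\<^sub>C" by (intro subspace_add[OF subspace_nnC] subspace_scale[OF subspace_nnC] V)
    then show "V \<in> cs (c *\<^sub>R X)" by (simp add: V(1) cs_iff algebra_simps)
  qed
  have bracket: "cs (br X Y) = {br X' Y' + Z |X' Y' Z. X' \<in> cs X \<and> Y' \<in> cs Y \<and> Z \<in> \<nn>\<^sub>C}"
    if q: "X \<in> \<qq>" "Y \<in> \<qq>" for X Y
  proof (intro set_eqI iffI)
    fix V assume "V \<in> cs (br X Y)"
    then have "V = br X Y + (V - br X Y) \<and> X \<in> cs X \<and> Y \<in> cs Y \<and> V - br X Y \<in> \<nn>\<^sub>C"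
      by (simp add: cs_iff zero_nnC)
    then show "V \<in> {br X' Y' + Z |X' Y' Z. X' \<in> cs X \<and> Y' \<in> cs Y \<and> Z \<in> \<nn>\<^sub>C}" by blast
  next
    fix V assume "V \<in> {br X' Y' + Z |X' Y' Z. X' \<in> cs X \<and> Y' \<in> cs Y \<and> Z \<in> \<nn>\<^sub>C}"
    then obtain X' Y' Z where V: "V = br X' Y' + Z" "X' - X \<in> \<nn>\<^sub>C" "Y' - Y \<in> \<nn>\<^sub>C" "Z \<in> \<nn>\<^sub>C" by (auto simp: cs_iff)
    have X': "X' \<in> \<qq>" using subspace_add[OF subspace_\<qq> subsetD[OF nnC_\<qq> V(2)] q(1)] by simp
    have "br X' (Y' - Y) + br (X' - X) Y + Z \<in> \<nn>\<^sub>C"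
      by (intro subspace_add[OF subspace_nnC] V \<qq>_nnC X' q)
    then show "V \<in> cs (br X Y)" by (simp add: V(1) cs_iff br_simps algebra_simps)
  qed
  have sums: "(\<lambda>x. \<nu> X x + \<nu> Y x) = \<nu> (X + Y)" "(\<lambda>x. c *\<^sub>R \<nu> X x) = \<nu> (c *\<^sub>R X)" for X Y c
    by (simp_all add: fun_eq_iff nu_add nu_scale)
  have Q: "lcarrier (quot_lie br \<qq> \<nn>\<^sub>C) = cs ` \<qq>"
    by (simp add: quot_lie_def cs_def)
  have "f \<in> lie_hom ((vf_lie S)\<lparr>lcarrier := \<nu> ` \<qq>\<rparr>) (quot_lie br \<qq> \<nn>\<^sub>C)"
    unfolding lie_hom_def
  proof (intro CollectI conjI)
    show "\<forall>x\<in>lcarrier ((vf_lie S)\<lparr>lcarrier := \<nu> ` \<qq>\<rparr>). f x \<in> lcarrier (quot_lie br \<qq> \<nn>\<^sub>C)"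
      by (auto simp: Q f_nu)
  qed (auto simp: vf_lie_def quot_lie_def sums nu_bracket[symmetric] f_nu add scale bracket
      subspace_add[OF subspace_\<qq>] subspace_scale[OF subspace_\<qq>] \<qq>_br)
  moreover have "bij_betw f (\<nu> ` \<qq>) (cs ` \<qq>)"
    unfolding bij_betw_def
  proof
    show "inj_on f (\<nu> ` \<qq>)"
    proof (rule inj_onI)
      fix F G assume "F \<in> \<nu> ` \<qq>" "G \<in> \<nu> ` \<qq>" "f F = f G"
      then show "F = G" by (auto simp: f_def)
    qed
    show "f ` \<nu> ` \<qq> = cs ` \<qq>" by (simp add: image_image f_nu)
  qed
  ultimately show ?thesis unfolding lie_isomorphic_def by (auto simp: Q)
qed

end

theorem theorem20:
  fixes br :: "'g::euclidean_space \<Rightarrow> 'g \<Rightarrow> 'g" and \<theta> :: "'g \<Rightarrow> 'g" and \<aa> :: "'g set"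
    and pos :: "('g \<Rightarrow> real) set" and E :: "('g \<Rightarrow> real) \<Rightarrow> nat \<Rightarrow> 'g" and R :: "('g \<Rightarrow> real) set"
  assumes "hessenberg_setting br \<theta> \<aa> pos E R"
  shows "let S = hessenberg_setting.S br \<aa> pos E R;
             \<qq> = hessenberg_setting.\<qq> br \<aa> pos R;
             \<nn>\<^sub>C = hessenberg_setting.\<nn>\<^sub>C br \<aa> pos R;
             \<nu> = hessenberg_setting.\<nu> br \<theta> \<aa> pos E R
         in (\<forall>Z\<in>\<qq>. hessenberg_setting.multicontact br \<aa> pos E R (\<nu> Z)) \<and>
            \<nu> \<in> lie_hom (sub_lie br \<qq>) (vf_lie S) \<and>
            (hessenberg_setting.simple_roots pos \<subseteq> R \<longrightarrow>
               {Z\<in>\<qq>. \<nu> Z = 0} = \<nn>\<^sub>C \<and>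
               lie_isomorphic ((vf_lie S)\<lparr>lcarrier := \<nu> ` \<qq>\<rparr>) (quot_lie br \<qq> \<nn>\<^sub>C))"
proof -
  interpret hessenberg_setting br \<theta> \<aa> pos E R by (rule assms)
  show ?thesis
    unfolding Let_def
    using nu_multicontact nu_lie_hom kernel_eq image_isomorphic_quotient by blast
qed

end
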